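(* Let $m\ge 1$ and let $n_1,n_2\ge m$ be integers. Let $\Sigma_2$ be an $m\times m$ real symmetric positive definite matrix, and let $W_1\sim W_m(n_1,I_m)$ and $W_2\sim W_m(n_2,\Sigma_2)$ be independent Wishart matrices. Let $W_2^{1/2}$ be the unique positive definite square root of $W_2$, let $W_2^{-1/2}$ be its inverse, and put $U=W_2^{-1/2}W_1W_2^{-1/2}$. Then the density function of $U$ (on $U\ge 0$) is $$f(U)=\frac{\Gamma_m\left(\frac{n_1+n_2}{2}\right)\,|\Sigma_2|^{n_1/2}}{\Gamma_m\left(\frac{n_1}{2}\right)\Gamma_m\left(\frac{n_2}{2}\right)}\;|I_m+\Sigma_2U|^{-(n_1+n_2)/2}\;|U|^{(n_1-m-1)/2}.$$
   Context: $W_m(n,\Sigma)$ denotes the $m\times m$ (central) Wishart distribution with $n$ degrees of freedom and covariance matrix $\Sigma$, i.e. the distribution of $\sum_{k=1}^n z_kz_k^\top$ for independent $z_k\sim N_m(0,\Sigma)$. $|\cdot|$ denotes the determinant and $I_m$ the $m\times m$ identity matrix. For symmetric matrices, $A\ge 0$ means that $A$ is positive semidefinite. Densities of random symmetric matrices are with respect to Lebesgue measure $dU=\prod_{1\le i\le j\le m}du_{ij}$ on the space of real symmetric $m\times m$ matrices. The multivariate gamma function is $\Gamma_m(a)=\pi^{m(m-1)/4}\prod_{i=1}^m\Gamma\left(a-\frac{i-1}{2}\right)$ for $a>\frac{m-1}{2}$. *)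

theory Defs
  imports "HOL-Probability.Probability"
begin

definition psd_matrix :: "real ^ 'm ^ 'm \<Rightarrow> bool" where
  "psd_matrix A \<longleftrightarrow> transpose A = A \<and> (\<forall>x. 0 \<le> x \<bullet> (A *v x))"

definition pd_matrix :: "real ^ 'm ^ 'm \<Rightarrow> bool" where
  "pd_matrix A \<longleftrightarrow> transpose A = A \<and> (\<forall>x. x \<noteq> 0 \<longrightarrow> 0 < x \<bullet> (A *v x))"

(* Meaningful for positive definite A. On all other A the predicate is unsatisfiable, so
   matrix_sqrt takes one and the same unspecified value there. *)
definition matrix_sqrt :: "real ^ 'm ^ 'm \<Rightarrow> real ^ 'm ^ 'm" where
  "matrix_sqrt A = (THE B. pd_matrix B \<and> B ** B = A)"

(* N_m(0, S), given by its density; only meant for positive definite S. *)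
definition mvnormal :: "real ^ 'm ^ 'm \<Rightarrow> (real ^ 'm) measure" where
  "mvnormal S = density lborel
     (\<lambda>x. ennreal ((2 * pi) powr (- real CARD('m) / 2) * det S powr (- 1 / 2) *
       exp (- (x \<bullet> (matrix_inv S *v x)) / 2)))"

(* Independence of z 0, ..., z (n - 1) is encoded by the product measure. *)
definition wishart :: "nat \<Rightarrow> real ^ 'm ^ 'm \<Rightarrow> (real ^ 'm ^ 'm) measure" where
  "wishart n S = distr (\<Pi>\<^sub>M k\<in>{..<n}. mvnormal S) borel
     (\<lambda>z. \<Sum>k<n. (\<chi> i j. z k $ i * z k $ j))"

definition multivariate_gamma :: "nat \<Rightarrow> real \<Rightarrow> real" where
  "multivariate_gamma m a =
     pi powr (real (m * (m - 1)) / 4) * (\<Prod>i=1..m. Gamma (a - (real i - 1) / 2))"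

definition sym_of_upper :: "('m \<times> 'm \<Rightarrow> real) \<Rightarrow> real ^ ('m::{finite,linorder}) ^ ('m::{finite,linorder})" where
  "sym_of_upper u = (\<chi> i j. u (min i j, max i j))"

(* Lebesgue measure on the symmetric matrices (the product of the du_ij with i <= j), regarded as
   a measure on all m x m matrices that is concentrated on the symmetric ones. It is not lborel on
   real ^ 'm ^ 'm, for which the symmetric matrices are a null set if m >= 2. *)
definition sym_lborel :: "(real ^ ('m::{finite,linorder}) ^ ('m::{finite,linorder})) measure" where
  "sym_lborel = distr (\<Pi>\<^sub>M p\<in>{(i, j). i \<le> j}. lborel) borel sym_of_upper"

lemma measurable_sym_of_upper:
  "sym_of_upper \<in> borel_measurable
     (\<Pi>\<^sub>M p\<in>{(i, j). i \<le> (j :: 'm::{finite,linorder})}. lborel)"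
proof -
  have "(\<lambda>u. u (min i j, max i j)) \<in> borel_measurable
          (\<Pi>\<^sub>M p\<in>{(i, j). i \<le> (j :: 'm)}. lborel)" for i j :: 'm
    using measurable_component_singleton
      [of "(min i j, max i j)" "{(i, j). i \<le> (j :: 'm)}" "\<lambda>_. lborel :: real measure"]
    by (simp add: min.coboundedI1)
  then show ?thesis
    unfolding sym_of_upper_def
    by (subst borel_measurable_euclidean_space)
       (auto simp: Basis_vec_def inner_axis)
qed

lemma measurable_outer_product_sum:
  fixes S :: "real ^ 'm ^ 'm"
  shows "(\<lambda>z. \<Sum>k<n. (\<chi> i j. z k $ i * z k $ j)) \<in> borel_measurable
     (\<Pi>\<^sub>M k\<in>{..<n}. mvnormal S)"
proof (rule borel_measurable_sum)
  fix k assume k: "k \<in> {..<n}"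
  have [measurable]: "(\<lambda>z. z k) \<in> borel_measurable (\<Pi>\<^sub>M k\<in>{..<n}. mvnormal S)"
    using measurable_component_singleton[of k "{..<n}" "\<lambda>_. mvnormal S"] k
    by (simp add: mvnormal_def cong: measurable_cong_sets)
  have "continuous_on UNIV (\<lambda>x :: real ^ 'm. (\<chi> i j. x $ i * x $ j) :: real ^ 'm ^ 'm)"
    by (intro continuous_intros)
  then have "(\<lambda>x :: real ^ 'm. (\<chi> i j. x $ i * x $ j) :: real ^ 'm ^ 'm) \<in> borel_measurable borel"
    by (rule borel_measurable_continuous_onI)
  then show "(\<lambda>z. (\<chi> i j. z k $ i * z k $ j) :: real ^ 'm ^ 'm) \<in> borel_measurable
     (\<Pi>\<^sub>M k\<in>{..<n}. mvnormal S)"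
    by (rule measurable_compose[rotated]) measurable
qed

end

(* No Jacobian on the space of symmetric matrices is computed. The push-forward of Lebesgue measure under
   Z |-> Z Z^T is found by induction on the rows (Bartlett): rotate the columns so that the last row v becomes
   (t, 0, ..., 0); then the remaining rows are b_i = Z_i1 and a smaller matrix Z', with Gram entries t b_i and
   b_i b_j + (Z' Z'^T)_ij, and r = t^2 = |v|^2 has density proportional to r^(n/2 - 1). In the coordinates
   a = t b the Gram matrix of Z' is the Schur complement of r, and det S = r * det (Schur complement).
   This gives a density C(m,n) det(S)^((n-m-1)/2) on the positive definite matrices, with
   C(m,n) = pi^(nm/2) / Gamma_m(n/2). Given W2 = Y, the columns z of the first sample become Y^(-1/2) z, so
   the density of U at X, given Y, is proportional to
   det(Y)^(n1/2) exp(- tr(Y X) / 2) det(X)^((n1-m-1)/2). Integrating Y out against its Wishart density is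
   again an integral over a Gram matrix, now with n1 + n2 columns, of a Gaussian with precision
   Sigma2^(-1) + X. *)
theory Submission
  imports Defs
begin

section \<open>Product Lebesgue measure\<close>

text \<open>Every law is stated as an identity of nonnegative integrals against an arbitrary
  measurable function, so Tonelli moves constants and densities around without any integrability
  question. The induction closes because of a coincidence of exponents: with n columns and p other
  rows, the law of r contributes r^(n/2 - 1) and the substitution a = t b contributes r^(-p/2).
  Together they give r^((n - p - 2)/2), and (n - p - 2)/2 is also the exponent of the Schur
  complement for p rows and n - 1 columns; so both powers combine to one power of det S, and each
  row leaves behind one factor pi^(k/2) / Gamma(k/2), k being its number of columns. A separate
  obstacle is the root of W2. It is a definite description, and existence, uniqueness and Borel
  measurability on the positive definite cone have to be known before U is a random variable.
  Existence and continuity are obtained topologically, without eigenvalues. Singular matrices carry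
  no mass, and \<open>0 powr x = 0\<close> makes the claimed density vanish on them.\<close>

abbreviation lborel_PiM :: "'i set \<Rightarrow> ('i \<Rightarrow> real) measure" where
  "lborel_PiM I \<equiv> PiM I (\<lambda>_. lborel)"

interpretation lborel_prod: product_sigma_finite "\<lambda>_. lborel :: 'a::euclidean_space measure"
  by standard

lemma nn_integral_lborel_PiM_affine:
  fixes a h :: "'i \<Rightarrow> real"
  assumes "finite J" and "\<And>p. p \<in> J \<Longrightarrow> a p \<noteq> 0"
    and "H \<in> borel_measurable (lborel_PiM J)"
  shows "(\<integral>\<^sup>+x. H (\<lambda>p\<in>J. a p * x p + h p) \<partial>lborel_PiM J) =
    ennreal (\<Prod>p\<in>J. 1 / \<bar>a p\<bar>) * (\<integral>\<^sup>+x. H x \<partial>lborel_PiM J)"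
  using assms
proof (induction J arbitrary: H rule: finite_induct)
  case empty
  then show ?case by (simp add: PiM_empty nn_integral_count_space_finite)
next
  case (insert i J)
  note [measurable] = insert.prems(2)
  have ai: "a i \<noteq> 0" using insert.prems(1) by simp
  have m0: "(\<lambda>x. \<lambda>p\<in>insert i J. a p * x p + h p) \<in> lborel_PiM (insert i J) \<rightarrow>\<^sub>M lborel_PiM (insert i J)"
    by measurable
  have upd: "(\<lambda>p\<in>insert i J. a p * (x(i := y)) p + h p) = (\<lambda>p\<in>J. a p * x p + h p)(i := a i * y + h i)"
    for x and y :: real
    using insert.hyps(2) by (auto simp: fun_eq_iff)
  have m1: "(\<lambda>y. H (x(i := y))) \<in> borel_measurable lborel" if "x \<in> space (lborel_PiM J)" for x
    using measurable_compose[OF measurable_component_update[OF that insert.hyps(2)] insert.prems(2)] .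
  have inner: "(\<integral>\<^sup>+y. H (x(i := a i * y + h i)) \<partial>lborel) = ennreal (1 / \<bar>a i\<bar>) * (\<integral>\<^sup>+y. H (x(i := y)) \<partial>lborel)"
    if "x \<in> space (lborel_PiM J)" for x
    using nn_integral_real_affine[OF m1[OF that, unfolded measurable_lborel2] ai, of "h i"] ai
    by (simp add: add.commute mult.assoc[symmetric] ennreal_mult[symmetric])
  have m2[measurable]: "(\<lambda>x. \<integral>\<^sup>+y. H (x(i := y)) \<partial>lborel) \<in> borel_measurable (lborel_PiM J)"
    by measurable
  have "(\<integral>\<^sup>+x. H (\<lambda>p\<in>insert i J. a p * x p + h p) \<partial>lborel_PiM (insert i J)) =
      (\<integral>\<^sup>+x. \<integral>\<^sup>+y. H ((\<lambda>p\<in>J. a p * x p + h p)(i := a i * y + h i)) \<partial>lborel \<partial>lborel_PiM J)"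
    using lborel_prod.product_nn_integral_insert[OF insert.hyps measurable_compose[OF m0 insert.prems(2)]]
    by (simp only: upd)
  also have "\<dots> = (\<integral>\<^sup>+x. ennreal (1 / \<bar>a i\<bar>) * (\<integral>\<^sup>+y. H ((\<lambda>p\<in>J. a p * x p + h p)(i := y)) \<partial>lborel) \<partial>lborel_PiM J)"
    by (intro nn_integral_cong inner) (auto simp: space_PiM)
  also have "\<dots> = ennreal (1 / \<bar>a i\<bar>) * (\<integral>\<^sup>+x. (\<integral>\<^sup>+y. H ((\<lambda>p\<in>J. a p * x p + h p)(i := y)) \<partial>lborel) \<partial>lborel_PiM J)"
    by (rule nn_integral_cmult) measurable
  also have "(\<integral>\<^sup>+x. (\<integral>\<^sup>+y. H ((\<lambda>p\<in>J. a p * x p + h p)(i := y)) \<partial>lborel) \<partial>lborel_PiM J) =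
      ennreal (\<Prod>p\<in>J. 1 / \<bar>a p\<bar>) * (\<integral>\<^sup>+x. (\<integral>\<^sup>+y. H (x(i := y)) \<partial>lborel) \<partial>lborel_PiM J)"
    by (rule insert.IH[OF _ m2]) (use insert.prems in auto)
  also have "(\<integral>\<^sup>+x. (\<integral>\<^sup>+y. H (x(i := y)) \<partial>lborel) \<partial>lborel_PiM J) = (\<integral>\<^sup>+x. H x \<partial>lborel_PiM (insert i J))"
    by (rule lborel_prod.product_nn_integral_insert[OF insert.hyps insert.prems(2), symmetric])
  finally show ?case
    using insert.hyps by (simp add: mult.assoc[symmetric] ennreal_mult[symmetric] prod_nonneg)
qed

lemma nn_integral_lborel_PiM_translate:
  assumes "finite J" and "H \<in> borel_measurable (lborel_PiM J)"
  shows "(\<integral>\<^sup>+x. H (\<lambda>p\<in>J. x p + h p) \<partial>lborel_PiM J) = (\<integral>\<^sup>+x. H x \<partial>lborel_PiM J)"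
  using nn_integral_lborel_PiM_affine[OF assms(1) _ assms(2), of "\<lambda>_. 1" h] by simp

text \<open>With the coordinates in \<open>K\<close> frozen, the map only translates the block
  \<open>J\<close>. Tonelli and translation invariance therefore suffice, and the shift
  \<open>h\<close> has to be measurable but not differentiable.\<close>

lemma nn_integral_lborel_PiM_shear:
  assumes "finite J" "finite K" "J \<inter> K = {}"
    and H: "H \<in> borel_measurable (lborel_PiM (K \<union> J))"
    and h: "\<And>p. p \<in> J \<Longrightarrow> (\<lambda>y. h y p) \<in> borel_measurable (lborel_PiM K)"
  shows "(\<integral>\<^sup>+z. H (\<lambda>p\<in>K \<union> J. if p \<in> J then z p + h (restrict z K) p else z p) \<partial>lborel_PiM (K \<union> J)) =
    (\<integral>\<^sup>+z. H z \<partial>lborel_PiM (K \<union> J))"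
proof -
  note [measurable] = H h
  have KJ: "K \<inter> J = {}" using assms(3) by auto
  have "(\<lambda>z. \<lambda>p\<in>K \<union> J. if p \<in> J then z p + h (restrict z K) p else z p)
      \<in> lborel_PiM (K \<union> J) \<rightarrow>\<^sub>M lborel_PiM (K \<union> J)" (is "?S \<in> _")
  proof (rule measurable_restrict)
    fix p assume p: "p \<in> K \<union> J"
    have "(\<lambda>z. restrict z K) \<in> lborel_PiM (K \<union> J) \<rightarrow>\<^sub>M lborel_PiM K"
      by (rule measurable_restrict_subset) simp
    from measurable_compose[OF this h]
    show "(\<lambda>z. if p \<in> J then z p + h (restrict z K) p else z p) \<in> lborel_PiM (K \<union> J) \<rightarrow>\<^sub>M lborel"
      using p by (cases "p \<in> J") auto
  qed
  note mS = measurable_compose[OF this H]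
  have sh: "?S (merge K J (y, x)) = merge K J (y, \<lambda>p\<in>J. x p + h y p)" if "y \<in> space (lborel_PiM K)" for x y
  proof -
    have "restrict (merge K J (y, x)) K = y"
      using that by (auto simp: fun_eq_iff space_PiM PiE_def extensional_def merge_def)
    then show ?thesis
      using KJ by (auto simp only: fun_eq_iff) (auto simp: merge_def restrict_def)
  qed
  have mH: "(\<lambda>x. H (merge K J (y, x))) \<in> borel_measurable (lborel_PiM J)" if [measurable]: "y \<in> space (lborel_PiM K)" for y
    by measurable
  have "(\<integral>\<^sup>+z. H (?S z) \<partial>lborel_PiM (K \<union> J)) =
      (\<integral>\<^sup>+y. \<integral>\<^sup>+x. H (merge K J (y, \<lambda>p\<in>J. x p + h y p)) \<partial>lborel_PiM J \<partial>lborel_PiM K)"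
    by (subst lborel_prod.product_nn_integral_fold[OF KJ assms(2,1) mS])
       (intro nn_integral_cong, simp only: sh)
  also have "\<dots> = (\<integral>\<^sup>+y. \<integral>\<^sup>+x. H (merge K J (y, x)) \<partial>lborel_PiM J \<partial>lborel_PiM K)"
    by (intro nn_integral_cong nn_integral_lborel_PiM_translate assms(1) mH)
  also have "\<dots> = (\<integral>\<^sup>+z. H z \<partial>lborel_PiM (K \<union> J))"
    by (rule lborel_prod.product_nn_integral_fold[OF KJ assms(2,1) H, symmetric])
  finally show ?thesis .
qed

text \<open>Used to identify a single column, indexed by pairs \<open>(i, c)\<close>, with a vector
  indexed by \<open>i\<close>, and to treat permutations of coordinates.\<close>

lemma nn_integral_PiM_lborel_reindex:
  fixes H :: "('i \<Rightarrow> 'b::euclidean_space) \<Rightarrow> ennreal"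
  assumes "finite A" "inj_on f A" and "H \<in> borel_measurable (PiM A (\<lambda>_. lborel))"
  shows "(\<integral>\<^sup>+x. H (\<lambda>a\<in>A. x (f a)) \<partial>PiM (f ` A) (\<lambda>_. lborel)) = (\<integral>\<^sup>+x. H x \<partial>PiM A (\<lambda>_. lborel))"
  using assms
proof (induction A arbitrary: H rule: finite_induct)
  case empty
  then show ?case by (simp add: PiM_empty nn_integral_count_space_finite)
next
  case (insert i A)
  note [measurable] = insert.prems(2)
  let ?L = "\<lambda>J. PiM J (\<lambda>_. lborel :: 'b measure)"
  have fi: "f i \<notin> f ` A" using insert.prems(1) insert.hyps by auto
  have upd: "(\<lambda>a\<in>insert i A. (x(f i := y)) (f a)) = (\<lambda>a\<in>A. x (f a))(i := y)" for x and y :: 'b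
  proof -
    have "f a \<noteq> f i" if "a \<in> A" for a using fi that by (metis imageI)
    then show ?thesis using insert.hyps by (auto simp: fun_eq_iff)
  qed
  have m0: "(\<lambda>x. \<lambda>a\<in>insert i A. x (f a)) \<in> ?L (insert (f i) (f ` A)) \<rightarrow>\<^sub>M ?L (insert i A)"
    by (intro measurable_restrict measurable_component_singleton) auto
  have m1: "(\<lambda>x. \<integral>\<^sup>+y. H (x(i := y)) \<partial>lborel) \<in> borel_measurable (?L A)"
    by measurable
  have "(\<integral>\<^sup>+x. H (\<lambda>a\<in>insert i A. x (f a)) \<partial>?L (f ` insert i A)) =
      (\<integral>\<^sup>+x. \<integral>\<^sup>+y. H ((\<lambda>a\<in>A. x (f a))(i := y)) \<partial>lborel \<partial>?L (f ` A))"
    using lborel_prod.product_nn_integral_insert[OF finite_imageI[OF insert.hyps(1)] fi measurable_compose[OF m0 insert.prems(2)]]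
    by (simp only: upd image_insert)
  also have "\<dots> = (\<integral>\<^sup>+x. \<integral>\<^sup>+y. H (x(i := y)) \<partial>lborel \<partial>?L A)"
    using insert.prems(1) by (intro insert.IH[OF _ m1]) simp
  also have "\<dots> = (\<integral>\<^sup>+x. H x \<partial>?L (insert i A))"
    by (rule lborel_prod.product_nn_integral_insert[OF insert.hyps insert.prems(2), symmetric])
  finally show ?case .
qed

text \<open>Lebesgue measure is characterised by its values on boxes, and the preimage of a box is a
  product of intervals.\<close>

lemma nn_integral_lborel_vec:
  fixes H :: "real ^ 'm \<Rightarrow> ennreal"
  assumes [measurable]: "H \<in> borel_measurable borel"
  shows "(\<integral>\<^sup>+x. H (\<chi> i. x i) \<partial>lborel_PiM UNIV) = (\<integral>\<^sup>+x. H x \<partial>lborel)"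
proof -
  have m: "(\<lambda>x. \<chi> i. x i) \<in> borel_measurable (lborel_PiM (UNIV :: 'm set))"
    by (subst borel_measurable_euclidean_space) (auto simp: Basis_vec_def inner_axis)
  have "lborel = distr (lborel_PiM (UNIV :: 'm set)) borel (\<lambda>x. \<chi> i. x i)"
  proof (rule lborel_eqI)
    fix l u :: "real ^ 'm"
    assume lu: "\<And>b. b \<in> Basis \<Longrightarrow> l \<bullet> b \<le> u \<bullet> b"
    have le: "l $ i \<le> u $ i" for i
      using lu[of "axis i 1"] by (auto simp: Basis_vec_def inner_axis)
    have "emeasure (distr (lborel_PiM (UNIV :: 'm set)) borel (\<lambda>x. \<chi> i. x i)) (box l u) =
        emeasure (lborel_PiM UNIV) (\<Pi>\<^sub>E i\<in>UNIV. {l $ i<..<u $ i})"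
      by (subst emeasure_distr[OF m])
         (auto intro!: arg_cong[where f="emeasure _"] simp: space_PiM mem_box Basis_vec_def inner_axis PiE_iff)
    also have "\<dots> = (\<Prod>i\<in>UNIV. emeasure lborel {l $ i<..<u $ i})"
      by (subst lborel_prod.emeasure_PiM) auto
    also have "\<dots> = ennreal (\<Prod>i\<in>UNIV. u $ i - l $ i)"
      by (subst prod_ennreal[symmetric]) (auto simp: le)
    also have "(\<Prod>i\<in>UNIV. u $ i - l $ i) = (\<Prod>b\<in>Basis. (u - l) \<bullet> b)"
    proof -
      have *: "Basis = (\<lambda>i. axis i 1 :: real ^ 'm) ` UNIV" by (auto simp: Basis_vec_def)
      show ?thesis
        unfolding * by (subst prod.reindex) (auto simp: inj_on_def axis_eq_axis inner_axis)
    qed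
    finally show "emeasure (distr (lborel_PiM (UNIV :: 'm set)) borel (\<lambda>x. \<chi> i. x i)) (box l u) =
        ennreal (\<Prod>b\<in>Basis. (u - l) \<bullet> b)" .
  qed simp
  then show ?thesis
    by (subst nn_integral_distr[OF m, symmetric]) simp_all
qed

text \<open>The preimage of a half-line \<open>{..r}\<close> is a ball, so the distribution function
  of the squared length is the ball volume \<open>unit_ball_vol n * r powr (n / 2)\<close>, and the
  density is its derivative. The constant is \<open>n / 2 * unit_ball_vol n\<close>, which the
  recursion of Gamma turns into \<open>pi powr (n / 2) / Gamma (n / 2)\<close>.\<close>

lemma nn_integral_lborel_PiM_sum_squares:
  assumes fin: "finite A" and ne: "A \<noteq> {}" and h[measurable]: "h \<in> borel_measurable borel"
  defines "n \<equiv> real (card A)"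
  shows "(\<integral>\<^sup>+v. h (\<Sum>a\<in>A. (v a)\<^sup>2) \<partial>lborel_PiM A) =
    (\<integral>\<^sup>+r. ennreal (if 0 < r then pi powr (n / 2) / Gamma (n / 2) * r powr (n / 2 - 1) else 0) * h r \<partial>lborel)"
proof -
  define g where "g r = (if 0 < r then pi powr (n / 2) / Gamma (n / 2) * r powr (n / 2 - 1) else 0)" for r
  have n1: "n \<ge> 1" unfolding n_def using fin ne by (simp add: Suc_leI card_gt_0_iff)
  have Gp: "Gamma (n / 2) > 0" using n1 by (intro Gamma_real_pos) simp
  have g0: "g r \<ge> 0" for r unfolding g_def using Gp by auto
  have [measurable]: "g \<in> borel_measurable borel" unfolding g_def by measurable
  have mq[measurable]: "(\<lambda>v. \<Sum>a\<in>A. (v a)\<^sup>2) \<in> borel_measurable (lborel_PiM A)"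
    by measurable
  define V where "V r = unit_ball_vol n * (max 0 r) powr (n / 2)" for r
  have lhs: "emeasure (distr (lborel_PiM A) borel (\<lambda>v. \<Sum>a\<in>A. (v a)\<^sup>2)) {..r} = ennreal (V r)" for r
  proof (cases "r > 0")
    case True
    have "emeasure (distr (lborel_PiM A) borel (\<lambda>v. \<Sum>a\<in>A. (v a)\<^sup>2)) {..r} =
        emeasure (lborel_PiM A) ({f. sqrt (\<Sum>i\<in>A. (f i)\<^sup>2) \<le> sqrt r} \<inter> space (lborel_PiM A))"
      by (subst emeasure_distr[OF mq]) (auto intro!: arg_cong[where f="emeasure _"])
    also have "\<dots> = ennreal (unit_ball_vol n * sqrt r ^ card A)"
      using emeasure_cball_aux[OF fin, of "sqrt r"] True by (simp add: n_def)
    also have "sqrt r ^ card A = r powr (n / 2)"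
      using True by (simp add: powr_half_sqrt[symmetric] powr_realpow[symmetric] powr_powr n_def)
    finally show ?thesis using True by (simp add: V_def)
  next
    case False
    have "emeasure (distr (lborel_PiM A) borel (\<lambda>v. \<Sum>a\<in>A. (v a)\<^sup>2)) {..r} =
        emeasure (lborel_PiM A) {v \<in> space (lborel_PiM A). (\<Sum>a\<in>A. (v a)\<^sup>2) \<le> r}"
      by (subst emeasure_distr[OF mq]) (auto intro!: arg_cong[where f="emeasure _"])
    \<comment> \<open>For \<open>r\<close> at most 0 only the origin can remain, a null set because
      \<open>A\<close> is nonempty.\<close>
    also have "\<dots> \<le> emeasure (lborel_PiM A) (\<Pi>\<^sub>E a\<in>A. {0})"
    proof (rule emeasure_mono)
      show "{v \<in> space (lborel_PiM A). (\<Sum>a\<in>A. (v a)\<^sup>2) \<le> r} \<subseteq> (\<Pi>\<^sub>E a\<in>A. {0})"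
      proof (rule subsetI, unfold mem_Collect_eq, elim conjE)
        fix v assume v: "v \<in> space (lborel_PiM A)" "(\<Sum>a\<in>A. (v a)\<^sup>2) \<le> r"
        have "(\<Sum>a\<in>A. (v a)\<^sup>2) = 0" using v False sum_nonneg[of A "\<lambda>a. (v a)\<^sup>2"] by simp
        then have "\<forall>a\<in>A. v a = 0" using fin by (subst (asm) sum_nonneg_eq_0_iff) auto
        then have "v = (\<lambda>a\<in>A. 0)" using v by (auto simp: space_PiM PiE_def fun_eq_iff extensional_def)
        then show "v \<in> (\<Pi>\<^sub>E a\<in>A. {0})" by auto
      qed
    qed (intro sets_PiM_I_finite fin, simp)
    also have "\<dots> = 0"
      using fin ne by (subst lborel_prod.emeasure_PiM) auto
    finally show ?thesis using False by (simp add: V_def max_def)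
  qed
  have rhs: "emeasure (density lborel g) {..r} = ennreal (V r)" for r
  proof -
    have "emeasure (density lborel g) {..r} = (\<integral>\<^sup>+x. ennreal (g x) * indicator {..r} x \<partial>lborel)"
      by (subst emeasure_density) auto
    also have "\<dots> = (\<integral>\<^sup>+x. ennreal (if x \<in> {0..max 0 r} then g x else 0) \<partial>lborel)"
      by (intro nn_integral_cong) (auto simp: g_def indicator_def)
    also have "\<dots> = ennreal (V (max 0 r) - V 0)"
    proof (rule nn_integral_has_integral_lborel)
      show "(\<lambda>x. if x \<in> {0..max 0 r} then g x else 0) \<in> borel_measurable borel" by simp
      show "0 \<le> (if x \<in> {0..max 0 r} then g x else 0)" for x by (simp add: g0)
      \<comment> \<open>Only interior derivatives are used: for \<open>n = 1\<close> the density is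
        unbounded near 0, while the distribution function stays continuous there.\<close>
      have "(g has_integral (V (max 0 r) - V 0)) {0..max 0 r}"
      proof (rule fundamental_theorem_of_calculus_interior)
        show "continuous_on {0..max 0 r} V"
          unfolding V_def using n1 by (intro continuous_intros continuous_on_powr') auto
        fix x assume x: "x \<in> {0<..<max 0 r}"
        have G1: "Gamma (n / 2 + 1) = n / 2 * Gamma (n / 2)"
          using n1 by (intro Gamma_plus1) (auto elim!: nonpos_Ints_cases)
        have d: "((\<lambda>r. unit_ball_vol n * r powr (n / 2)) has_real_derivative g x) (at x)"
          using x Gp n1 unfolding unit_ball_vol_def G1
          by (auto intro!: derivative_eq_intros simp: g_def less_imp_neq[symmetric])
        have "eventually (\<lambda>y. y \<in> {0<..}) (nhds x)"
          using x by (intro eventually_nhds_in_open) auto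
        then have "eventually (\<lambda>y. unit_ball_vol n * y powr (n / 2) = V y) (nhds x)"
          by eventually_elim (auto simp: V_def)
        from DERIV_cong_ev[OF refl this refl] d
        show "(V has_vector_derivative g x) (at x)"
          by (simp add: has_real_derivative_iff_has_vector_derivative)
      qed simp
      then show "((\<lambda>x. if x \<in> {0..max 0 r} then g x else 0) has_integral (V (max 0 r) - V 0)) UNIV"
        by (subst has_integral_restrict_UNIV)
    qed
    also have "V (max 0 r) - V 0 = V r" using n1 by (auto simp: V_def)
    finally show ?thesis .
  qed
  have "distr (lborel_PiM A) borel (\<lambda>v. \<Sum>a\<in>A. (v a)\<^sup>2) = density lborel g"
  proof (rule measure_eqI_generator_eq[where E="range (\<lambda>a::real. {..a})" and A="\<lambda>i::nat. {..real i}" and \<Omega>=UNIV])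
    show "Int_stable (range (\<lambda>a::real. {..a}))"
      by (auto simp: Int_stable_def)
    show "(\<Union>i. {..real i}) = UNIV"
      using real_arch_simple by auto
    show "sets (distr (lborel_PiM A) borel (\<lambda>v. \<Sum>a\<in>A. (v a)\<^sup>2)) = sigma_sets UNIV (range (\<lambda>a::real. {..a}))"
         "sets (density lborel g) = sigma_sets UNIV (range (\<lambda>a::real. {..a}))"
      by (simp_all add: borel_eq_atMost)
  qed (auto simp: lhs rhs)
  from arg_cong[OF this, of "\<lambda>N. \<integral>\<^sup>+x. h x \<partial>N"] show ?thesis
    by (simp add: nn_integral_distr nn_integral_density g_def)
qed

text \<open>Every square matrix is built from elementary ones, and both sides are compatible with
  products. Diagonal matrices scale the coordinates, swaps reindex them, and the remaining
  invertible elementary matrices are shears.\<close>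

lemma nn_integral_lborel_matrix_vector_mult:
  fixes A :: "real ^ 'm ^ 'm" and H :: "real ^ 'm \<Rightarrow> ennreal"
  assumes "det A \<noteq> 0" "H \<in> borel_measurable borel"
  shows "(\<integral>\<^sup>+x. H (A *v x) \<partial>lborel) = ennreal (1 / \<bar>det A\<bar>) * (\<integral>\<^sup>+x. H x \<partial>lborel)"
proof -
  have lin[measurable]: "(\<lambda>x. A *v x) \<in> borel_measurable borel" for A :: "real ^ 'm ^ 'm"
    by (intro borel_measurable_continuous_onI linear_continuous_on)
       (simp add: linear_conv_bounded_linear[symmetric])
  have chi[measurable]: "(\<lambda>x. \<chi> i. x i) \<in> borel_measurable (lborel_PiM (UNIV :: 'm set))"
    by (subst borel_measurable_euclidean_space) (auto simp: Basis_vec_def inner_axis)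
  \<comment> \<open>Invertibility and the quantifier over \<open>H\<close> belong to the induction
    predicate: both must be available for each factor of a product, and a matrix with a zero row
    becomes a vacuous case.\<close>
  define P :: "real ^ 'm ^ 'm \<Rightarrow> bool" where "P A \<longleftrightarrow> det A \<noteq> 0 \<longrightarrow>
    (\<forall>H \<in> borel_measurable borel. (\<integral>\<^sup>+x. H (A *v x) \<partial>lborel) =
      ennreal (1 / \<bar>det A\<bar>) * (\<integral>\<^sup>+x. H x \<partial>lborel))" for A
  have PI: "P A" if "\<And>H. H \<in> borel_measurable borel \<Longrightarrow> det A \<noteq> 0 \<Longrightarrow>
    (\<integral>\<^sup>+x. H (A *v (\<chi> i. x i)) \<partial>lborel_PiM UNIV) =
      ennreal (1 / \<bar>det A\<bar>) * (\<integral>\<^sup>+x. H (\<chi> i. x i) \<partial>lborel_PiM UNIV)" for A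
    unfolding P_def
  proof (intro impI ballI)
    fix H :: "real ^ 'm \<Rightarrow> ennreal" assume H[measurable]: "H \<in> borel_measurable borel" and d: "det A \<noteq> 0"
    show "(\<integral>\<^sup>+x. H (A *v x) \<partial>lborel) = ennreal (1 / \<bar>det A\<bar>) * (\<integral>\<^sup>+x. H x \<partial>lborel)"
      using that[OF H d] nn_integral_lborel_vec[OF H] nn_integral_lborel_vec[of "\<lambda>x. H (A *v x)"] by simp
  qed
  have "P A"
  proof (induction A rule: induct_matrix_elementary)
    case mult: (1 A B)
    show ?case unfolding P_def
    proof (intro impI ballI)
      fix H :: "real ^ 'm \<Rightarrow> ennreal" assume H[measurable]: "H \<in> borel_measurable borel" and d: "det (A ** B) \<noteq> 0"
      have dA: "det A \<noteq> 0" "det B \<noteq> 0" using d by (auto simp: det_mul)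
      have "(\<integral>\<^sup>+x. H (A *v (B *v x)) \<partial>lborel) = ennreal (1 / \<bar>det B\<bar>) * (\<integral>\<^sup>+x. H (A *v x) \<partial>lborel)"
        by (rule mult(2)[unfolded P_def, THEN mp, OF dA(2), THEN bspec]) measurable
      also have "(\<integral>\<^sup>+x. H (A *v x) \<partial>lborel) = ennreal (1 / \<bar>det A\<bar>) * (\<integral>\<^sup>+x. H x \<partial>lborel)"
        by (rule mult(1)[unfolded P_def, THEN mp, OF dA(1), THEN bspec]) fact
      finally show "(\<integral>\<^sup>+x. H ((A ** B) *v x) \<partial>lborel) = ennreal (1 / \<bar>det (A ** B)\<bar>) * (\<integral>\<^sup>+x. H x \<partial>lborel)"
        by (simp add: matrix_vector_mul_assoc[symmetric] det_mul abs_mult mult.assoc[symmetric] ennreal_mult[symmetric] mult.commute[of "\<bar>det A\<bar>"])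
    qed
  next
    case zero_row: (2 A i)
    then show ?case by (simp add: P_def det_zero_row(2))
  next
    case diagonal: (3 A)
    show ?case
    proof (rule PI)
      fix H :: "real ^ 'm \<Rightarrow> ennreal" assume H[measurable]: "H \<in> borel_measurable borel" and d: "det A \<noteq> 0"
      have dd: "det A = (\<Prod>i\<in>UNIV. A $ i $ i)" using diagonal by (rule det_diagonal)
      have "(\<Sum>j\<in>UNIV. A $ i $ j * x j) = (\<Sum>j\<in>UNIV. if j = i then A $ i $ i * x i else 0)" for x :: "'m \<Rightarrow> real" and i
        by (intro sum.cong) (auto simp: diagonal)
      then have eq: "A *v (\<chi> i. x i) = (\<chi> i. (\<lambda>i\<in>UNIV. A $ i $ i * x i + 0) i)" for x
        by (simp add: matrix_vector_mult_def vec_eq_iff)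
      show "(\<integral>\<^sup>+x. H (A *v (\<chi> i. x i)) \<partial>lborel_PiM UNIV) =
          ennreal (1 / \<bar>det A\<bar>) * (\<integral>\<^sup>+x. H (\<chi> i. x i) \<partial>lborel_PiM UNIV)"
        unfolding eq
        by (subst nn_integral_lborel_PiM_affine[where h="\<lambda>_. 0" and H="\<lambda>x. H (\<chi> i. x i)"])
           (use d in \<open>auto simp: dd abs_prod prod_dividef\<close>)
    qed
  next
    case swap1: (4 m n)
    let ?f = "Transposition.transpose m n"
    let ?A = "(\<chi> i j. mat 1 $ i $ ?f j) :: real ^ 'm ^ 'm"
    have d: "\<bar>det ?A\<bar> = 1"
      using det_permute_columns[of ?f "mat 1 :: real ^ 'm ^ 'm"] by (simp add: sign_swap_id swap1 permutes_swap_id abs_mult)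
    have eq: "?A *v (\<chi> i. x i) = (\<chi> i. (\<lambda>a\<in>UNIV. x (?f a)) i)" for x
    proof -
      have "(\<Sum>j\<in>UNIV. (if i = ?f j then 1 else 0) * x j) = x (?f i)" for i
      proof -
        have "(\<Sum>j\<in>UNIV. (if i = ?f j then 1 else 0) * x j) = (\<Sum>j\<in>UNIV. if j = ?f i then x j else 0)"
          by (intro sum.cong) (auto simp: Transposition.transpose_def)
        then show ?thesis by simp
      qed
      then show ?thesis by (simp add: matrix_vector_mult_def vec_eq_iff mat_def)
    qed
    show ?case
    proof (rule PI)
      fix H :: "real ^ 'm \<Rightarrow> ennreal" assume H[measurable]: "H \<in> borel_measurable borel"
      show "(\<integral>\<^sup>+x. H (?A *v (\<chi> i. x i)) \<partial>lborel_PiM UNIV) =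
          ennreal (1 / \<bar>det ?A\<bar>) * (\<integral>\<^sup>+x. H (\<chi> i. x i) \<partial>lborel_PiM UNIV)"
        unfolding eq d
        using nn_integral_PiM_lborel_reindex[of UNIV ?f "\<lambda>x. H (\<chi> i. x i)"] by (simp add: restrict_def)
    qed
  next
    case idplus: (5 m n c)
    let ?A = "(\<chi> i j. if i = m \<and> j = n then c else of_bool (i = j)) :: real ^ 'm ^ 'm"
    \<comment> \<open>The matrix arises from the identity by a row operation, so its determinant is
      1.\<close>
    have "?A = (\<chi> k. if k = m then row m (mat 1) + c *s row n (mat 1) else row k (mat 1))"
      using idplus by (auto simp: vec_eq_iff row_def mat_def)
    then have d: "det ?A = 1"
      by (simp only: det_row_operation[OF idplus] det_I)
    have "(\<Sum>j\<in>UNIV. (if i = m \<and> j = n then c else of_bool (i = j)) * x j) = (if i = m then x i + c * x n else x i)" for i x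
    proof (cases "i = m")
      case True
      have "(\<Sum>j\<in>UNIV. (if i = m \<and> j = n then c else of_bool (i = j)) * x j) =
          (\<Sum>j\<in>UNIV. (if j = n then c * x j else 0) + (if j = i then x j else 0))"
        using True idplus by (intro sum.cong) auto
      then show ?thesis using True by (simp add: sum.distrib)
    next
      case False
      have "(\<Sum>j\<in>UNIV. (if i = m \<and> j = n then c else of_bool (i = j)) * x j) =
          (\<Sum>j\<in>UNIV. (if j = i then x j else 0))"
        using False by (intro sum.cong) auto
      then show ?thesis using False by simp
    qed
    then have eq: "?A *v (\<chi> i. x i) = (\<chi> i. (\<lambda>p\<in>(UNIV - {m}) \<union> {m}. if p \<in> {m}
          then x p + (\<lambda>y p. c * y n) (restrict x (UNIV - {m})) p else x p) i)" for x
      using idplus by (auto simp: matrix_vector_mult_def vec_eq_iff)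
    have U: "(UNIV - {m}) \<union> {m} = UNIV" by auto
    show ?case
    proof (rule PI)
      fix H :: "real ^ 'm \<Rightarrow> ennreal" assume H[measurable]: "H \<in> borel_measurable borel"
      have mc: "(\<lambda>y. c * y n) \<in> borel_measurable (lborel_PiM (UNIV - {m}))"
        using measurable_component_singleton[of n "UNIV - {m}" "\<lambda>_. lborel :: real measure"] idplus
        by (intro borel_measurable_times borel_measurable_const) auto
      show "(\<integral>\<^sup>+x. H (?A *v (\<chi> i. x i)) \<partial>lborel_PiM UNIV) =
          ennreal (1 / \<bar>det ?A\<bar>) * (\<integral>\<^sup>+x. H (\<chi> i. x i) \<partial>lborel_PiM UNIV)"
        unfolding eq d
        using nn_integral_lborel_PiM_shear[of "{m}" "UNIV - {m}" "\<lambda>x. H (\<chi> i. x i)" "\<lambda>y p. c * y n"] mc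
        unfolding U by (simp add: restrict_def)
    qed
  qed
  then show ?thesis using assms by (simp add: P_def)
qed

text \<open>The integrand is a product over the coordinates; the one-dimensional factor is read off
  from the total mass 1 of the standard normal density.\<close>

lemma nn_integral_gaussian_vec:
  "(\<integral>\<^sup>+x. ennreal (exp (- (norm x)\<^sup>2 / 2)) \<partial>(lborel :: (real ^ 'm) measure)) =
    ennreal ((2 * pi) powr (real CARD('m) / 2))"
proof -
  have 1: "(\<integral>\<^sup>+t. ennreal (exp (- t\<^sup>2 / 2)) \<partial>lborel) = ennreal (sqrt (2 * pi))"
  proof -
    have "1 = (\<integral>\<^sup>+t. ennreal (std_normal_density t) \<partial>lborel)"
      using prob_space.emeasure_space_1[OF prob_space_normal_density[of 1 0]]
      by (simp add: emeasure_density)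
    also have "\<dots> = (\<integral>\<^sup>+t. ennreal (1 / sqrt (2 * pi)) * ennreal (exp (- t\<^sup>2 / 2)) \<partial>lborel)"
      by (intro nn_integral_cong) (simp add: std_normal_density_def ennreal_mult[symmetric])
    also have "\<dots> = ennreal (1 / sqrt (2 * pi)) * (\<integral>\<^sup>+t. ennreal (exp (- t\<^sup>2 / 2)) \<partial>lborel)"
      by (rule nn_integral_cmult) simp
    finally have e: "ennreal (1 / sqrt (2 * pi)) * (\<integral>\<^sup>+t. ennreal (exp (- t\<^sup>2 / 2)) \<partial>lborel) = 1" by simp
    have "(\<integral>\<^sup>+t. ennreal (exp (- t\<^sup>2 / 2)) \<partial>lborel) =
        ennreal (sqrt (2 * pi)) * (ennreal (1 / sqrt (2 * pi)) * (\<integral>\<^sup>+t. ennreal (exp (- t\<^sup>2 / 2)) \<partial>lborel))"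
      by (simp add: mult.assoc[symmetric] ennreal_mult[symmetric])
    then show ?thesis by (simp add: e[simplified])
  qed
  have "(\<integral>\<^sup>+x. ennreal (exp (- (norm x)\<^sup>2 / 2)) \<partial>(lborel :: (real ^ 'm) measure)) =
      (\<integral>\<^sup>+x. (\<Prod>i\<in>UNIV. ennreal (exp (- (x i)\<^sup>2 / 2))) \<partial>lborel_PiM (UNIV :: 'm set))"
    by (subst nn_integral_lborel_vec[symmetric])
       (auto intro!: nn_integral_cong simp: prod_ennreal exp_sum[symmetric] norm_vec_def L2_set_def
         sum_negf sum_divide_distrib[symmetric] sum_nonneg)
  also have "\<dots> = (\<Prod>i\<in>(UNIV :: 'm set). ennreal (sqrt (2 * pi)))"
    by (subst lborel_prod.product_nn_integral_prod) (simp_all only: 1 measurable_lborel2, simp_all)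
  also have "\<dots> = ennreal (sqrt (2 * pi) ^ CARD('m))"
    by (simp add: ennreal_power)
  also have "sqrt (2 * pi) ^ CARD('m) = (2 * pi) powr (real CARD('m) / 2)"
    by (simp add: powr_half_sqrt[symmetric] powr_realpow[symmetric] powr_powr del: powr_half_sqrt_powr)
  finally show ?thesis .
qed

section \<open>Positive definite matrices and their square roots\<close>

lemma norm_matrix_vector_mult_le:
  fixes A :: "real ^ 'n ^ 'm"
  shows "norm (A *v x) \<le> norm A * norm x"
proof -
  have "norm (A *v x) \<le> L2_set (\<lambda>i. norm (A $ i) * norm x) UNIV"
    unfolding norm_vec_def[of "A *v x"]
    by (intro L2_set_mono) (auto simp: matrix_vector_mul_component Cauchy_Schwarz_ineq2)
  also have "\<dots> = norm A * norm x"
    by (simp add: L2_set_left_distrib[symmetric] norm_vec_def[of A])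
  finally show ?thesis .
qed

lemma inner_matrix_vector_mult_symmetric:
  fixes A :: "real ^ 'm ^ 'm"
  assumes "transpose A = A"
  shows "x \<bullet> (A *v y) = (A *v x) \<bullet> y"
  by (metis assms dot_lmul_matrix transpose_matrix_vector)

lemma continuous_on_matrix_mult [continuous_intros]:
  fixes f :: "'a::topological_space \<Rightarrow> real ^ 'n ^ 'm" and g :: "'a \<Rightarrow> real ^ 'k ^ 'n"
  assumes "continuous_on S f" "continuous_on S g"
  shows "continuous_on S (\<lambda>x. f x ** g x)"
  unfolding matrix_matrix_mult_def by (intro continuous_intros assms)

lemma continuous_on_det [continuous_intros]:
  fixes f :: "'a::topological_space \<Rightarrow> real ^ 'm ^ 'm"
  assumes "continuous_on S f"
  shows "continuous_on S (\<lambda>x. det (f x))"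
  unfolding det_def by (intro continuous_intros assms)

lemma continuous_on_quadratic_form:
  fixes f :: "'a::topological_space \<Rightarrow> real ^ 'm ^ 'm"
  assumes "continuous_on S f" "continuous_on S g"
  shows "continuous_on S (\<lambda>x. g x \<bullet> (f x *v g x))"
  unfolding matrix_vector_mult_def by (intro continuous_intros assms)

lemma
  fixes A :: "real ^ 'm ^ 'm"
  assumes "det A \<noteq> 0"
  shows matrix_inv_right: "A ** matrix_inv A = mat 1"
    and matrix_inv_left: "matrix_inv A ** A = mat 1"
proof -
  have "\<exists>B. A ** B = mat 1 \<and> B ** A = mat 1"
    using assms by (metis invertible_def invertible_det_nz)
  from someI_ex[OF this] show "A ** matrix_inv A = mat 1" "matrix_inv A ** A = mat 1"
    unfolding matrix_inv_def by auto
qed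

text \<open>By Cramer's rule the inverse is a continuous function of the entries where the
  determinant is nonzero, and it is constant on the Borel set of singular matrices.\<close>

lemma borel_measurable_matrix_inv [measurable]:
  "(matrix_inv :: real ^ 'm ^ 'm \<Rightarrow> real ^ 'm ^ 'm) \<in> borel_measurable borel"
proof -
  have m: "(\<lambda>A :: real ^ 'm ^ 'm. det A) \<in> borel_measurable borel"
    by (intro borel_measurable_continuous_onI continuous_on_det continuous_on_id)
  define J where "J A = (\<chi> k l. det (\<chi> i j. if j = k then axis l 1 $ i else A $ i $ j) / det A)" for A :: "real ^ 'm ^ 'm"
  have eq: "matrix_inv A = (if det A = 0 then (SOME B. False) else J A)" for A :: "real ^ 'm ^ 'm"
  proof (cases "det A = 0")
    case True
    \<comment> \<open>The predicate under the choice operator is empty for every singular matrix, so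
      all of them share the single value \<open>SOME B. False\<close>.\<close>
    then have "\<not> (A ** B = mat 1 \<and> B ** A = mat 1)" for B
      by (metis invertible_def invertible_det_nz)
    then have "(\<lambda>B. A ** B = mat 1 \<and> B ** A = mat 1) = (\<lambda>_. False)"
      by (intro ext) blast
    then show ?thesis using True unfolding matrix_inv_def by simp
  next
    case False
    have "matrix_inv A $ k $ l = J A $ k $ l" for k l
    proof -
      have "A *v (matrix_inv A *v axis l 1) = axis l 1"
        using False by (simp add: matrix_vector_mul_assoc matrix_inv_right)
      then have "(matrix_inv A *v axis l 1) $ k = J A $ k $ l"
        by (subst (asm) cramer[OF False]) (simp add: J_def)
      then show ?thesis by (simp add: matrix_vector_mult_basis column_def)
    qed
    then show ?thesis using False by (simp add: vec_eq_iff)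
  qed
  have "continuous_on (- {A :: real ^ 'm ^ 'm. det A = 0}) J"
    unfolding J_def
  proof (intro continuous_intros)
    fix k l
    show "continuous_on (- {A :: real ^ 'm ^ 'm. det A = 0})
        (\<lambda>A. if j = k then axis l 1 $ i else A $ i $ j)" for i j
      by (cases "j = k") (auto intro!: continuous_intros)
  qed auto
  moreover have "{A :: real ^ 'm ^ 'm. det A = 0} \<in> sets borel"
    using m by measurable
  ultimately have "(\<lambda>A :: real ^ 'm ^ 'm. if A \<in> {A. det A = 0} then (SOME B. False) else J A) \<in> borel_measurable borel"
    by (intro borel_measurable_continuous_on_if continuous_on_const)
  then show ?thesis by (simp add: eq[abs_def])
qed

text \<open>The constant is the minimum of the quadratic form on the compact unit sphere;
  homogeneity extends the bound to all vectors.\<close>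

lemma pd_matrix_coercive:
  fixes A :: "real ^ 'm ^ 'm"
  assumes "pd_matrix A"
  obtains e where "e > 0" "\<And>x. e * (norm x)\<^sup>2 \<le> x \<bullet> (A *v x)"
proof -
  have "continuous_on (sphere 0 1) (\<lambda>x. x \<bullet> (A *v x))"
    by (intro continuous_on_quadratic_form continuous_intros)
  moreover have "sphere 0 1 \<noteq> ({} :: (real ^ 'm) set)" by simp
  ultimately obtain u where u: "u \<in> sphere 0 1" "\<And>x. x \<in> sphere 0 1 \<Longrightarrow> u \<bullet> (A *v u) \<le> x \<bullet> (A *v x)"
    using continuous_attains_inf[OF compact_sphere, of 0 1 "\<lambda>x. x \<bullet> (A *v x)"] by blast
  show thesis
  proof
    have "u \<noteq> 0" using u(1) by auto
    then show "u \<bullet> (A *v u) > 0" using assms by (simp add: pd_matrix_def)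
    fix x :: "real ^ 'm"
    show "u \<bullet> (A *v u) * (norm x)\<^sup>2 \<le> x \<bullet> (A *v x)"
    proof (cases "x = 0")
      case False
      define y where "y = (1 / norm x) *\<^sub>R x"
      have "x = norm x *\<^sub>R y" using False by (simp add: y_def)
      then have "x \<bullet> (A *v x) = (norm x)\<^sup>2 * (y \<bullet> (A *v y))"
        by (metis inner_scaleR_left inner_scaleR_right matrix_vector_mult_scaleR mult.assoc power2_eq_square)
      moreover have "y \<in> sphere 0 1" using False by (simp add: y_def)
      ultimately show ?thesis using u(2)[of y] by (simp add: mult.commute mult_right_mono)
    qed simp
  qed
qed

lemma pd_matrix_imp_psd_matrix: "pd_matrix A \<Longrightarrow> psd_matrix A"
  by (auto simp: pd_matrix_def psd_matrix_def) (metis inner_zero_left less_eq_real_def)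

lemma pd_matrix_add_psd_matrix:
  assumes "pd_matrix A" "psd_matrix B"
  shows "pd_matrix (A + B)"
proof -
  have "transpose (A + B) = A + B"
    using assms by (simp add: pd_matrix_def psd_matrix_def transpose_def vec_eq_iff)
  then show ?thesis
    using assms by (auto simp: pd_matrix_def psd_matrix_def matrix_vector_mult_add_rdistrib inner_add_right add_pos_nonneg)
qed

text \<open>If \<open>y = B *v x\<close> were nonzero, a small move from \<open>x\<close> in the
  direction of \<open>- y\<close> would make the form negative: its value at
  \<open>x - s *\<^sub>R y\<close> is \<open>s * (s * c - 2 * (y \<bullet> y))\<close>.\<close>

lemma psd_matrix_mult_eq_0:
  fixes B :: "real ^ 'm ^ 'm"
  assumes B: "psd_matrix B" and x: "x \<bullet> (B *v x) = 0"
  shows "B *v x = 0"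
proof (rule ccontr)
  assume "B *v x \<noteq> 0"
  define y where "y = B *v x"
  define c where "c = y \<bullet> (B *v y)"
  \<comment> \<open>The added 1 keeps the quotient defined when \<open>c\<close> is 0. It gives
    \<open>s * c \<le> y \<bullet> y\<close>, against the bound
    \<open>2 * (y \<bullet> y) \<le> s * c\<close> that nonnegativity forces.\<close>
  define s where "s = (y \<bullet> y) / (c + 1)"
  have sym: "transpose B = B" and pos: "\<And>x. 0 \<le> x \<bullet> (B *v x)" using B by (auto simp: psd_matrix_def)
  have c: "c \<ge> 0" unfolding c_def by (rule pos)
  have y: "y \<bullet> y > 0" using \<open>B *v x \<noteq> 0\<close> by (simp add: y_def)
  have s: "s > 0" using y c by (simp add: s_def)
  have "x \<bullet> (B *v y) = y \<bullet> y"
    using inner_matrix_vector_mult_symmetric[OF sym, of x y] by (simp add: y_def)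
  then have "(x - s *\<^sub>R y) \<bullet> (B *v (x - s *\<^sub>R y)) = s * (s * c - 2 * (y \<bullet> y))"
    using x by (simp add: matrix_vector_mult_diff_distrib matrix_vector_mult_scaleR inner_diff_left
        inner_diff_right c_def y_def[symmetric] algebra_simps)
  then have "0 \<le> s * (s * c - 2 * (y \<bullet> y))" using pos by metis
  then have "2 * (y \<bullet> y) \<le> s * c" using s by (simp add: zero_le_mult_iff)
  moreover have "s * c \<le> y \<bullet> y"
    using c y by (simp add: s_def field_simps)
  ultimately show False using y by simp
qed

lemma pd_matrix_det_nonzero:
  assumes "pd_matrix A"
  shows "det A \<noteq> 0"
proof -
  have "\<forall>x. A *v x = 0 \<longrightarrow> x = 0"
    using assms by (metis inner_zero_right less_irrefl pd_matrix_def)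
  then have "\<exists>B. B ** A = mat 1" by (simp add: matrix_left_invertible_ker)
  then show ?thesis by (simp add: invertible_det_nz[symmetric] invertible_left_inverse)
qed

text \<open>A vector on which the form vanishes lies in the kernel, and the kernel is trivial. This
  separates the positive definite matrices from the singular boundary of the semidefinite
  cone.\<close>

lemma psd_matrix_det_nonzero_imp_pd_matrix:
  assumes "psd_matrix A" "det A \<noteq> 0"
  shows "pd_matrix A"
proof -
  have "A *v x \<noteq> 0" if "x \<noteq> 0" for x
    using assms(2) that by (metis invertible_det_nz invertible_left_inverse matrix_left_invertible_ker)
  then have "x \<bullet> (A *v x) \<noteq> 0" if "x \<noteq> 0" for x
    using psd_matrix_mult_eq_0[OF assms(1), of x] that by metis
  then show ?thesis using assms(1) by (auto simp: psd_matrix_def pd_matrix_def order_less_le)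
qed

section \<open>Square roots on the cone of positive definite matrices\<close>

lemma inner_square_symmetric:
  fixes B :: "real ^ 'm ^ 'm"
  assumes "transpose B = B"
  shows "x \<bullet> ((B ** B) *v x) = (norm (B *v x))\<^sup>2"
  using inner_matrix_vector_mult_symmetric[OF assms, of x "B *v x"]
  by (simp add: matrix_vector_mul_assoc[symmetric] power2_norm_eq_inner)

lemma psd_matrix_square:
  assumes "transpose B = B"
  shows "psd_matrix (B ** B)"
  using assms by (auto simp: psd_matrix_def inner_square_symmetric matrix_transpose_mul)

lemma pd_matrix_square:
  assumes "transpose B = B" "det B \<noteq> 0"
  shows "pd_matrix (B ** B)"
  using psd_matrix_square[OF assms(1)] assms(2)
  by (intro psd_matrix_det_nonzero_imp_pd_matrix) (auto simp: det_mul)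

text \<open>With \<open>D = B - C\<close> and \<open>P = B + C\<close> the equation \<open>B\<^sup>2 = C\<^sup>2\<close> reads \<open>D P + P D = 0\<close>, so
  \<open>tr (D P D) = - tr (D D P) = - tr (D P D)\<close>; hence the positive semidefinite matrix
  \<open>D P D\<close> has trace 0.\<close>

lemma pd_matrix_square_inject:
  fixes B C :: "real ^ 'm ^ 'm"
  assumes B: "pd_matrix B" and C: "pd_matrix C" and eq: "B ** B = C ** C"
  shows "B = C"
proof -
  define D where "D = B - C"
  define P where "P = B + C"
  have symD: "transpose D = D"
    using B C by (simp add: D_def pd_matrix_def transpose_def vec_eq_iff)
  have pdP: "pd_matrix P"
    unfolding P_def by (intro pd_matrix_add_psd_matrix B pd_matrix_imp_psd_matrix C)
  have "(D ** P + P ** D) $ i $ j = 2 * ((B ** B) $ i $ j - (C ** C) $ i $ j)" for i j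
    unfolding D_def P_def matrix_matrix_mult_def
    by (simp add: sum.distrib[symmetric] sum_distrib_left sum_subtractf[symmetric])
       (intro sum.cong, simp_all add: algebra_simps)
  then have anti: "D ** P + P ** D = 0" by (simp add: eq vec_eq_iff)
  have "trace (D ** P ** D) + trace (D ** P ** D) = trace (D ** (D ** P)) + trace (D ** (P ** D))"
    by (simp add: trace_mul_sym[of "D ** P" D] matrix_mul_assoc)
  also have "\<dots> = trace (D ** (D ** P + P ** D))"
    by (simp add: matrix_add_ldistrib trace_add)
  finally have tr: "trace (D ** P ** D) = 0"
    by (simp add: anti trace_def)
  have diag: "(D ** P ** D) $ i $ i = (D *v axis i 1) \<bullet> (P *v (D *v axis i 1))" for i
  proof -
    have "(D ** P ** D) $ i $ i = axis i 1 \<bullet> ((D ** P ** D) *v axis i 1)"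
      by (simp add: matrix_vector_mult_basis inner_axis' column_def)
    also have "\<dots> = axis i 1 \<bullet> (D *v (P *v (D *v axis i 1)))"
      by (simp add: matrix_vector_mul_assoc matrix_mul_assoc)
    finally show ?thesis by (simp add: inner_matrix_vector_mult_symmetric[OF symD])
  qed
  have nonneg: "(D ** P ** D) $ i $ i \<ge> 0" for i
    unfolding diag using pd_matrix_imp_psd_matrix[OF pdP] by (simp add: psd_matrix_def)
  have "D *v axis i 1 = 0" for i
  proof -
    have "(D ** P ** D) $ i $ i = 0"
      using tr nonneg unfolding trace_def by (subst (asm) sum_nonneg_eq_0_iff) auto
    then show ?thesis
      using pdP unfolding diag pd_matrix_def by (metis less_irrefl)
  qed
  then have "D = 0"
    by (simp add: matrix_vector_mult_basis column_def vec_eq_iff)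
  then show ?thesis by (simp add: D_def)
qed

text \<open>A symmetric perturbation whose Euclidean norm is below the coercivity constant cannot
  destroy definiteness. Openness is meant within the subspace of symmetric matrices, where
  invariance of domain is applied to squaring.\<close>

lemma openin_pd_matrix: "openin (top_of_set {A :: real ^ 'm ^ 'm. transpose A = A}) {A. pd_matrix A}"
  unfolding openin_contains_ball
proof (intro conjI ballI)
  fix A :: "real ^ 'm ^ 'm" assume "A \<in> {A. pd_matrix A}"
  then obtain e where e: "e > 0" "\<And>x. e * (norm x)\<^sup>2 \<le> x \<bullet> (A *v x)"
    using pd_matrix_coercive by blast
  show "\<exists>e>0. ball A e \<inter> {A. transpose A = A} \<subseteq> {A. pd_matrix A}"
  proof (intro exI conjI subsetI)
    fix B assume B: "B \<in> ball A e \<inter> {A. transpose A = A}"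
    have "0 < x \<bullet> (B *v x)" if "x \<noteq> 0" for x
    proof -
      have "\<bar>x \<bullet> ((A - B) *v x)\<bar> \<le> norm x * (norm (A - B) * norm x)"
        by (rule order_trans[OF Cauchy_Schwarz_ineq2])
           (intro mult_left_mono norm_matrix_vector_mult_le norm_ge_zero)
      also have "\<dots> = norm (A - B) * (norm x)\<^sup>2" by (simp add: power2_eq_square)
      also have "\<dots> < e * (norm x)\<^sup>2" using B that by (auto simp: dist_norm)
      also have "\<dots> \<le> x \<bullet> (A *v x)" by (rule e)
      finally show ?thesis by (simp add: matrix_vector_mult_diff_rdistrib inner_diff_right)
    qed
    then show "B \<in> {A. pd_matrix A}" using B by (simp add: pd_matrix_def)
  qed (rule e)
qed (auto simp: pd_matrix_def)

lemma closed_symmetric_matrices: "closed {A :: real ^ 'm ^ 'm. transpose A = A}"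
  unfolding transpose_def by (intro closed_Collect_eq continuous_intros)

lemma closed_psd_matrix: "closed {A :: real ^ 'm ^ 'm. psd_matrix A}"
proof -
  have "{A :: real ^ 'm ^ 'm. psd_matrix A} = {A. transpose A = A} \<inter> (\<Inter>x. {A. 0 \<le> x \<bullet> (A *v x)})"
    by (auto simp: psd_matrix_def)
  moreover have "closed {A :: real ^ 'm ^ 'm. 0 \<le> x \<bullet> (A *v x)}" for x
    by (intro closed_Collect_le continuous_on_quadratic_form continuous_intros)
  ultimately show ?thesis
    using closed_symmetric_matrices by (simp only:) (intro closed_Int closed_INT ballI, assumption, simp)
qed

text \<open>For a symmetric root the trace of \<open>B ** B\<close> is the squared Euclidean norm of
  \<open>B\<close>. The roots of a convergent sequence are therefore bounded, and a limit point of
  them in the closed semidefinite cone is a root of the limit.\<close>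

lemma closed_square_psd_matrix: "closed ((\<lambda>B :: real ^ 'm ^ 'm. B ** B) ` {B. psd_matrix B})"
  unfolding closed_sequential_limits
proof (intro allI impI, elim conjE)
  fix X :: "nat \<Rightarrow> real ^ 'm ^ 'm" and A
  assume "\<forall>n. X n \<in> (\<lambda>B. B ** B) ` {B. psd_matrix B}" and lim: "X \<longlonglongrightarrow> A"
  then obtain B where B: "\<And>n. psd_matrix (B n)" "\<And>n. X n = B n ** B n"
    by (simp add: image_iff) metis
  have cont_tr: "continuous_on UNIV (\<lambda>A :: real ^ 'm ^ 'm. trace A)"
    unfolding trace_def by (intro continuous_intros)
  have "(\<lambda>n. trace (X n)) \<longlonglongrightarrow> trace A"
    using continuous_on_tendsto_compose[OF cont_tr lim] by simp
  then have "Bseq (\<lambda>n. trace (X n))" using convergentI convergent_imp_Bseq by blast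
  then obtain K where K: "\<And>n. \<bar>trace (X n)\<bar> \<le> K" unfolding Bseq_def by auto
  have nB: "trace (X n) = (norm (B n))\<^sup>2" for n
  proof -
    have "transpose (B n) = B n" using B(1) by (simp add: psd_matrix_def)
    then have "B n $ i $ j = B n $ j $ i" for i j by (metis transpose_def vec_lambda_beta)
    then show ?thesis
      by (simp add: B(2) trace_def matrix_matrix_mult_def power2_norm_eq_inner inner_vec_def)
  qed
  have "B n \<in> {B. psd_matrix B} \<inter> cball 0 (sqrt K)" for n
    using K[of n] B(1)[of n] by (simp add: nB real_le_rsqrt)
  moreover have "compact ({B :: real ^ 'm ^ 'm. psd_matrix B} \<inter> cball 0 (sqrt K))"
    by (intro closed_Int_compact closed_psd_matrix compact_cball)
  ultimately obtain L r where L: "L \<in> {B. psd_matrix B} \<inter> cball 0 (sqrt K)" "strict_mono (r :: nat \<Rightarrow> nat)" "(B \<circ> r) \<longlonglongrightarrow> L"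
    unfolding compact_eq_seq_compact_metric seq_compact_def by metis
  have "continuous_on UNIV (\<lambda>B :: real ^ 'm ^ 'm. B ** B)" by (intro continuous_intros)
  from continuous_on_tendsto_compose[OF this L(3)] have "(\<lambda>n. X (r n)) \<longlonglongrightarrow> L ** L"
    by (simp add: B(2))
  moreover have "(\<lambda>n. X (r n)) \<longlonglongrightarrow> A"
    using LIMSEQ_subseq_LIMSEQ[OF lim L(2)] by (simp add: o_def)
  ultimately have "A = L ** L" using LIMSEQ_unique by blast
  then show "A \<in> (\<lambda>B. B ** B) ` {B. psd_matrix B}" using L(1) by auto
qed

text \<open>Provides the connectedness on which the existence of square roots rests.\<close>

lemma convex_pd_matrix: "convex {A :: real ^ 'm ^ 'm. pd_matrix A}"
proof (rule convexI)
  fix A B :: "real ^ 'm ^ 'm" and u v :: real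
  assume *: "A \<in> {A. pd_matrix A}" "B \<in> {A. pd_matrix A}" "0 \<le> u" "0 \<le> v" "u + v = 1"
  have sc: "(c *\<^sub>R M) *v x = c *\<^sub>R (M *v x)" for c :: real and M :: "real ^ 'm ^ 'm" and x
    by (simp add: scaleR_matrix_vector_assoc)
  have "0 < u * (x \<bullet> (A *v x)) + v * (x \<bullet> (B *v x))" if "x \<noteq> 0" for x
  proof -
    have a: "0 < x \<bullet> (A *v x)" "0 < x \<bullet> (B *v x)" using * that by (auto simp: pd_matrix_def)
    show ?thesis
    proof (cases "u = 0")
      case True then show ?thesis using * a by simp
    next
      case False then show ?thesis using * a by (intro add_pos_nonneg) auto
    qed
  qed
  then show "u *\<^sub>R A + v *\<^sub>R B \<in> {A. pd_matrix A}"
    using * by (auto simp: pd_matrix_def transpose_def vec_eq_iff matrix_vector_mult_add_rdistrib sc inner_add_right)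
qed

text \<open>Squaring is continuous and injective on the cone, hence an open map into the symmetric
  matrices by invariance of domain. Its image is nonempty, and both open and closed relative to a
  connected set, so it is the whole cone. Openness on subsets of the cone gives continuity of the
  inverse.\<close>

lemma
  shows square_image_pd_matrix: "(\<lambda>B :: real ^ 'm ^ 'm. B ** B) ` {B. pd_matrix B} = {A. pd_matrix A}"
    and square_homeomorphism_pd_matrix: "\<exists>g. homeomorphism {B :: real ^ 'm ^ 'm. pd_matrix B} {A. pd_matrix A} (\<lambda>B. B ** B) g"
proof -
  let ?sym = "{A :: real ^ 'm ^ 'm. transpose A = A}" and ?pd = "{A :: real ^ 'm ^ 'm. pd_matrix A}"
  let ?sq = "\<lambda>B :: real ^ 'm ^ 'm. B ** B"
  have sub: "subspace ?sym"
    by (auto simp: subspace_def transpose_def vec_eq_iff)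
  have cont: "continuous_on S ?sq" for S by (intro continuous_intros)
  have inj: "inj_on ?sq ?pd" by (auto intro!: inj_onI pd_matrix_square_inject)
  have sqpd: "?sq ` ?pd \<subseteq> ?pd"
  proof (intro image_subsetI CollectI)
    fix B :: "real ^ 'm ^ 'm" assume "B \<in> ?pd"
    then show "pd_matrix (B ** B)"
      by (intro pd_matrix_square pd_matrix_det_nonzero) (auto simp: pd_matrix_def)
  qed
  have pdsym: "?pd \<subseteq> ?sym" by (auto simp: pd_matrix_def)
  have opn: "openin (top_of_set ?sym) (?sq ` W)" if "openin (top_of_set ?pd) W" for W
  proof (rule invariance_of_domain_subspaces)
    show "openin (top_of_set ?sym) W" using openin_trans[OF that openin_pd_matrix] .
    have "W \<subseteq> ?pd" using that openin_imp_subset by blast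
    then show "?sq \<in> W \<rightarrow> ?sym" "inj_on ?sq W"
      using sqpd pdsym inj inj_on_subset by blast+
  qed (auto intro: sub cont)
  \<comment> \<open>Relative closedness comes from the closed image of the semidefinite cone: a
    semidefinite root of an invertible matrix is itself invertible, hence definite.\<close>
  have "?sq ` ?pd = ?pd \<inter> ?sq ` {B. psd_matrix B}"
  proof (intro equalityI subsetI)
    fix A assume "A \<in> ?pd \<inter> ?sq ` {B. psd_matrix B}"
    then obtain B where B: "psd_matrix B" "A = B ** B" "pd_matrix A" by auto
    then have "pd_matrix B"
      using pd_matrix_det_nonzero[OF B(3)] by (auto simp: det_mul intro!: psd_matrix_det_nonzero_imp_pd_matrix)
    then show "A \<in> ?sq ` ?pd" using B by auto
  qed (use sqpd pd_matrix_imp_psd_matrix in auto)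
  then have "closedin (top_of_set ?pd) (?sq ` ?pd)"
    using closed_square_psd_matrix by (auto simp: closedin_closed)
  moreover have "openin (top_of_set ?pd) (?sq ` ?pd)"
    using opn[of ?pd] sqpd pdsym by (simp add: openin_subset_trans)
  moreover have "connected ?pd" by (intro convex_connected convex_pd_matrix)
  moreover have "mat 1 \<in> ?pd" by (auto simp: pd_matrix_def)
  ultimately show im: "?sq ` ?pd = ?pd"
    unfolding connected_clopen by blast
  show "\<exists>g. homeomorphism ?pd ?pd ?sq g"
  proof -
    have opn': "openin (top_of_set ?pd) (?sq ` W)" if "openin (top_of_set ?pd) W" for W
    proof -
      have "?sq ` W \<subseteq> ?pd" using that openin_imp_subset sqpd by blast
      then show ?thesis using opn[OF that] pdsym by (simp add: openin_subset_trans)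
    qed
    obtain g where g: "homeomorphism ?pd ?pd ?sq g"
      by (rule homeomorphism_injective_open_map[OF cont im inj opn'])
    show ?thesis by (rule exI[where x=g]) (rule g)
  qed
qed

lemma
  assumes "pd_matrix A"
  shows pd_matrix_sqrt: "pd_matrix (matrix_sqrt A)"
    and matrix_sqrt_square: "matrix_sqrt A ** matrix_sqrt A = A"
proof -
  have "\<exists>!B. pd_matrix B \<and> B ** B = A"
    using square_image_pd_matrix assms pd_matrix_square_inject by (auto simp: set_eq_iff image_iff) metis
  from theI'[OF this] show "pd_matrix (matrix_sqrt A)" "matrix_sqrt A ** matrix_sqrt A = A"
    unfolding matrix_sqrt_def by auto
qed

text \<open>The inverse homeomorphism of squaring agrees with \<open>matrix_sqrt\<close> on the
  cone, since positive definite roots are unique.\<close>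

lemma continuous_on_matrix_sqrt: "continuous_on {A :: real ^ 'm ^ 'm. pd_matrix A} matrix_sqrt"
proof -
  obtain g where g: "homeomorphism {B :: real ^ 'm ^ 'm. pd_matrix B} {A. pd_matrix A} (\<lambda>B. B ** B) g"
    using square_homeomorphism_pd_matrix by blast
  have "g A = matrix_sqrt A" if "pd_matrix A" for A
  proof (rule pd_matrix_square_inject)
    show "pd_matrix (g A)" "g A ** g A = matrix_sqrt A ** matrix_sqrt A"
      using g that by (auto simp: homeomorphism_def matrix_sqrt_square)
  qed (rule pd_matrix_sqrt[OF that])
  then show ?thesis
    using g continuous_on_cong[of "{A. pd_matrix A}" "{A. pd_matrix A}" g matrix_sqrt]
    by (simp add: homeomorphism_def)
qed

text \<open>The determinant is the square of the nonzero determinant of the root.\<close>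

lemma pd_matrix_det_pos:
  assumes "pd_matrix A"
  shows "det A > 0"
proof -
  have "det A = (det (matrix_sqrt A))\<^sup>2"
    by (metis assms det_mul matrix_sqrt_square power2_eq_square)
  then show ?thesis
    using pd_matrix_det_nonzero[OF pd_matrix_sqrt[OF assms]] by simp
qed

lemma pd_matrix_sets_borel [measurable]: "{A :: real ^ 'm ^ 'm. pd_matrix A} \<in> sets borel"
proof -
  obtain W where "open W" "{A :: real ^ 'm ^ 'm. pd_matrix A} = {A. transpose A = A} \<inter> W"
    using openin_pd_matrix unfolding openin_open by blast
  then show ?thesis using closed_symmetric_matrices by (simp only:) (intro sets.Int borel_closed borel_open)
qed

lemma borel_measurable_matrix_sqrt [measurable]:
  "(matrix_sqrt :: real ^ 'm ^ 'm \<Rightarrow> _) \<in> borel_measurable borel"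
proof -
  \<comment> \<open>The square of a positive definite matrix is positive definite, so outside the
    cone the description has no witness and denotes one fixed value.\<close>
  have neg: "matrix_sqrt A = (THE B. False)" if "\<not> pd_matrix A" for A :: "real ^ 'm ^ 'm"
  proof -
    have "(\<lambda>B. pd_matrix B \<and> B ** B = A) = (\<lambda>_. False)"
      using that pd_matrix_square pd_matrix_det_nonzero by (metis pd_matrix_def)
    then show ?thesis unfolding matrix_sqrt_def by simp
  qed
  have "(\<lambda>A :: real ^ 'm ^ 'm. if A \<in> {A. pd_matrix A} then matrix_sqrt A else (THE B. False)) \<in> borel_measurable borel"
    by (intro borel_measurable_continuous_on_if pd_matrix_sets_borel continuous_on_matrix_sqrt continuous_on_const)
  also have "(\<lambda>A :: real ^ 'm ^ 'm. if A \<in> {A. pd_matrix A} then matrix_sqrt A else (THE B. False)) = matrix_sqrt"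
    by (auto simp: fun_eq_iff neg)
  finally show ?thesis .
qed

section \<open>The law of the Gram matrix\<close>

definition index_pairs :: "'m::linorder set \<Rightarrow> ('m \<times> 'm) set" where
  "index_pairs I = {(i, j). i \<in> I \<and> j \<in> I \<and> i \<le> j}"

text \<open>The upper triangular entries of Z Z^T, for an array Z with rows indexed by
  \<open>I\<close> and one column for each sample in \<open>N\<close>.\<close>

definition gram_coords :: "'c set \<Rightarrow> 'm::linorder set \<Rightarrow> ('m \<times> 'c \<Rightarrow> real) \<Rightarrow> 'm \<times> 'm \<Rightarrow> real" where
  "gram_coords N I z = (\<lambda>p\<in>index_pairs I. \<Sum>c\<in>N. z (fst p, c) * z (snd p, c))"

text \<open>Extending by the identity outside \<open>I\<close> allows an induction on \<open>I\<close> with a fixed matrix type.\<close>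

definition sym_minor :: "'m set \<Rightarrow> ('m \<times> 'm \<Rightarrow> real) \<Rightarrow> real ^ ('m::{finite,linorder}) ^ ('m::{finite,linorder})" where
  "sym_minor I u = (\<chi> i j. if i \<in> I \<and> j \<in> I then u (min i j, max i j) else of_bool (i = j))"

text \<open>The determinant factor of a Wishart density. The indicator of the cone is part of it, so
  that integrals may run over all symmetric coordinates.\<close>

definition pd_det_powr :: "real \<Rightarrow> real ^ 'm ^ 'm \<Rightarrow> ennreal" where
  "pd_det_powr \<alpha> A = ennreal (if pd_matrix A then det A powr \<alpha> else 0)"

lemma mem_index_pairs [simp]: "(i, j) \<in> index_pairs I \<longleftrightarrow> i \<in> I \<and> j \<in> I \<and> i \<le> j"
  by (simp add: index_pairs_def)

lemma finite_index_pairs [simp]: "finite I \<Longrightarrow> finite (index_pairs I)"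
  by (rule finite_subset[of _ "I \<times> I"]) (auto simp: index_pairs_def)

lemma sym_minor_cong:
  assumes "\<And>p. p \<in> index_pairs I \<Longrightarrow> u p = v p"
  shows "sym_minor I u = sym_minor I v"
  using assms by (auto simp: sym_minor_def vec_eq_iff min_def max_def)

lemma measurable_sym_minor [measurable]:
  "sym_minor I \<in> borel_measurable (lborel_PiM (index_pairs (I :: 'm::{finite,linorder} set)))"
proof -
  have "(\<lambda>u. if i \<in> I \<and> j \<in> I then u (min i j, max i j) else of_bool (i = j))
      \<in> borel_measurable (lborel_PiM (index_pairs I))" for i j
    using measurable_component_singleton[of "(min i j, max i j)" "index_pairs I" "\<lambda>_. lborel :: real measure"]
    by (cases "i \<in> I \<and> j \<in> I") (auto simp: min_def max_def)
  then show ?thesis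
    unfolding sym_minor_def
    by (subst borel_measurable_euclidean_space) (auto simp: Basis_vec_def inner_axis)
qed

lemma borel_measurable_det [measurable]:
  "(\<lambda>A :: real ^ 'm ^ 'm. det A) \<in> borel_measurable borel"
  by (intro borel_measurable_continuous_onI continuous_on_det continuous_on_id)

lemma measurable_pred_pd_matrix [measurable]:
  "Measurable.pred (borel :: (real ^ 'm ^ 'm) measure) pd_matrix"
  using pd_matrix_sets_borel by (simp add: pred_def)

lemma measurable_pd_det_powr [measurable]:
  "pd_det_powr \<alpha> \<in> borel_measurable (borel :: (real ^ 'm ^ 'm) measure)"
  unfolding pd_det_powr_def by measurable

text \<open>The form of the congruent matrix at \<open>x\<close> is that of \<open>A\<close> at
  \<open>transpose M *v x\<close>, a nonzero vector when \<open>x\<close> is nonzero. The converse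
  is the same implication for the inverse of \<open>M\<close>.\<close>

lemma pd_matrix_congruence:
  fixes M A :: "real ^ 'm ^ 'm"
  assumes M: "det M \<noteq> 0"
  shows "pd_matrix (M ** A ** transpose M) \<longleftrightarrow> pd_matrix A"
proof -
  have imp: "pd_matrix (M ** A ** transpose M)" if M: "det M \<noteq> 0" and A: "pd_matrix A" for M A :: "real ^ 'm ^ 'm"
  proof -
    have sym: "transpose (M ** A ** transpose M) = M ** A ** transpose M"
      using A by (simp add: matrix_transpose_mul matrix_mul_assoc pd_matrix_def)
    have "0 < x \<bullet> ((M ** A ** transpose M) *v x)" if "x \<noteq> 0" for x
    proof -
      have "x \<bullet> ((M ** A ** transpose M) *v x) = x \<bullet> (M *v (A *v (transpose M *v x)))"
        by (simp only: matrix_vector_mul_assoc matrix_mul_assoc)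
      also have "\<dots> = (transpose M *v x) \<bullet> (A *v (transpose M *v x))"
        by (metis dot_lmul_matrix transpose_matrix_vector transpose_transpose)
      also have "\<dots> > 0"
      proof -
        have "transpose M *v x \<noteq> 0"
          using M that by (metis det_transpose invertible_det_nz invertible_left_inverse matrix_left_invertible_ker)
        then show ?thesis using A by (simp add: pd_matrix_def)
      qed
      finally show ?thesis .
    qed
    then show ?thesis using sym by (simp add: pd_matrix_def)
  qed
  define L where "L = matrix_inv M"
  have LM: "L ** M = mat 1" unfolding L_def by (rule matrix_inv_left[OF M])
  have "det L * det M = 1" using LM by (metis det_I det_mul)
  then have L: "det L \<noteq> 0" by auto
  have "L ** (M ** A ** transpose M) ** transpose L = (L ** M) ** A ** transpose (L ** M)"
    by (simp add: matrix_transpose_mul matrix_mul_assoc)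
  also have "\<dots> = A" by (simp add: LM)
  finally have "A = L ** (M ** A ** transpose M) ** transpose L" ..
  then show ?thesis using imp[OF M, of A] imp[OF L, of "M ** A ** transpose M"] by auto
qed

text \<open>Padded with the identity in row and column \<open>k\<close>, so that the remaining block
  keeps both the matrix type and its determinant.\<close>

definition schur_complement :: "'m \<Rightarrow> real ^ 'm ^ 'm \<Rightarrow> real ^ 'm ^ 'm" where
  "schur_complement k A = (\<chi> i j. if i = k \<or> j = k then of_bool (i = j)
     else A $ i $ j - A $ i $ k * A $ j $ k / A $ k $ k)"

text \<open>One step of Cholesky elimination: \<open>M\<close> is the identity with column
  \<open>k\<close> replaced by x, which is column \<open>k\<close> of \<open>A\<close> divided by
  the root of the pivot. The matrix x x^T restores what the Schur complement subtracts.\<close>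

lemma schur_complement_factor:
  fixes A :: "real ^ 'm ^ 'm"
  assumes sym: "transpose A = A" and r: "A $ k $ k > 0"
  obtains M where "det M = sqrt (A $ k $ k)" "A = M ** schur_complement k A ** transpose M"
proof
  define x where "x = (\<chi> i. A $ i $ k / sqrt (A $ k $ k))"
  \<comment> \<open>This is the shape of the matrix in \<open>cramer_lemma\<close>, which gives
    \<open>det M = x $ k\<close> at once.\<close>
  define M :: "real ^ 'm ^ 'm" where "M = (\<chi> i j. if j = k then (mat 1 *v x) $ i else mat 1 $ i $ j)"
  show "det M = sqrt (A $ k $ k)"
    unfolding M_def cramer_lemma using r by (simp add: x_def real_div_sqrt)
  have M: "M $ i $ j = (if j = k then x $ i else of_bool (i = j))" for i j
    by (simp only: M_def matrix_vector_mul_lid) (simp add: mat_def)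
  define S where "S = schur_complement k A"
  have S: "S $ i $ j = (if i = k \<or> j = k then of_bool (i = j) else A $ i $ j - A $ i $ k * A $ j $ k / A $ k $ k)" for i j
    by (simp add: S_def schur_complement_def)
  have MS: "(M ** S) $ i $ b = x $ i * of_bool (b = k) + (if i = k then 0 else of_bool (b \<noteq> k) * S $ i $ b)" for i b
  proof -
    have "(M ** S) $ i $ b = x $ i * S $ k $ b + (\<Sum>a\<in>UNIV - {k}. M $ i $ a * S $ a $ b)"
      unfolding matrix_matrix_mult_def by (simp add: sum.remove[of UNIV k] M)
    also have "(\<Sum>a\<in>UNIV - {k}. M $ i $ a * S $ a $ b) = (\<Sum>a\<in>UNIV - {k}. if a = i then S $ a $ b else 0)"
      by (intro sum.cong) (auto simp: M)
    also have "\<dots> = (if i = k then 0 else S $ i $ b)" by (simp add: sum.delta)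
    finally show ?thesis by (auto simp: S)
  qed
  have symA: "A $ i $ j = A $ j $ i" for i j using sym by (metis transpose_def vec_lambda_beta)
  have "(M ** S ** transpose M) $ i $ j = A $ i $ j" for i j
  proof -
    have "(M ** S ** transpose M) $ i $ j = x $ i * x $ j + (\<Sum>b\<in>UNIV - {k}. (M ** S) $ i $ b * M $ j $ b)"
      unfolding matrix_matrix_mult_def[of "M ** S"] transpose_def
      by (simp add: sum.remove[of UNIV k] M MS)
    also have "(\<Sum>b\<in>UNIV - {k}. (M ** S) $ i $ b * M $ j $ b) =
        (\<Sum>b\<in>UNIV - {k}. if b = j then if i = k then 0 else S $ i $ b else 0)"
      by (intro sum.cong) (auto simp: M MS)
    also have "\<dots> = (if i = k \<or> j = k then 0 else S $ i $ j)" by (simp add: sum.delta)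
    also have "x $ i * x $ j = A $ i $ k * A $ j $ k / A $ k $ k"
      using r by (simp add: x_def)
    finally show ?thesis using r by (auto simp: S symA)
  qed
  then show "A = M ** schur_complement k A ** transpose M"
    by (simp add: vec_eq_iff S_def)
qed

lemma pd_matrix_diag_pos: "pd_matrix A \<Longrightarrow> A $ k $ k > 0"
  unfolding pd_matrix_def
  by (auto dest!: spec[of _ "axis k 1"] simp: axis_eq_0_iff matrix_vector_mult_basis inner_axis' column_def)

text \<open>Congruence by the elimination factor preserves definiteness and multiplies the
  determinant by the pivot. A positive definite matrix has a positive diagonal, so no weight is lost
  where the pivot is not positive.\<close>

lemma pd_det_powr_schur:
  fixes A :: "real ^ 'm ^ 'm"
  assumes sym: "transpose A = A"
  shows "pd_det_powr \<alpha> A = (if A $ k $ k > 0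
    then ennreal ((A $ k $ k) powr \<alpha>) * pd_det_powr \<alpha> (schur_complement k A) else 0)"
proof (cases "A $ k $ k > 0")
  case False
  then show ?thesis using pd_matrix_diag_pos by (auto simp: pd_det_powr_def)
next
  case True
  obtain M where M: "det M = sqrt (A $ k $ k)" "A = M ** schur_complement k A ** transpose M"
    using schur_complement_factor[OF sym True] .
  have pd: "pd_matrix A \<longleftrightarrow> pd_matrix (schur_complement k A)"
    using pd_matrix_congruence[of M "schur_complement k A"] M True by simp
  have "det A = det M * det (schur_complement k A) * det M"
    by (subst M(2)) (simp add: det_mul)
  then have "det A = A $ k $ k * det (schur_complement k A)"
    using True M(1) by simp
  then show ?thesis
    using True pd_matrix_det_pos[of "schur_complement k A"]
    by (auto simp: pd_det_powr_def pd powr_mult ennreal_mult)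
qed

lemma transpose_sym_minor: "transpose (sym_minor I u) = sym_minor I u"
  by (auto simp: sym_minor_def transpose_def vec_eq_iff min.commute max.commute)

text \<open>As \<open>k\<close> exceeds all of \<open>I\<close>, the entries of its row and column
  are stored at \<open>(i, k)\<close>. The two identity paddings match, so eliminating
  \<open>k\<close> yields a \<open>sym_minor\<close> over the smaller set.\<close>

lemma schur_complement_sym_minor:
  assumes k: "\<And>i. i \<in> I \<Longrightarrow> i < k"
    and v: "\<And>i j. i \<in> I \<Longrightarrow> j \<in> I \<Longrightarrow> i \<le> j \<Longrightarrow> v (i, j) = u (i, j) - u (i, k) * u (j, k) / u (k, k)"
  shows "schur_complement k (sym_minor (insert k I) u) = sym_minor I v"
proof -
  have ik: "i \<noteq> k" "min i k = i" "max i k = k" "min k i = i" "max k i = k" if "i \<in> I" for i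
    using k[OF that] by auto
  have kI: "k \<notin> I" using k by blast
  have "schur_complement k (sym_minor (insert k I) u) $ i $ j = sym_minor I v $ i $ j" for i j
  proof (cases "i \<in> I \<and> j \<in> I")
    case True
    have "v (min i j, max i j) = u (min i j, max i j) - u (i, k) * u (j, k) / u (k, k)"
      using v[of i j] v[of j i] True by (cases "i \<le> j") (auto simp: min_def max_def)
    then show ?thesis
      using True by (simp add: schur_complement_def sym_minor_def ik)
  next
    case False
    then show ?thesis
      using kI by (auto simp: schur_complement_def sym_minor_def ik)
  qed
  then show ?thesis by (simp add: vec_eq_iff)
qed

section \<open>Shears and rotations of the columns\<close>

lemma measurable_lborel_PiM_component:
  "p \<in> J \<Longrightarrow> (\<lambda>x. x p) \<in> borel_measurable (lborel_PiM J)"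
  using measurable_component_singleton[of p J "\<lambda>_. lborel :: real measure"] by simp

lemma measurable_lborel_PiM_I:
  assumes "\<And>p. p \<in> J \<Longrightarrow> (\<lambda>x. f x p) \<in> borel_measurable M"
  shows "(\<lambda>x. \<lambda>p\<in>J. f x p) \<in> M \<rightarrow>\<^sub>M lborel_PiM J"
  using assms by (intro measurable_restrict) simp

lemma measurable_gram_coords:
  "gram_coords N I \<in> lborel_PiM (I \<times> N) \<rightarrow>\<^sub>M lborel_PiM (index_pairs I)"
  unfolding gram_coords_def
  by (intro measurable_lborel_PiM_I borel_measurable_sum borel_measurable_times
      measurable_lborel_PiM_component) auto

definition column_shear :: "'c \<Rightarrow> 'c \<Rightarrow> real \<Rightarrow> ('m \<times> 'c) set \<Rightarrow> ('m \<times> 'c \<Rightarrow> real) \<Rightarrow> 'm \<times> 'c \<Rightarrow> real" where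
  "column_shear c d \<tau> J z = (\<lambda>p\<in>J. if snd p = c then z p + \<tau> * z (fst p, d) else z p)"

lemma measurable_column_shear:
  assumes "d \<in> N"
  shows "column_shear c d \<tau> (I \<times> N) \<in> lborel_PiM (I \<times> N) \<rightarrow>\<^sub>M lborel_PiM (I \<times> N)"
  unfolding column_shear_def
proof (intro measurable_lborel_PiM_I)
  fix p assume p: "p \<in> I \<times> N"
  then have "(\<lambda>z. z p) \<in> borel_measurable (lborel_PiM (I \<times> N))" "(\<lambda>z. z (fst p, d)) \<in> borel_measurable (lborel_PiM (I \<times> N))"
    using assms by (auto intro!: measurable_lborel_PiM_component)
  then show "(\<lambda>z. if snd p = c then z p + \<tau> * z (fst p, d) else z p) \<in> borel_measurable (lborel_PiM (I \<times> N))"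
    by (cases "snd p = c") auto
qed

lemma nn_integral_column_shear:
  assumes fin: "finite I" "finite N" and cd: "c \<in> N" "d \<in> N" "c \<noteq> d"
    and Q: "Q \<in> borel_measurable (lborel_PiM (I \<times> N))"
  shows "(\<integral>\<^sup>+z. Q (column_shear c d \<tau> (I \<times> N) z) \<partial>lborel_PiM (I \<times> N)) = (\<integral>\<^sup>+z. Q z \<partial>lborel_PiM (I \<times> N))"
proof -
  have U: "(I \<times> (N - {c})) \<union> (I \<times> {c}) = I \<times> N" using cd by auto
  have eq: "column_shear c d \<tau> (I \<times> N) z = (\<lambda>p\<in>(I \<times> (N - {c})) \<union> (I \<times> {c}). if p \<in> I \<times> {c}
      then z p + (\<lambda>y p. \<tau> * y (fst p, d)) (restrict z (I \<times> (N - {c}))) p else z p)" for z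
    unfolding column_shear_def U using cd by (auto simp: fun_eq_iff)
  have m: "(\<lambda>y. \<tau> * y (fst p, d)) \<in> borel_measurable (lborel_PiM (I \<times> (N - {c})))" if "p \<in> I \<times> {c}" for p
    using that cd by (intro borel_measurable_times borel_measurable_const measurable_lborel_PiM_component) auto
  have "(\<integral>\<^sup>+z. Q (\<lambda>p\<in>(I \<times> (N - {c})) \<union> (I \<times> {c}). if p \<in> I \<times> {c}
      then z p + (\<lambda>y p. \<tau> * y (fst p, d)) (restrict z (I \<times> (N - {c}))) p else z p)
      \<partial>lborel_PiM ((I \<times> (N - {c})) \<union> (I \<times> {c}))) = (\<integral>\<^sup>+z. Q z \<partial>lborel_PiM ((I \<times> (N - {c})) \<union> (I \<times> {c})))"
  proof (rule nn_integral_lborel_PiM_shear)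
    show "Q \<in> borel_measurable (lborel_PiM ((I \<times> (N - {c})) \<union> (I \<times> {c})))" unfolding U by (rule Q)
    show "(I \<times> {c}) \<inter> (I \<times> (N - {c})) = {}" by auto
  qed (use fin m in auto)
  then show ?thesis unfolding eq unfolding U .
qed

text \<open>A plane rotation by an angle that is not a multiple of \<open>\<pi>\<close> is a product of three shears;
  this avoids a theory of linear maps on \<open>PiM\<close>.\<close>

definition column_rotation :: "'c \<Rightarrow> 'c \<Rightarrow> real \<Rightarrow> real \<Rightarrow> ('m \<times> 'c) set \<Rightarrow> ('m \<times> 'c \<Rightarrow> real) \<Rightarrow> 'm \<times> 'c \<Rightarrow> real" where
  "column_rotation c d x y J z =
    (\<lambda>p\<in>J. if snd p = c then x * z p - y * z (fst p, d)
      else if snd p = d then y * z (fst p, c) + x * z p else z p)"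

lemma column_rotation_eq_shears:
  fixes z :: "'m \<times> 'c \<Rightarrow> real"
  assumes cd: "c \<in> N" "d \<in> N" "c \<noteq> d" and xy: "x\<^sup>2 + y\<^sup>2 = 1" "y \<noteq> 0"
  shows "column_rotation c d x y (I \<times> N) z =
    column_shear c d (- (1 - x) / y) (I \<times> N) (column_shear d c y (I \<times> N) (column_shear c d (- (1 - x) / y) (I \<times> N) z))"
proof
  fix p :: "'m \<times> 'c"
  obtain i e where p: "p = (i, e)" by (cases p)
  \<comment> \<open>With \<open>x\<close> and \<open>y\<close> as cosine and sine of an angle,
    \<open>q\<close> is the tangent of half the angle, and the facts \<open>t\<close> and
    \<open>t2\<close> are half-angle formulas.\<close>
  define q where "q = (1 - x) / y"
  have t: "q * y = 1 - x" using xy by (simp add: q_def)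
  have "(1 - x) * (1 + x) = y * y" using xy(1) by (simp add: power2_eq_square algebra_simps)
  then have t2: "q * (1 + x) = y" using xy by (simp add: q_def field_simps)
  have "z (i, c) - q * z (i, d) - q * (z (i, d) + y * (z (i, c) - q * z (i, d)))
      = (1 - q * y) * z (i, c) - q * (1 + (1 - q * y)) * z (i, d)"
    by (simp add: algebra_simps)
  also have "\<dots> = x * z (i, c) - y * z (i, d)" unfolding t using t2 by simp
  finally have A: "z (i, c) - q * z (i, d) - q * (z (i, d) + y * (z (i, c) - q * z (i, d)))
      = x * z (i, c) - y * z (i, d)" .
  have "z (i, d) + y * (z (i, c) - q * z (i, d)) = y * z (i, c) + (1 - q * y) * z (i, d)"
    by (simp add: algebra_simps)
  then have B: "z (i, d) + y * (z (i, c) - q * z (i, d)) = y * z (i, c) + x * z (i, d)" unfolding t by simp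
  have nq: "- (1 - x) / y = - q" by (simp add: q_def minus_divide_left)
  have "column_rotation c d x y (I \<times> N) z p =
    column_shear c d (- q) (I \<times> N) (column_shear d c y (I \<times> N) (column_shear c d (- q) (I \<times> N) z)) p"
  proof (cases "i \<in> I \<and> e \<in> N")
    case True
    consider "e = c" | "e = d" "e \<noteq> c" | "e \<noteq> c" "e \<noteq> d" by blast
    then show ?thesis
    proof cases
      case 1
      then show ?thesis using True cd A by (simp add: p column_rotation_def column_shear_def)
    next
      case 2
      then show ?thesis using True cd B by (simp add: p column_rotation_def column_shear_def)
    next
      case 3
      then show ?thesis using True cd by (simp add: p column_rotation_def column_shear_def)
    qed
  qed (auto simp: p column_rotation_def column_shear_def)
  then show "column_rotation c d x y (I \<times> N) z p =
    column_shear c d (- (1 - x) / y) (I \<times> N) (column_shear d c y (I \<times> N) (column_shear c d (- (1 - x) / y) (I \<times> N) z)) p"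
    by (simp only: nq)
qed

lemma nn_integral_column_rotation:
  assumes fin: "finite I" "finite N" and cd: "c \<in> N" "d \<in> N" "c \<noteq> d"
    and xy: "x\<^sup>2 + y\<^sup>2 = 1" "y \<noteq> 0"
    and Q: "Q \<in> borel_measurable (lborel_PiM (I \<times> N))"
  shows "(\<integral>\<^sup>+z. Q (column_rotation c d x y (I \<times> N) z) \<partial>lborel_PiM (I \<times> N)) = (\<integral>\<^sup>+z. Q z \<partial>lborel_PiM (I \<times> N))"
proof -
  let ?S = "column_shear c d (- (1 - x) / y) (I \<times> N)" and ?T = "column_shear d c y (I \<times> N)"
  have mS: "?S \<in> lborel_PiM (I \<times> N) \<rightarrow>\<^sub>M lborel_PiM (I \<times> N)" and mT: "?T \<in> lborel_PiM (I \<times> N) \<rightarrow>\<^sub>M lborel_PiM (I \<times> N)"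
    using cd by (auto intro!: measurable_column_shear)
  have dc: "d \<noteq> c" using cd by simp
  note QS = measurable_compose[OF mS Q]
  note QST = measurable_compose[OF mT QS]
  have "(\<integral>\<^sup>+z. Q (?S (?T (?S z))) \<partial>lborel_PiM (I \<times> N)) = (\<integral>\<^sup>+z. Q (?S (?T z)) \<partial>lborel_PiM (I \<times> N))"
    by (rule nn_integral_column_shear[OF fin cd QST])
  also have "\<dots> = (\<integral>\<^sup>+z. Q (?S z) \<partial>lborel_PiM (I \<times> N))"
    by (rule nn_integral_column_shear[OF fin cd(2,1) dc QS])
  also have "\<dots> = (\<integral>\<^sup>+z. Q z \<partial>lborel_PiM (I \<times> N))"
    by (rule nn_integral_column_shear[OF fin cd Q])
  finally show ?thesis
    by (simp only: column_rotation_eq_shears[OF cd xy])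
qed

lemma sum_remove2:
  fixes f :: "'c \<Rightarrow> real"
  assumes "finite N" "c \<in> N" "d \<in> N" "c \<noteq> d"
  shows "sum f N = f c + f d + sum f (N - {c, d})"
proof -
  have "sum f N = f c + sum f (N - {c})" using assms by (simp add: sum.remove)
  also have "sum f (N - {c}) = f d + sum f (N - {c} - {d})" using assms by (intro sum.remove) auto
  also have "N - {c} - {d} = N - {c, d}" by auto
  finally show ?thesis by simp
qed

lemma gram_coords_column_rotation:
  assumes fin: "finite N" and cd: "c \<in> N" "d \<in> N" "c \<noteq> d" and xy: "x\<^sup>2 + y\<^sup>2 = 1"
  shows "gram_coords N I (column_rotation c d x y (I \<times> N) z) = gram_coords N I z"
proof -
  have "(\<Sum>e\<in>N. column_rotation c d x y (I \<times> N) z (i, e) * column_rotation c d x y (I \<times> N) z (j, e)) =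
      (\<Sum>e\<in>N. z (i, e) * z (j, e))" if ij: "i \<in> I" "j \<in> I" for i j
  proof -
    have "(\<Sum>e\<in>N. column_rotation c d x y (I \<times> N) z (i, e) * column_rotation c d x y (I \<times> N) z (j, e)) =
        (x * z (i, c) - y * z (i, d)) * (x * z (j, c) - y * z (j, d))
        + (y * z (i, c) + x * z (i, d)) * (y * z (j, c) + x * z (j, d)) + (\<Sum>e\<in>N - {c, d}. z (i, e) * z (j, e))"
      using cd ij by (subst sum_remove2[OF fin cd]) (auto simp: column_rotation_def intro!: sum.cong)
    also have "(x * z (i, c) - y * z (i, d)) * (x * z (j, c) - y * z (j, d))
        + (y * z (i, c) + x * z (i, d)) * (y * z (j, c) + x * z (j, d)) =
        (x\<^sup>2 + y\<^sup>2) * (z (i, c) * z (j, c) + z (i, d) * z (j, d))"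
      by (simp add: algebra_simps power2_eq_square)
    finally show ?thesis using xy by (simp add: sum_remove2[OF fin cd, of "\<lambda>e. z (i, e) * z (j, e)"])
  qed
  then show ?thesis
    by (auto simp: gram_coords_def fun_eq_iff index_pairs_def)
qed

text \<open>In the application \<open>w\<close> is the last row of Z, and the sums are its inner
  products with the other rows. Rotations in the planes of \<open>c0\<close> and \<open>d\<close>,
  one \<open>d\<close> at a time, move all of \<open>w\<close> into the entry at \<open>c0\<close>.
  The number \<open>t\<close> is chosen before \<open>H\<close>; its sign stays open, since later
  only \<open>t\<^sup>2\<close> and its absolute value count.\<close>

lemma nn_integral_rotate_to_axis:
  fixes w :: "'c \<Rightarrow> real" and I :: "'m::linorder set"
  assumes fin: "finite I" "finite N" and c0: "c0 \<in> N"
  shows "\<exists>t. t\<^sup>2 = (\<Sum>c\<in>N. (w c)\<^sup>2) \<and>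
    (\<forall>H. (\<lambda>(g, a). H g a) \<in> borel_measurable (lborel_PiM (index_pairs I) \<Otimes>\<^sub>M lborel_PiM I) \<longrightarrow>
      (\<integral>\<^sup>+z. H (gram_coords N I z) (\<lambda>i\<in>I. \<Sum>c\<in>N. z (i, c) * w c) \<partial>lborel_PiM (I \<times> N)) =
      (\<integral>\<^sup>+z. H (gram_coords N I z) (\<lambda>i\<in>I. t * z (i, c0)) \<partial>lborel_PiM (I \<times> N)))"
proof -
  let ?J = "\<lambda>H w. \<integral>\<^sup>+z. H (gram_coords N I z) (\<lambda>i\<in>I. \<Sum>c\<in>N. z (i, c) * w c) \<partial>lborel_PiM (I \<times> N)"
  let ?M = "borel_measurable (lborel_PiM (index_pairs I) \<Otimes>\<^sub>M lborel_PiM I)"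
  \<comment> \<open>\<open>K\<close> collects the columns whose entry has already been rotated to
    0.\<close>
  have "\<exists>w'. (\<forall>c\<in>K. w' c = 0) \<and> (\<Sum>c\<in>N. (w' c)\<^sup>2) = (\<Sum>c\<in>N. (w c)\<^sup>2) \<and>
      (\<forall>H. (\<lambda>(g, a). H g a) \<in> ?M \<longrightarrow> ?J H w = ?J H w')" if "K \<subseteq> N - {c0}" for K
    using finite_subset[OF that finite_Diff[OF fin(2)]] that
  proof (induction K rule: finite_induct)
    case empty
    show ?case by (intro exI[of _ w]) simp
  next
    case (insert d K)
    have "K \<subseteq> N - {c0}" using insert.prems by simp
    from insert.IH[OF this] obtain w' where "\<forall>c\<in>K. w' c = 0" "(\<Sum>c\<in>N. (w' c)\<^sup>2) = (\<Sum>c\<in>N. (w c)\<^sup>2)"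
      "\<forall>H. (\<lambda>(g, a). H g a) \<in> ?M \<longrightarrow> ?J H w = ?J H w'" by (elim exE conjE)
    note w' = this(1)[rule_format] this(2) this(3)[rule_format]
    show ?case
    \<comment> \<open>An entry that is already 0 is left alone: the rotation would have
      \<open>y = 0\<close>, where the factorisation into shears divides by 0.\<close>
    proof (cases "w' d = 0")
      case True
      then have "\<forall>c\<in>insert d K. w' c = 0" using w'(1) by simp
      moreover have "\<forall>H. (\<lambda>(g, a). H g a) \<in> ?M \<longrightarrow> ?J H w = ?J H w'" using w'(3) by (intro allI impI)
      ultimately show ?thesis using w'(2) by (intro exI[of _ w'] conjI)
    next
      case False
      have cd: "c0 \<in> N" "d \<in> N" "c0 \<noteq> d" using insert.prems c0 by auto
      define \<rho> where "\<rho> = sqrt ((w' c0)\<^sup>2 + (w' d)\<^sup>2)"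
      have pos: "(w' c0)\<^sup>2 + (w' d)\<^sup>2 > 0" using False by (simp add: add_nonneg_pos)
      have \<rho>: "\<rho> > 0" "\<rho>\<^sup>2 = (w' c0)\<^sup>2 + (w' d)\<^sup>2" using pos by (auto simp: \<rho>_def)
      \<comment> \<open>The signs are such that a rotated row pairs with the new vector
        \<open>v\<close> as the original row pairs with \<open>w'\<close>.\<close>
      define x y where "x = w' c0 / \<rho>" and "y = - (w' d / \<rho>)"
      have xy: "x\<^sup>2 + y\<^sup>2 = 1" "y \<noteq> 0"
        using \<rho> pos False by (auto simp: x_def y_def power_divide add_divide_distrib[symmetric])
      define v where "v = w'(c0 := \<rho>, d := 0)"
      have v: "v c0 = \<rho>" "v d = 0" "\<And>e. e \<in> N - {c0, d} \<Longrightarrow> v e = w' e" using cd by (auto simp: v_def)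
      have dot: "(\<Sum>c\<in>N. column_rotation c0 d x y (I \<times> N) z (i, c) * v c) = (\<Sum>c\<in>N. z (i, c) * w' c)"
        if i: "i \<in> I" for i z
      proof -
        have "(\<Sum>c\<in>N. column_rotation c0 d x y (I \<times> N) z (i, c) * v c) =
            (x * z (i, c0) - y * z (i, d)) * \<rho> + (\<Sum>e\<in>N - {c0, d}. z (i, e) * w' e)"
          using cd i v by (subst sum_remove2[OF fin(2) cd]) (auto simp: column_rotation_def intro!: sum.cong)
        also have "(x * z (i, c0) - y * z (i, d)) * \<rho> = z (i, c0) * w' c0 + z (i, d) * w' d"
          using \<rho>(1) by (simp add: x_def y_def algebra_simps)
        finally show ?thesis by (simp add: sum_remove2[OF fin(2) cd])
      qed
      have J: "?J H w = ?J H v" if H: "(\<lambda>(g, a). H g a) \<in> ?M" for H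
      proof -
        define Q where "Q z = H (gram_coords N I z) (\<lambda>i\<in>I. \<Sum>c\<in>N. z (i, c) * v c)" for z
        have "(\<lambda>z. (gram_coords N I z, \<lambda>i\<in>I. \<Sum>c\<in>N. z (i, c) * v c)) \<in>
            lborel_PiM (I \<times> N) \<rightarrow>\<^sub>M lborel_PiM (index_pairs I) \<Otimes>\<^sub>M lborel_PiM I"
          by (intro measurable_Pair measurable_gram_coords measurable_lborel_PiM_I borel_measurable_sum
              borel_measurable_times borel_measurable_const measurable_lborel_PiM_component) auto
        from measurable_compose[OF this H] have Q: "Q \<in> borel_measurable (lborel_PiM (I \<times> N))"
          unfolding Q_def by simp
        have "?J H w = ?J H w'" by (rule w'(3)[OF H])
        also have "\<dots> = (\<integral>\<^sup>+z. Q (column_rotation c0 d x y (I \<times> N) z) \<partial>lborel_PiM (I \<times> N))"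
          unfolding Q_def gram_coords_column_rotation[OF fin(2) cd xy(1)] using dot
          by (intro nn_integral_cong arg_cong2[where f=H] refl restrict_ext) simp
        also have "\<dots> = (\<integral>\<^sup>+z. Q z \<partial>lborel_PiM (I \<times> N))"
          by (rule nn_integral_column_rotation[OF fin cd xy Q])
        finally show ?thesis by (simp only: Q_def)
      qed
      have "(\<Sum>c\<in>N. (v c)\<^sup>2) = (\<Sum>c\<in>N. (w' c)\<^sup>2)"
        using v \<rho> by (simp add: sum_remove2[OF fin(2) cd])
      then have "(\<Sum>c\<in>N. (v c)\<^sup>2) = (\<Sum>c\<in>N. (w c)\<^sup>2)" using w'(2) by simp
      moreover have "\<forall>c\<in>insert d K. v c = 0" using w'(1) insert.prems by (auto simp: v_def)
      moreover have "\<forall>H. (\<lambda>(g, a). H g a) \<in> ?M \<longrightarrow> ?J H w = ?J H v" using J by (intro allI impI)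
      ultimately show ?thesis by (intro exI[of _ v] conjI)
    qed
  qed
  from this[OF subset_refl] obtain w' where "\<forall>c\<in>N - {c0}. w' c = 0"
    "(\<Sum>c\<in>N. (w' c)\<^sup>2) = (\<Sum>c\<in>N. (w c)\<^sup>2)" "\<forall>H. (\<lambda>(g, a). H g a) \<in> ?M \<longrightarrow> ?J H w = ?J H w'"
    by (elim exE conjE)
  note w' = this(1)[rule_format] this(2) this(3)[rule_format]
  have s: "(\<Sum>c\<in>N. f c * w' c) = f c0 * w' c0" for f
    using sum.remove[OF fin(2) c0, of "\<lambda>c. f c * w' c"] w'(1) by simp
  show ?thesis
  proof (intro exI[of _ "w' c0"] conjI allI impI)
    show "(w' c0)\<^sup>2 = (\<Sum>c\<in>N. (w c)\<^sup>2)"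
      using w'(2) s[of w'] by (simp add: power2_eq_square)
    show "?J H w = (\<integral>\<^sup>+z. H (gram_coords N I z) (\<lambda>i\<in>I. w' c0 * z (i, c0)) \<partial>lborel_PiM (I \<times> N))"
      if "(\<lambda>(g, a). H g a) \<in> ?M" for H
      using w'(3)[OF that] by (simp only: s) (simp only: mult.commute)
  qed
qed

section \<open>Peeling off the last row\<close>

lemma sigma_finite_lborel_PiM: "finite J \<Longrightarrow> sigma_finite_measure (lborel_PiM J)"
  by (rule lborel_prod.sigma_finite)

text \<open>The density weight of the Schur complement of \<open>r\<close> in the symmetric matrix with blocks
  \<open>u\<close>, \<open>a\<close>, \<open>r\<close>.\<close>

definition schur_weight ::
  "real \<Rightarrow> 'm set \<Rightarrow> ('m \<times> 'm \<Rightarrow> real) \<Rightarrow> ('m::{finite,linorder} \<Rightarrow> real) \<Rightarrow> real \<Rightarrow> ennreal" where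
  "schur_weight \<beta> I u a r = pd_det_powr \<beta> (sym_minor I (\<lambda>p. u p - a (fst p) * a (snd p) / r))"

lemma measurable_schur_weight:
  assumes "\<And>p. p \<in> index_pairs I \<Longrightarrow> (\<lambda>x. u x p) \<in> borel_measurable M"
    and "\<And>i. i \<in> I \<Longrightarrow> (\<lambda>x. a x i) \<in> borel_measurable M"
    and "r \<in> borel_measurable M"
  shows "(\<lambda>x. schur_weight \<beta> I (u x) (a x) (r x)) \<in> borel_measurable M"
proof -
  have "(\<lambda>x. \<lambda>p\<in>index_pairs I. u x p - a x (fst p) * a x (snd p) / r x) \<in> M \<rightarrow>\<^sub>M lborel_PiM (index_pairs I)"
    by (intro measurable_lborel_PiM_I borel_measurable_diff borel_measurable_divide borel_measurable_times assms)
       (auto simp: index_pairs_def)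
  from measurable_compose[OF measurable_compose[OF this measurable_sym_minor] measurable_pd_det_powr]
  have "(\<lambda>x. pd_det_powr \<beta> (sym_minor I (\<lambda>p\<in>index_pairs I. u x p - a x (fst p) * a x (snd p) / r x))) \<in> borel_measurable M" .
  moreover have "sym_minor I (\<lambda>p\<in>index_pairs I. u x p - a x (fst p) * a x (snd p) / r x) =
      sym_minor I (\<lambda>p. u x p - a x (fst p) * a x (snd p) / r x)" for x
    by (rule sym_minor_cong) simp
  ultimately show ?thesis by (simp add: schur_weight_def)
qed

text \<open>Here the last row is frozen as \<open>w\<close>. After the rotation, column
  \<open>c0\<close> of the other rows is a vector b, and the remaining columns fall under
  \<open>IH\<close>. Adding b b^T to their Gram matrix only translates Lebesgue measure; passing to
  a = t b turns b b^T into a a^T / r and costs the Jacobian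
  \<open>r powr (- real (card I) / 2)\<close>.\<close>

lemma nn_integral_gram_coords_row:
  fixes I :: "'m::{finite,linorder} set" and N :: "'c set"
  assumes fin: "finite N" and c0: "c0 \<in> N"
    and IH: "\<And>F. F \<in> borel_measurable (lborel_PiM (index_pairs I)) \<Longrightarrow>
      (\<integral>\<^sup>+z. F (gram_coords (N - {c0}) I z) \<partial>lborel_PiM (I \<times> (N - {c0}))) =
      C * (\<integral>\<^sup>+u. F u * pd_det_powr \<beta> (sym_minor I u) \<partial>lborel_PiM (index_pairs I))"
    and H: "(\<lambda>(u, a). H u a) \<in> borel_measurable (lborel_PiM (index_pairs I) \<Otimes>\<^sub>M lborel_PiM I)"
    and r: "r = (\<Sum>c\<in>N. (w c)\<^sup>2)" "r > 0"
  shows "(\<integral>\<^sup>+z. H (gram_coords N I z) (\<lambda>i\<in>I. \<Sum>c\<in>N. z (i, c) * w c) \<partial>lborel_PiM (I \<times> N)) =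
    C * (ennreal (r powr (- real (card I) / 2)) *
      (\<integral>\<^sup>+a. \<integral>\<^sup>+u. H u a * schur_weight \<beta> I u a r \<partial>lborel_PiM (index_pairs I) \<partial>lborel_PiM I))"
proof -
  have finI: "finite I" by simp
  let ?N' = "N - {c0}" and ?P = "lborel_PiM (index_pairs I)"
  obtain t where t: "t\<^sup>2 = (\<Sum>c\<in>N. (w c)\<^sup>2)"
    and "\<forall>H. (\<lambda>(g, a). H g a) \<in> borel_measurable (?P \<Otimes>\<^sub>M lborel_PiM I) \<longrightarrow>
      (\<integral>\<^sup>+z. H (gram_coords N I z) (\<lambda>i\<in>I. \<Sum>c\<in>N. z (i, c) * w c) \<partial>lborel_PiM (I \<times> N)) =
      (\<integral>\<^sup>+z. H (gram_coords N I z) (\<lambda>i\<in>I. t * z (i, c0)) \<partial>lborel_PiM (I \<times> N))"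
    using nn_integral_rotate_to_axis[OF finI fin c0, of w] by (elim exE conjE)
  note rot = this(2)[rule_format]
  have t2: "t\<^sup>2 = r" and t0: "t \<noteq> 0" using t r by auto
  have tt: "t * t = r" using t2 by (simp add: power2_eq_square)
  define f where "f z = H (gram_coords N I z) (\<lambda>i\<in>I. t * z (i, c0))" for z
  have "(\<lambda>z. (gram_coords N I z, \<lambda>i\<in>I. t * z (i, c0))) \<in> lborel_PiM (I \<times> N) \<rightarrow>\<^sub>M ?P \<Otimes>\<^sub>M lborel_PiM I"
    using c0 by (intro measurable_Pair measurable_gram_coords measurable_lborel_PiM_I
        borel_measurable_times borel_measurable_const measurable_lborel_PiM_component) auto
  from measurable_compose[OF this H] have f: "f \<in> borel_measurable (lborel_PiM (I \<times> N))"
    unfolding f_def by simp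
  define P where "P a = (\<integral>\<^sup>+u. H u a * schur_weight \<beta> I u a r \<partial>?P)" for a
  have mHs: "(\<lambda>(a, u). H u a * schur_weight \<beta> I u a r) \<in> borel_measurable (lborel_PiM I \<Otimes>\<^sub>M ?P)"
  proof -
    have "(\<lambda>(a, u). H u a) \<in> borel_measurable (lborel_PiM I \<Otimes>\<^sub>M ?P)"
      using measurable_compose[OF measurable_pair_swap' H] by (simp add: case_prod_beta)
    moreover have "(\<lambda>x. schur_weight \<beta> I (snd x) (fst x) r) \<in> borel_measurable (lborel_PiM I \<Otimes>\<^sub>M ?P)"
      by (intro measurable_schur_weight borel_measurable_const
          measurable_compose[OF measurable_snd measurable_lborel_PiM_component]
          measurable_compose[OF measurable_fst measurable_lborel_PiM_component])
    ultimately show ?thesis by (simp add: case_prod_beta)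
  qed
  have P: "P \<in> borel_measurable (lborel_PiM I)"
    unfolding P_def
    by (rule sigma_finite_measure.borel_measurable_nn_integral[OF sigma_finite_lborel_PiM mHs]) simp
  have mPt: "(\<lambda>x. P (\<lambda>i\<in>I. t * x i)) \<in> borel_measurable (lborel_PiM I)"
    by (rule measurable_compose[OF _ P])
       (intro measurable_lborel_PiM_I borel_measurable_times borel_measurable_const measurable_lborel_PiM_component)
  have U: "(I \<times> {c0}) \<union> (I \<times> ?N') = I \<times> N" using c0 by auto
  have dis: "(I \<times> {c0}) \<inter> (I \<times> ?N') = {}" by auto
  have inner: "(\<integral>\<^sup>+z. f (merge (I \<times> {c0}) (I \<times> ?N') (b, z)) \<partial>lborel_PiM (I \<times> ?N')) =
      C * P (\<lambda>i\<in>I. t * b (i, c0))" if "b \<in> space (lborel_PiM (I \<times> {c0}))" for b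
  proof -
    define a where "a = (\<lambda>i\<in>I. t * b (i, c0))"
    have a: "a \<in> space (lborel_PiM I)" by (auto simp: a_def space_PiM)
    have Ha: "(\<lambda>u. H u a) \<in> borel_measurable ?P"
      using measurable_compose[OF measurable_Pair2'[OF a] H] by simp
    \<comment> \<open>\<open>F\<close> absorbs the rank-one contribution of the split column, so
      that \<open>IH\<close> sees only the columns in \<open>?N'\<close>.\<close>
    define F where "F u = H (\<lambda>p\<in>index_pairs I. u p + b (fst p, c0) * b (snd p, c0)) a" for u
    have mtr: "(\<lambda>u. \<lambda>p\<in>index_pairs I. u p + b (fst p, c0) * b (snd p, c0)) \<in> ?P \<rightarrow>\<^sub>M ?P"
      by (intro measurable_lborel_PiM_I borel_measurable_add borel_measurable_const measurable_lborel_PiM_component)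
    have F: "F \<in> borel_measurable ?P"
      unfolding F_def using measurable_compose[OF mtr Ha] .
    have mg: "merge (I \<times> {c0}) (I \<times> ?N') (b, z) (i, c0) = b (i, c0)"
      "c \<in> ?N' \<Longrightarrow> merge (I \<times> {c0}) (I \<times> ?N') (b, z) (i, c) = z (i, c)" if "i \<in> I" for i c z
      using that by (auto simp: merge_def)
    have "f (merge (I \<times> {c0}) (I \<times> ?N') (b, z)) = F (gram_coords ?N' I z)" for z
    proof -
      have "gram_coords N I (merge (I \<times> {c0}) (I \<times> ?N') (b, z)) =
          (\<lambda>p\<in>index_pairs I. gram_coords ?N' I z p + b (fst p, c0) * b (snd p, c0))"
      proof
        fix p
        show "gram_coords N I (merge (I \<times> {c0}) (I \<times> ?N') (b, z)) p =
          (\<lambda>p\<in>index_pairs I. gram_coords ?N' I z p + b (fst p, c0) * b (snd p, c0)) p"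
          by (auto simp: gram_coords_def index_pairs_def sum.remove[OF fin c0] mg)
      qed
      moreover have "(\<lambda>i\<in>I. t * merge (I \<times> {c0}) (I \<times> ?N') (b, z) (i, c0)) = a"
        by (auto simp: a_def fun_eq_iff mg)
      ultimately show ?thesis unfolding f_def F_def by simp
    qed
    then have "(\<integral>\<^sup>+z. f (merge (I \<times> {c0}) (I \<times> ?N') (b, z)) \<partial>lborel_PiM (I \<times> ?N')) =
        C * (\<integral>\<^sup>+u. F u * pd_det_powr \<beta> (sym_minor I u) \<partial>?P)"
      using IH[OF F] by simp
    also have "(\<integral>\<^sup>+u. F u * pd_det_powr \<beta> (sym_minor I u) \<partial>?P) = P a"
    proof -
      let ?G = "\<lambda>u. H u a * schur_weight \<beta> I u a r"
      have G: "?G \<in> borel_measurable ?P"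
        by (intro borel_measurable_times_ennreal Ha measurable_schur_weight borel_measurable_const measurable_lborel_PiM_component)
      have "F u * pd_det_powr \<beta> (sym_minor I u) = ?G (\<lambda>p\<in>index_pairs I. u p + b (fst p, c0) * b (snd p, c0))" for u
      proof -
        have "sym_minor I u = sym_minor I (\<lambda>p. (\<lambda>p\<in>index_pairs I. u p + b (fst p, c0) * b (snd p, c0)) p - a (fst p) * a (snd p) / r)"
        proof (rule sym_minor_cong)
          fix p assume p: "p \<in> index_pairs I"
          then have "a (fst p) * a (snd p) = (t * t) * (b (fst p, c0) * b (snd p, c0))"
            by (auto simp: a_def index_pairs_def)
          then show "u p = (\<lambda>p\<in>index_pairs I. u p + b (fst p, c0) * b (snd p, c0)) p - a (fst p) * a (snd p) / r"
            using p r(2) tt by simp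
        qed
        then show ?thesis by (simp add: F_def schur_weight_def)
      qed
      then have "(\<integral>\<^sup>+u. F u * pd_det_powr \<beta> (sym_minor I u) \<partial>?P) =
          (\<integral>\<^sup>+u. ?G (\<lambda>p\<in>index_pairs I. u p + (\<lambda>p. b (fst p, c0) * b (snd p, c0)) p) \<partial>?P)"
        by simp
      also have "\<dots> = P a"
        unfolding P_def by (rule nn_integral_lborel_PiM_translate[OF _ G]) simp
      finally show ?thesis .
    qed
    finally show ?thesis by (simp add: a_def)
  qed
  have "(\<integral>\<^sup>+z. H (gram_coords N I z) (\<lambda>i\<in>I. \<Sum>c\<in>N. z (i, c) * w c) \<partial>lborel_PiM (I \<times> N)) =
      (\<integral>\<^sup>+z. f z \<partial>lborel_PiM ((I \<times> {c0}) \<union> (I \<times> ?N')))"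
    unfolding U f_def by (rule rot[OF H])
  also have "\<dots> = (\<integral>\<^sup>+b. \<integral>\<^sup>+z. f (merge (I \<times> {c0}) (I \<times> ?N') (b, z)) \<partial>lborel_PiM (I \<times> ?N') \<partial>lborel_PiM (I \<times> {c0}))"
    using fin f by (intro lborel_prod.product_nn_integral_fold[OF dis]) (auto simp: U)
  also have "\<dots> = (\<integral>\<^sup>+b. C * P (\<lambda>i\<in>I. t * b (i, c0)) \<partial>lborel_PiM (I \<times> {c0}))"
    by (intro nn_integral_cong inner)
  also have "\<dots> = (\<integral>\<^sup>+x. C * P (\<lambda>i\<in>I. t * x i) \<partial>lborel_PiM I)"
  proof -
    have im: "(\<lambda>i. (i, c0)) ` I = I \<times> {c0}" by auto
    have "(\<lambda>i\<in>I. t * (\<lambda>i\<in>I. b (i, c0)) i) = (\<lambda>i\<in>I. t * b (i, c0))" for b :: "'m \<times> 'c \<Rightarrow> real" by auto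
    then show ?thesis
      using nn_integral_PiM_lborel_reindex[OF finI, of "\<lambda>i. (i, c0)" "\<lambda>x. C * P (\<lambda>i\<in>I. t * x i)"] mPt
      by (simp add: im inj_on_def)
  qed
  also have "\<dots> = C * (\<integral>\<^sup>+x. P (\<lambda>i\<in>I. t * x i + (\<lambda>_. 0) i) \<partial>lborel_PiM I)"
    using mPt by (simp add: nn_integral_cmult)
  also have "(\<integral>\<^sup>+x. P (\<lambda>i\<in>I. t * x i + (\<lambda>_. 0) i) \<partial>lborel_PiM I) =
      ennreal (\<Prod>i\<in>I. 1 / \<bar>t\<bar>) * (\<integral>\<^sup>+a. P a \<partial>lborel_PiM I)"
    by (rule nn_integral_lborel_PiM_affine[OF finI _ P]) (rule t0)
  also have "(\<Prod>i\<in>I. 1 / \<bar>t\<bar>) = r powr (- real (card I) / 2)"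
  proof -
    have "\<bar>t\<bar> = r powr (1/2)" using t2 r(2) by (metis powr_half_sqrt less_imp_le real_sqrt_abs)
    then have "(\<Prod>i\<in>I. 1 / \<bar>t\<bar>) = (r powr (- (1/2))) ^ card I"
      by (simp add: powr_minus inverse_eq_divide)
    also have "\<dots> = r powr (- real (card I) / 2)"
      using r(2) by (simp add: powr_power)
    finally show ?thesis .
  qed
  finally show ?thesis by (simp only: P_def)
qed

text \<open>Factor \<open>i\<close> is the constant in the law of a squared length in dimension
  \<open>n - i\<close>: each row that is peeled off uses up one column.\<close>

definition gram_const :: "nat \<Rightarrow> nat \<Rightarrow> real" where
  "gram_const p n = (\<Prod>i<p. pi powr (real (n - i) / 2) / Gamma (real (n - i) / 2))"

lemma gram_const_Suc:
  "gram_const (Suc p) n = pi powr (real n / 2) / Gamma (real n / 2) * gram_const p (n - 1)"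
  by (simp add: gram_const_def prod.lessThan_Suc_shift del: prod.lessThan_Suc)

lemma gram_const_pos: "p \<le> n \<Longrightarrow> gram_const p n > 0"
  unfolding gram_const_def by (intro prod_pos divide_pos_pos Gamma_real_pos) auto

text \<open>Coordinates of the symmetric matrix with block \<open>u\<close>, border \<open>a\<close>
  and corner \<open>r\<close>. When \<open>k\<close> lies above all of \<open>I\<close>, a new pair
  is \<open>(k, k)\<close> or \<open>(i, k)\<close>, so \<open>fst p\<close> decides between corner
  and border.\<close>

definition join_coords :: "'m \<Rightarrow> 'm set \<Rightarrow> ('m \<times> 'm \<Rightarrow> real) \<Rightarrow> ('m::linorder \<Rightarrow> real) \<Rightarrow> real \<Rightarrow> 'm \<times> 'm \<Rightarrow> real" where
  "join_coords k I u a r = (\<lambda>p\<in>index_pairs (insert k I).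
     if p \<in> index_pairs I then u p else if fst p = k then r else a (fst p))"

lemma measurable_join_coords:
  assumes "\<And>p. p \<in> index_pairs I \<Longrightarrow> (\<lambda>x. u x p) \<in> borel_measurable M"
    and "\<And>i. i \<in> I \<Longrightarrow> (\<lambda>x. a x i) \<in> borel_measurable M"
    and "r \<in> borel_measurable M"
  shows "(\<lambda>x. join_coords k I (u x) (a x) (r x)) \<in> M \<rightarrow>\<^sub>M lborel_PiM (index_pairs (insert k I))"
  unfolding join_coords_def
proof (intro measurable_lborel_PiM_I)
  fix p assume p: "p \<in> index_pairs (insert k I)"
  have fp: "fst p \<in> insert k I" using p by (auto simp: index_pairs_def)
  show "(\<lambda>x. if p \<in> index_pairs I then u x p else if fst p = k then r x else a x (fst p)) \<in> borel_measurable M"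
    using assms fp by (cases "p \<in> index_pairs I"; cases "fst p = k") simp_all
qed

lemma pd_det_powr_join_coords:
  assumes k: "\<And>i. i \<in> I \<Longrightarrow> i < k"
  shows "pd_det_powr \<beta> (sym_minor (insert k I) (join_coords k I u a r)) =
    (if r > 0 then ennreal (r powr \<beta>) * schur_weight \<beta> I u a r else 0)"
proof -
  have kI: "k \<notin> I" using k by blast
  have kk: "sym_minor (insert k I) (join_coords k I u a r) $ k $ k = r"
    using kI by (simp add: sym_minor_def join_coords_def)
  have "schur_complement k (sym_minor (insert k I) (join_coords k I u a r)) =
      sym_minor I (\<lambda>p. u p - a (fst p) * a (snd p) / r)"
    by (rule schur_complement_sym_minor) (use k kI in \<open>auto simp: join_coords_def less_imp_le\<close>)
  then show ?thesis
    by (simp add: pd_det_powr_schur[OF transpose_sym_minor, where k=k] kk schur_weight_def)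
qed

text \<open>For a frozen row \<open>k\<close> the integral over the other rows depends on that row
  only through its squared length. Both sides thus become the same integral over corner, border and
  block: the left one by the law of the squared length, the right one by factoring the weight at the
  pivot \<open>k\<close>.\<close>

lemma nn_integral_gram_coords_insert:
  fixes I :: "'m::{finite,linorder} set" and N :: "'c set"
  assumes k: "\<And>i. i \<in> I \<Longrightarrow> i < k" and fin: "finite N" and c0: "c0 \<in> N"
    and IH: "\<And>F. F \<in> borel_measurable (lborel_PiM (index_pairs I)) \<Longrightarrow>
      (\<integral>\<^sup>+z. F (gram_coords (N - {c0}) I z) \<partial>lborel_PiM (I \<times> (N - {c0}))) =
      ennreal C * (\<integral>\<^sup>+u. F u * pd_det_powr \<beta> (sym_minor I u) \<partial>lborel_PiM (index_pairs I))"
    and \<beta>: "\<beta> = (real (card N) - real (card I) - 2) / 2" and C: "C \<ge> 0"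
    and F: "F \<in> borel_measurable (lborel_PiM (index_pairs (insert k I)))"
  shows "(\<integral>\<^sup>+z. F (gram_coords N (insert k I) z) \<partial>lborel_PiM (insert k I \<times> N)) =
    ennreal (pi powr (real (card N) / 2) / Gamma (real (card N) / 2) * C) *
    (\<integral>\<^sup>+u. F u * pd_det_powr \<beta> (sym_minor (insert k I) u) \<partial>lborel_PiM (index_pairs (insert k I)))"
proof -
  have finI: "finite I" by simp
  have kI: "k \<notin> I" using k by blast
  let ?P = "lborel_PiM (index_pairs I)" and ?n = "real (card N)"
  define A where "A r = (\<integral>\<^sup>+a. \<integral>\<^sup>+u. F (join_coords k I u a r) * schur_weight \<beta> I u a r \<partial>?P \<partial>lborel_PiM I)" for r
  define \<Psi> where "\<Psi> r = ennreal C * (ennreal (r powr (- real (card I) / 2)) * A r)" for r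
  have A: "A \<in> borel_measurable borel"
  proof -
    have "(\<lambda>x. F (join_coords k I (snd x) (snd (fst x)) (fst (fst x))) *
        schur_weight \<beta> I (snd x) (snd (fst x)) (fst (fst x))) \<in> borel_measurable ((borel \<Otimes>\<^sub>M lborel_PiM I) \<Otimes>\<^sub>M ?P)"
      by (intro borel_measurable_times_ennreal measurable_compose[OF measurable_join_coords F] measurable_schur_weight
          measurable_compose[OF measurable_snd measurable_lborel_PiM_component]
          measurable_compose[OF measurable_fst measurable_compose[OF measurable_snd measurable_lborel_PiM_component]]
          measurable_compose[OF measurable_fst measurable_fst])
    then have "(\<lambda>x. \<integral>\<^sup>+u. F (join_coords k I u (snd x) (fst x)) * schur_weight \<beta> I u (snd x) (fst x) \<partial>?P)
        \<in> borel_measurable (borel \<Otimes>\<^sub>M lborel_PiM I)"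
      by (intro sigma_finite_measure.borel_measurable_nn_integral[OF sigma_finite_lborel_PiM])
         (simp_all add: case_prod_beta)
    then show ?thesis
      unfolding A_def
      by (intro sigma_finite_measure.borel_measurable_nn_integral[OF sigma_finite_lborel_PiM[OF finI]])
         (simp add: case_prod_beta)
  qed
  then have \<Psi>: "\<Psi> \<in> borel_measurable borel" unfolding \<Psi>_def by measurable
  have ne: "{k} \<times> N \<noteq> {}" and fkN: "finite ({k} \<times> N)" using c0 fin by auto
  have cardkN: "card ({k} \<times> N) = card N" by (simp add: card_cartesian_product)
  define q where "q v = (\<Sum>x\<in>{k} \<times> N. (v x)\<^sup>2)" for v :: "'m \<times> 'c \<Rightarrow> real"
  have q: "q v = (\<Sum>c\<in>N. (v (k, c))\<^sup>2)" for v
    unfolding q_def by (simp add: sum.cartesian_product' sum.Sigma[symmetric] fin)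
  have mq[measurable]: "q \<in> borel_measurable (lborel_PiM ({k} \<times> N))"
    unfolding q_def by measurable
  \<comment> \<open>A zero row makes the pivot 0, where the preceding result does not apply; such
    rows form a null set.\<close>
  have AEq: "AE v in lborel_PiM ({k} \<times> N). q v \<noteq> 0"
  proof -
    have "(\<integral>\<^sup>+v. indicator {0} (q v) \<partial>lborel_PiM ({k} \<times> N)) = 0"
      unfolding q_def by (subst nn_integral_lborel_PiM_sum_squares[OF fkN ne])
        (auto simp: indicator_def intro!: nn_integral_zero' AE_I2)
    then have "AE v in lborel_PiM ({k} \<times> N). indicator {0} (q v) = (0 :: ennreal)"
      by (subst (asm) nn_integral_0_iff_AE) auto
    then show ?thesis by eventually_elim (auto simp: indicator_def split: if_splits)
  qed
  have U: "({k} \<times> N) \<union> (I \<times> N) = insert k I \<times> N" by auto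
  have dis: "({k} \<times> N) \<inter> (I \<times> N) = {}" using kI by auto
  have mg: "merge ({k} \<times> N) (I \<times> N) (v, z) (k, c) = v (k, c)"
    "i \<in> I \<Longrightarrow> merge ({k} \<times> N) (I \<times> N) (v, z) (i, c) = z (i, c)" if "c \<in> N" for v z i c
    using that kI by (auto simp: merge_def)
  have gram: "gram_coords N (insert k I) (merge ({k} \<times> N) (I \<times> N) (v, z)) =
      join_coords k I (gram_coords N I z) (\<lambda>i\<in>I. \<Sum>c\<in>N. z (i, c) * v (k, c)) (q v)" for v z
  proof
    fix p
    have no: "i \<in> I \<Longrightarrow> \<not> k \<le> i" for i using k by (auto simp: not_le)
    show "gram_coords N (insert k I) (merge ({k} \<times> N) (I \<times> N) (v, z)) p =
      join_coords k I (gram_coords N I z) (\<lambda>i\<in>I. \<Sum>c\<in>N. z (i, c) * v (k, c)) (q v) p"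
      using kI no by (auto simp: gram_coords_def join_coords_def index_pairs_def mg q power2_eq_square)
  qed
  have mF: "(\<lambda>z. F (gram_coords N (insert k I) z)) \<in> borel_measurable (lborel_PiM (({k} \<times> N) \<union> (I \<times> N)))"
    unfolding U by (rule measurable_compose[OF measurable_gram_coords F])
  have "(\<integral>\<^sup>+z. F (gram_coords N (insert k I) z) \<partial>lborel_PiM (insert k I \<times> N)) =
      (\<integral>\<^sup>+v. \<integral>\<^sup>+z. F (gram_coords N (insert k I) (merge ({k} \<times> N) (I \<times> N) (v, z)))
        \<partial>lborel_PiM (I \<times> N) \<partial>lborel_PiM ({k} \<times> N))"
    using lborel_prod.product_nn_integral_fold[OF dis fkN _ mF] fin unfolding U by simp
  also have "\<dots> = (\<integral>\<^sup>+v. \<Psi> (q v) \<partial>lborel_PiM ({k} \<times> N))"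
  proof (rule nn_integral_cong_AE, use AEq in eventually_elim)
    fix v assume "q v \<noteq> 0"
    then have pos: "q v > 0" unfolding q_def by (simp add: order_less_le sum_nonneg)
    have "(\<lambda>x. F (join_coords k I (fst x) (snd x) (q v))) \<in> borel_measurable (?P \<Otimes>\<^sub>M lborel_PiM I)"
      by (intro measurable_compose[OF measurable_join_coords F] borel_measurable_const
          measurable_compose[OF measurable_snd measurable_lborel_PiM_component]
          measurable_compose[OF measurable_fst measurable_lborel_PiM_component])
    then have H: "(\<lambda>(u, a). F (join_coords k I u a (q v))) \<in> borel_measurable (?P \<Otimes>\<^sub>M lborel_PiM I)"
      by (simp add: case_prod_beta)
    show "(\<integral>\<^sup>+z. F (gram_coords N (insert k I) (merge ({k} \<times> N) (I \<times> N) (v, z))) \<partial>lborel_PiM (I \<times> N)) = \<Psi> (q v)"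
      unfolding gram \<Psi>_def A_def
      by (rule nn_integral_gram_coords_row[OF fin c0 IH H _ pos]) (simp_all add: q)
  qed
  also have "\<dots> = (\<integral>\<^sup>+r. ennreal (if 0 < r then pi powr (?n / 2) / Gamma (?n / 2) * r powr (?n / 2 - 1) else 0) * \<Psi> r \<partial>lborel)"
    using nn_integral_lborel_PiM_sum_squares[OF fkN ne \<Psi>] by (simp only: q_def cardkN)
  also have "\<dots> = (\<integral>\<^sup>+r. ennreal (pi powr (?n / 2) / Gamma (?n / 2) * C) *
      ((if 0 < r then ennreal (r powr \<beta>) else 0) * A r) \<partial>lborel)"
  proof (rule nn_integral_cong)
    fix r :: real
    show "ennreal (if 0 < r then pi powr (?n / 2) / Gamma (?n / 2) * r powr (?n / 2 - 1) else 0) * \<Psi> r =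
      ennreal (pi powr (?n / 2) / Gamma (?n / 2) * C) * ((if 0 < r then ennreal (r powr \<beta>) else 0) * A r)"
    proof (cases "0 < r")
      case True
      have "card N > 0" using fin c0 card_gt_0_iff by blast
      then have G: "Gamma (?n / 2) > 0" by (intro Gamma_real_pos) simp
      have "r powr \<beta> = r powr (?n / 2 - 1) * r powr (- real (card I) / 2)"
      proof -
        have "\<beta> = (?n / 2 - 1) + (- real (card I) / 2)" unfolding \<beta> by (simp add: field_simps)
        then show ?thesis by (simp only: powr_add)
      qed
      moreover have "ennreal (K * x) * (ennreal C * (ennreal y * A r)) = ennreal (K * C) * (ennreal (x * y) * A r)"
        if "K \<ge> 0" "x \<ge> 0" "y \<ge> 0" for K x y
        using that C by (simp add: ennreal_mult mult_ac)
      moreover have "pi powr (?n / 2) / Gamma (?n / 2) \<ge> 0" using G by simp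
      ultimately show ?thesis
        using True unfolding \<Psi>_def by (simp only: if_True powr_ge_zero)
    qed simp
  qed
  also have "\<dots> = ennreal (pi powr (?n / 2) / Gamma (?n / 2) * C) *
      (\<integral>\<^sup>+r. (if 0 < r then ennreal (r powr \<beta>) else 0) * A r \<partial>lborel)"
    using A by (intro nn_integral_cmult) measurable
  also have "(\<integral>\<^sup>+r. (if 0 < r then ennreal (r powr \<beta>) else 0) * A r \<partial>lborel) =
      (\<integral>\<^sup>+u. F u * pd_det_powr \<beta> (sym_minor (insert k I) u) \<partial>lborel_PiM (index_pairs (insert k I)))"
  proof -
    define G where "G x = F x * pd_det_powr \<beta> (sym_minor (insert k I) x)" for x
    have G: "G \<in> borel_measurable (lborel_PiM (index_pairs (insert k I)))"
      unfolding G_def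
      by (intro borel_measurable_times_ennreal F measurable_compose[OF measurable_sym_minor measurable_pd_det_powr])
    let ?E = "(I \<times> {k}) \<union> index_pairs I"
    \<comment> \<open>Corner, border and block of the enlarged symmetric matrix; maximality of
      \<open>k\<close> excludes pairs \<open>(k, i)\<close> with \<open>i\<close> in
      \<open>I\<close>.\<close>
    have E: "index_pairs (insert k I) = insert (k, k) ?E"
      using k less_imp_le by (auto simp: index_pairs_def) (metis leD)+
    have dE: "(I \<times> {k}) \<inter> index_pairs I = {}" and kkE: "(k, k) \<notin> ?E" and fE: "finite ?E"
      using kI by (auto simp: index_pairs_def intro: finite_index_pairs)
    have pdj: "pd_det_powr \<beta> (sym_minor (insert k I) (join_coords k I u a r)) =
        (if r > 0 then ennreal (r powr \<beta>) * schur_weight \<beta> I u a r else 0)" for u a r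
      by (rule pd_det_powr_join_coords) (rule k)
    have mrg: "(merge (I \<times> {k}) (index_pairs I) (b, u))((k, k) := r) = join_coords k I u (\<lambda>i\<in>I. b (i, k)) r"
      if "b \<in> space (lborel_PiM (I \<times> {k}))" for b u r
    proof
      fix p
      show "((merge (I \<times> {k}) (index_pairs I) (b, u))((k, k) := r)) p = join_coords k I u (\<lambda>i\<in>I. b (i, k)) r p"
        using kI k by (cases p) (auto simp: merge_def join_coords_def less_imp_le dest: leD)
    qed
    have GE: "G \<in> borel_measurable (lborel_PiM (insert (k, k) ?E))" using G unfolding E .
    have mGu: "(\<lambda>x. G (x((k, k) := r))) \<in> borel_measurable (lborel_PiM ?E)" for r
      by (rule measurable_compose[OF _ GE]) (rule measurable_fun_upd[where J="?E"], auto)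
    have "(\<integral>\<^sup>+x. G x \<partial>lborel_PiM (index_pairs (insert k I))) =
        (\<integral>\<^sup>+r. \<integral>\<^sup>+x. G (x((k, k) := r)) \<partial>lborel_PiM ?E \<partial>lborel)"
      unfolding E by (rule lborel_prod.product_nn_integral_insert_rev[OF fE kkE GE])
    also have "\<dots> = (\<integral>\<^sup>+r. (if 0 < r then ennreal (r powr \<beta>) else 0) * A r \<partial>lborel)"
    proof (rule nn_integral_cong)
      fix r :: real
      let ?Q = "\<lambda>a. \<integral>\<^sup>+u. G (join_coords k I u a r) \<partial>?P"
      have "(\<lambda>x. G (join_coords k I (snd x) (fst x) r)) \<in> borel_measurable (lborel_PiM I \<Otimes>\<^sub>M ?P)"
        by (intro measurable_compose[OF measurable_join_coords G] borel_measurable_const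
            measurable_compose[OF measurable_snd measurable_lborel_PiM_component]
            measurable_compose[OF measurable_fst measurable_lborel_PiM_component])
      then have Q: "?Q \<in> borel_measurable (lborel_PiM I)"
        by (intro sigma_finite_measure.borel_measurable_nn_integral[OF sigma_finite_lborel_PiM])
           (simp_all add: case_prod_beta)
      have "(\<integral>\<^sup>+x. G (x((k, k) := r)) \<partial>lborel_PiM ?E) =
          (\<integral>\<^sup>+b. \<integral>\<^sup>+u. G ((merge (I \<times> {k}) (index_pairs I) (b, u))((k, k) := r)) \<partial>?P \<partial>lborel_PiM (I \<times> {k}))"
        by (rule lborel_prod.product_nn_integral_fold[OF dE _ _ mGu]) simp_all
      also have "\<dots> = (\<integral>\<^sup>+b. ?Q (\<lambda>i\<in>I. b (i, k)) \<partial>lborel_PiM (I \<times> {k}))"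
        by (intro nn_integral_cong) (simp only: mrg)
      also have "\<dots> = (\<integral>\<^sup>+a. ?Q a \<partial>lborel_PiM I)"
      proof -
        have "(\<lambda>i. (i, k)) ` I = I \<times> {k}" by auto
        then show ?thesis
          using nn_integral_PiM_lborel_reindex[OF finI _ Q, of "\<lambda>i. (i, k)"] by (simp add: inj_on_def)
      qed
      also have "\<dots> = (\<integral>\<^sup>+a. \<integral>\<^sup>+u. (if 0 < r then ennreal (r powr \<beta>) else 0) *
          (F (join_coords k I u a r) * schur_weight \<beta> I u a r) \<partial>?P \<partial>lborel_PiM I)"
        unfolding G_def pdj by (intro nn_integral_cong) (simp add: mult_ac)
      also have "\<dots> = (if 0 < r then ennreal (r powr \<beta>) else 0) * A r"
      proof -
        have "(\<lambda>x. F (join_coords k I (snd x) (fst x) r) * schur_weight \<beta> I (snd x) (fst x) r)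
            \<in> borel_measurable (lborel_PiM I \<Otimes>\<^sub>M ?P)"
          by (intro borel_measurable_times_ennreal measurable_compose[OF measurable_join_coords F] measurable_schur_weight
              borel_measurable_const measurable_compose[OF measurable_snd measurable_lborel_PiM_component]
              measurable_compose[OF measurable_fst measurable_lborel_PiM_component])
        then have m2: "(\<lambda>a. \<integral>\<^sup>+u. F (join_coords k I u a r) * schur_weight \<beta> I u a r \<partial>?P) \<in> borel_measurable (lborel_PiM I)"
          by (intro sigma_finite_measure.borel_measurable_nn_integral[OF sigma_finite_lborel_PiM])
             (simp_all add: case_prod_beta)
        have m1: "(\<lambda>u. F (join_coords k I u a r) * schur_weight \<beta> I u a r) \<in> borel_measurable ?P" for a
          by (intro borel_measurable_times_ennreal measurable_compose[OF measurable_join_coords F] measurable_schur_weight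
              borel_measurable_const measurable_lborel_PiM_component)
        show ?thesis unfolding A_def by (simp only: nn_integral_cmult[OF m1] nn_integral_cmult[OF m2])
      qed
      finally show "(\<integral>\<^sup>+x. G (x((k, k) := r)) \<partial>lborel_PiM ?E) = (if 0 < r then ennreal (r powr \<beta>) else 0) * A r" .
    qed
    finally show ?thesis by (simp only: G_def)
  qed
  finally show ?thesis .
qed

text \<open>Adding the indices in increasing order makes each new row the last one. A step removes
  one row and one column, so \<open>N\<close> has to vary in the induction, while the difference of
  the cardinalities, and with it the exponent, stays the same.\<close>

proposition nn_integral_gram_coords:
  fixes I :: "'m::{finite,linorder} set" and N :: "'c set"
  assumes "finite N" "card I \<le> card N"
    and "F \<in> borel_measurable (lborel_PiM (index_pairs I))"
  shows "(\<integral>\<^sup>+z. F (gram_coords N I z) \<partial>lborel_PiM (I \<times> N)) =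
    ennreal (gram_const (card I) (card N)) *
    (\<integral>\<^sup>+u. F u * pd_det_powr ((real (card N) - real (card I) - 1) / 2) (sym_minor I u) \<partial>lborel_PiM (index_pairs I))"
  using finite[of I] assms
proof (induction I arbitrary: N F rule: finite_linorder_max_induct)
  case empty
  have "sym_minor {} u = (mat 1 :: ((real, 'm) vec, 'm) vec)" for u
    by (simp add: sym_minor_def mat_def vec_eq_iff)
  moreover have "pd_matrix (mat 1 :: ((real, 'm) vec, 'm) vec)" by (simp add: pd_matrix_def)
  ultimately have "pd_det_powr \<alpha> (sym_minor {} u :: ((real, 'm) vec, 'm) vec) = 1" for \<alpha> u
    by (simp add: pd_det_powr_def)
  moreover have "index_pairs ({} :: 'm set) = {}" by (simp add: index_pairs_def)
  ultimately show ?case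
    by (simp add: gram_const_def gram_coords_def PiM_empty nn_integral_count_space_finite)
next
  case (insert k I)
  have kI: "k \<notin> I" using insert.hyps by blast
  have cI: "card (insert k I) = Suc (card I)" using kI by simp
  then have "N \<noteq> {}" using insert.prems by auto
  then obtain c0 where c0: "c0 \<in> N" by blast
  have cN: "card (N - {c0}) = card N - 1" "card N \<ge> 1" using c0 insert.prems cI by auto
  define \<beta> where "\<beta> = (real (card N) - real (card I) - 2) / 2"
  have ex: "(real (card (N - {c0})) - real (card I) - 1) / 2 = \<beta>"
    "(real (card N) - real (card (insert k I)) - 1) / 2 = \<beta>"
    using cN kI by (auto simp: \<beta>_def cI of_nat_diff)
  have le: "card I \<le> card (N - {c0})" using insert.prems cN by (simp add: cI)
  have IH: "(\<integral>\<^sup>+z. F (gram_coords (N - {c0}) I z) \<partial>lborel_PiM (I \<times> (N - {c0}))) =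
      ennreal (gram_const (card I) (card N - 1)) * (\<integral>\<^sup>+u. F u * pd_det_powr \<beta> (sym_minor I u) \<partial>lborel_PiM (index_pairs I))"
    if "F \<in> borel_measurable (lborel_PiM (index_pairs I))" for F
    by (rule insert.IH[OF finite_Diff[OF insert.prems(1)] le that, unfolded ex(1), unfolded cN(1)])
  have gc: "gram_const (card I) (card N - 1) \<ge> 0" using gram_const_pos[OF le] cN by simp
  show ?case
    unfolding ex(2) unfolding cI gram_const_Suc
    by (rule nn_integral_gram_coords_insert[OF _ insert.prems(1) c0 IH \<beta>_def gc insert.prems(3)])
       (use insert.hyps in auto)
qed

section \<open>The Wishart density\<close>

lemma borel_measurable_vec_nth:
  "f \<in> borel_measurable M \<Longrightarrow> (\<lambda>x. (f x :: real ^ 'm) $ i) \<in> borel_measurable M"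
  by (rule measurable_compose[of f M borel "\<lambda>v. v $ i"])
     (auto intro!: borel_measurable_continuous_onI continuous_intros)

lemma borel_measurable_matrix_nth:
  "f \<in> borel_measurable M \<Longrightarrow> (\<lambda>x. (f x :: real ^ 'n ^ 'm) $ i $ j) \<in> borel_measurable M"
  by (rule measurable_compose[of f M borel "\<lambda>v. v $ i $ j"])
     (auto intro!: borel_measurable_continuous_onI continuous_intros)

lemma borel_measurable_vecI:
  "(\<And>i. (\<lambda>x. (f x :: real ^ 'm) $ i) \<in> borel_measurable M) \<Longrightarrow> f \<in> borel_measurable M"
  by (subst borel_measurable_euclidean_space) (auto simp: Basis_vec_def inner_axis)

lemma borel_measurable_matrixI:
  "(\<And>i j. (\<lambda>x. (f x :: real ^ 'n ^ 'm) $ i $ j) \<in> borel_measurable M) \<Longrightarrow> f \<in> borel_measurable M"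
  by (subst borel_measurable_euclidean_space) (auto simp: Basis_vec_def inner_axis)

lemma borel_measurable_matrix_mult [measurable (raw)]:
  fixes f :: "'a \<Rightarrow> real ^ 'n ^ 'm" and g :: "'a \<Rightarrow> real ^ 'k ^ 'n"
  assumes "f \<in> borel_measurable M" "g \<in> borel_measurable M"
  shows "(\<lambda>x. f x ** g x) \<in> borel_measurable M"
  using assms
  by (intro borel_measurable_matrixI)
     (auto simp: matrix_matrix_mult_def intro!: borel_measurable_sum borel_measurable_times borel_measurable_matrix_nth)

section \<open>Samples of vectors and their scatter matrices\<close>

definition scatter :: "'c set \<Rightarrow> ('c \<Rightarrow> real ^ 'm) \<Rightarrow> real ^ 'm ^ 'm" where
  "scatter N z = (\<Sum>k\<in>N. (\<chi> i j. z k $ i * z k $ j))"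

lemma measurable_PiM_lborel_component:
  "k \<in> N \<Longrightarrow> (\<lambda>z. z k) \<in> borel_measurable (PiM N (\<lambda>_. lborel :: 'a::euclidean_space measure))"
  using measurable_component_singleton[of k N "\<lambda>_. lborel :: 'a measure"] by simp

lemma measurable_scatter [measurable]:
  "scatter N \<in> borel_measurable (PiM N (\<lambda>_. lborel :: (real ^ 'm) measure))"
  unfolding scatter_def
  by (intro borel_measurable_sum borel_measurable_matrixI)
     (auto intro!: borel_measurable_times borel_measurable_vec_nth measurable_PiM_lborel_component)

text \<open>The inner product of matrices is entrywise, that is, the trace of B^T X. Through it a
  product of centred Gaussian densities depends on the sample only by way of the scatter
  matrix.\<close>

lemma inner_scatter:
  fixes B :: "real ^ 'm ^ 'm"
  shows "B \<bullet> scatter N z = (\<Sum>k\<in>N. z k \<bullet> (B *v z k))"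
proof -
  have "B \<bullet> (\<chi> i j. x $ i * x $ j) = x \<bullet> (B *v x)" for x
    by (simp add: inner_vec_def matrix_vector_mult_def sum_distrib_left mult_ac)
  then show ?thesis by (simp add: scatter_def inner_sum_right)
qed

lemma scatter_matrix_vector_mult:
  fixes A :: "real ^ 'm ^ 'm"
  shows "scatter N (\<lambda>k\<in>N. A *v z k) = A ** scatter N z ** transpose A"
proof -
  have "(scatter N (\<lambda>k\<in>N. A *v z k)) $ i $ j = (A ** scatter N z ** transpose A) $ i $ j" for i j
  proof -
    have "(A ** scatter N z ** transpose A) $ i $ j =
        (\<Sum>b\<in>UNIV. \<Sum>a\<in>UNIV. \<Sum>k\<in>N. A $ i $ a * (z k $ a * z k $ b) * A $ j $ b)"
      by (simp add: scatter_def matrix_matrix_mult_def transpose_def sum_distrib_left sum_distrib_right)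
    also have "\<dots> = (\<Sum>b\<in>UNIV. \<Sum>k\<in>N. \<Sum>a\<in>UNIV. A $ i $ a * (z k $ a * z k $ b) * A $ j $ b)"
      by (intro sum.cong refl sum.swap)
    also have "\<dots> = (\<Sum>k\<in>N. \<Sum>b\<in>UNIV. \<Sum>a\<in>UNIV. A $ i $ a * (z k $ a * z k $ b) * A $ j $ b)"
      by (rule sum.swap)
    also have "\<dots> = (\<Sum>k\<in>N. (A *v z k) $ i * (A *v z k) $ j)"
      by (intro sum.cong refl, subst sum.swap) (simp add: matrix_vector_mult_def sum_product mult_ac)
    finally show ?thesis by (simp add: scatter_def)
  qed
  then show ?thesis by (simp add: vec_eq_iff)
qed

text \<open>Flattens a sample of vectors to the doubly indexed array of reals for which the law of
  the Gram matrix is known.\<close>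

lemma nn_integral_PiM_lborel_vec:
  fixes Q :: "('c \<Rightarrow> real ^ 'm) \<Rightarrow> ennreal"
  assumes "finite N" and "Q \<in> borel_measurable (PiM N (\<lambda>_. lborel))"
  shows "(\<integral>\<^sup>+z. Q z \<partial>PiM N (\<lambda>_. lborel)) = (\<integral>\<^sup>+z. Q (\<lambda>c\<in>N. \<chi> i. z (i, c)) \<partial>lborel_PiM (UNIV \<times> N))"
  using assms
proof (induction N arbitrary: Q rule: finite_induct)
  case empty
  then show ?case by (simp add: PiM_empty nn_integral_count_space_finite)
next
  case (insert c N)
  let ?V = "\<lambda>N. PiM N (\<lambda>_. lborel :: (real ^ 'm) measure)" and ?U = "UNIV :: 'm set"
  note [measurable] = insert.prems
  have m1: "(\<lambda>z. \<integral>\<^sup>+x. Q (z(c := x)) \<partial>lborel) \<in> borel_measurable (?V N)"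
    by measurable
  have mz: "(\<lambda>z. \<lambda>d\<in>M. \<chi> i. z (i, d)) \<in> lborel_PiM (?U \<times> M) \<rightarrow>\<^sub>M ?V M" for M :: "'c set"
    by (intro measurable_restrict) (auto intro!: borel_measurable_vecI measurable_lborel_PiM_component)
  have m2: "(\<lambda>x. Q (z(c := x))) \<in> borel_measurable lborel" if "z \<in> space (?V N)" for z
    using measurable_compose[OF measurable_component_update[OF that insert.hyps(2)] insert.prems] .
  have U: "(?U \<times> N) \<union> (?U \<times> {c}) = ?U \<times> insert c N" and dis: "(?U \<times> N) \<inter> (?U \<times> {c}) = {}"
    using insert.hyps by auto
  have "(\<integral>\<^sup>+z. Q z \<partial>?V (insert c N)) = (\<integral>\<^sup>+z. \<integral>\<^sup>+x. Q (z(c := x)) \<partial>lborel \<partial>?V N)"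
    by (rule lborel_prod.product_nn_integral_insert[OF insert.hyps insert.prems])
  also have "\<dots> = (\<integral>\<^sup>+z. \<integral>\<^sup>+x. Q ((\<lambda>d\<in>N. \<chi> i. z (i, d))(c := x)) \<partial>lborel \<partial>lborel_PiM (?U \<times> N))"
    by (rule insert.IH[OF m1])
  also have "\<dots> = (\<integral>\<^sup>+z. \<integral>\<^sup>+y. Q (\<lambda>d\<in>insert c N. \<chi> i. merge (?U \<times> N) (?U \<times> {c}) (z, y) (i, d))
      \<partial>lborel_PiM (?U \<times> {c}) \<partial>lborel_PiM (?U \<times> N))"
  proof (rule nn_integral_cong)
    fix z assume z: "z \<in> space (lborel_PiM (?U \<times> N))"
    let ?z = "\<lambda>d\<in>N. \<chi> i. z (i, d)"
    have mQ: "(\<lambda>x. Q (?z(c := x))) \<in> borel_measurable borel"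
      using m2[of ?z] measurable_space[OF mz z] by simp
    have "(\<integral>\<^sup>+x. Q (?z(c := x)) \<partial>lborel) = (\<integral>\<^sup>+y. Q (?z(c := (\<chi> i. y i))) \<partial>lborel_PiM ?U)"
      by (rule nn_integral_lborel_vec[OF mQ, symmetric])
    also have "\<dots> = (\<integral>\<^sup>+y. Q (?z(c := (\<chi> i. y (i, c)))) \<partial>lborel_PiM (?U \<times> {c}))"
    proof -
      have im: "(\<lambda>i. (i, c)) ` ?U = ?U \<times> {c}" by auto
      have "(\<lambda>y. \<chi> i. y i) \<in> borel_measurable (lborel_PiM ?U)"
        by (auto intro!: borel_measurable_vecI measurable_lborel_PiM_component)
      from measurable_compose[OF this mQ]
      have "(\<lambda>y. Q (?z(c := (\<chi> i. y i)))) \<in> borel_measurable (lborel_PiM ?U)" .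
      from nn_integral_PiM_lborel_reindex[OF _ _ this, of "\<lambda>i. (i, c)"]
      show ?thesis by (simp add: im inj_on_def)
    qed
    also have "\<dots> = (\<integral>\<^sup>+y. Q (\<lambda>d\<in>insert c N. \<chi> i. merge (?U \<times> N) (?U \<times> {c}) (z, y) (i, d)) \<partial>lborel_PiM (?U \<times> {c}))"
      using insert.hyps(2) by (intro nn_integral_cong arg_cong[where f=Q]) (auto simp: fun_eq_iff merge_def)
    finally show "(\<integral>\<^sup>+x. Q (?z(c := x)) \<partial>lborel) =
      (\<integral>\<^sup>+y. Q (\<lambda>d\<in>insert c N. \<chi> i. merge (?U \<times> N) (?U \<times> {c}) (z, y) (i, d)) \<partial>lborel_PiM (?U \<times> {c}))" .
  qed
  also have "\<dots> = (\<integral>\<^sup>+z. Q (\<lambda>d\<in>insert c N. \<chi> i. z (i, d)) \<partial>lborel_PiM (?U \<times> insert c N))"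
  proof -
    have "(\<lambda>z. Q (\<lambda>d\<in>insert c N. \<chi> i. z (i, d))) \<in> borel_measurable (lborel_PiM ((?U \<times> N) \<union> (?U \<times> {c})))"
      unfolding U by (rule measurable_compose[OF mz insert.prems])
    from lborel_prod.product_nn_integral_fold[OF dis _ _ this] insert.hyps(1)
    show ?thesis unfolding U by simp
  qed
  finally show ?case .
qed

lemma nn_integral_scatter:
  fixes F :: "real ^ ('m::{finite,linorder}) ^ ('m::{finite,linorder}) \<Rightarrow> ennreal"
  assumes N: "finite N" "CARD('m) \<le> card N" and F: "F \<in> borel_measurable borel"
  shows "(\<integral>\<^sup>+z. F (scatter N z) \<partial>PiM N (\<lambda>_. lborel)) = ennreal (gram_const CARD('m) (card N)) *
    (\<integral>\<^sup>+X. F X * pd_det_powr ((real (card N) - real CARD('m) - 1) / 2) X \<partial>sym_lborel)"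
proof -
  \<comment> \<open>For the full index set nothing is padded, and the coordinates are those of
    \<open>sym_lborel\<close>.\<close>
  have minor: "sym_minor UNIV = (sym_of_upper :: ('m \<times> 'm \<Rightarrow> real) \<Rightarrow> _)"
    by (simp add: fun_eq_iff sym_minor_def sym_of_upper_def)
  have pairs: "index_pairs (UNIV :: 'm set) = {(i, j). i \<le> j}" by (auto simp: index_pairs_def)
  have "scatter N (\<lambda>c\<in>N. \<chi> i. z (i, c)) = sym_minor UNIV (gram_coords N UNIV z)" for z :: "'m \<times> 'a \<Rightarrow> real"
    by (auto simp: vec_eq_iff scatter_def sym_minor_def gram_coords_def index_pairs_def min_def max_def mult.commute)
  then have "(\<integral>\<^sup>+z. F (scatter N z) \<partial>PiM N (\<lambda>_. lborel)) =
      (\<integral>\<^sup>+z. F (sym_minor UNIV (gram_coords N UNIV z)) \<partial>lborel_PiM (UNIV \<times> N))"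
    using nn_integral_PiM_lborel_vec[OF N(1) measurable_compose[OF measurable_scatter F]] by simp
  also have "\<dots> = ennreal (gram_const CARD('m) (card N)) * (\<integral>\<^sup>+u. F (sym_minor UNIV u) *
      pd_det_powr ((real (card N) - real CARD('m) - 1) / 2) (sym_minor UNIV u) \<partial>lborel_PiM (index_pairs UNIV))"
    by (rule nn_integral_gram_coords[OF N measurable_compose[OF measurable_sym_minor F]])
  also have "(\<integral>\<^sup>+u. F (sym_minor UNIV u) * pd_det_powr ((real (card N) - real CARD('m) - 1) / 2) (sym_minor UNIV u)
      \<partial>lborel_PiM (index_pairs UNIV)) =
      (\<integral>\<^sup>+X. F X * pd_det_powr ((real (card N) - real CARD('m) - 1) / 2) X \<partial>sym_lborel)"
    unfolding sym_lborel_def minor pairs using borel_measurable_times_ennreal[OF F measurable_pd_det_powr]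
    by (intro nn_integral_distr[OF measurable_sym_of_upper, symmetric]) simp
  finally show ?thesis .
qed

lemma nn_integral_PiM_density:
  fixes f :: "'a::euclidean_space \<Rightarrow> real"
  assumes "finite N" and [measurable]: "f \<in> borel_measurable borel"
    and "Q \<in> borel_measurable (PiM N (\<lambda>_. lborel))"
  shows "(\<integral>\<^sup>+z. Q z \<partial>PiM N (\<lambda>_. density lborel (\<lambda>x. ennreal (f x)))) =
    (\<integral>\<^sup>+z. Q z * (\<Prod>k\<in>N. ennreal (f (z k))) \<partial>PiM N (\<lambda>_. lborel))"
  using assms(1,3)
proof (induction N arbitrary: Q rule: finite_induct)
  case empty
  then show ?case by (simp add: PiM_empty nn_integral_count_space_finite)
next
  case (insert c N)
  let ?D = "density lborel (\<lambda>x. ennreal (f x))" and ?V = "\<lambda>N. PiM N (\<lambda>_. lborel :: 'a measure)"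
  note [measurable] = insert.prems
  \<comment> \<open>A real-valued density yields a sigma-finite measure whatever its total mass, and
    this is what the product construction asks for.\<close>
  interpret D: product_sigma_finite "\<lambda>_. ?D"
    by (intro product_sigma_finite.intro)
       (simp add: sigma_finite_measure.sigma_finite_iff_density_finite[OF sigma_finite_lborel])
  have sD: "sets (PiM M (\<lambda>_. ?D)) = sets (?V M)" for M :: "'b set"
    by (intro sets_PiM_cong) auto
  have spD: "space (PiM M (\<lambda>_. ?D)) = space (?V M)" for M :: "'b set"
    by (simp add: space_PiM)
  have QD: "Q \<in> borel_measurable (PiM (insert c N) (\<lambda>_. ?D))"
    using insert.prems by (simp cong: measurable_cong_sets add: measurable_cong_sets[OF sD refl])
  have m1: "(\<lambda>z. \<integral>\<^sup>+x. ennreal (f x) * Q (z(c := x)) \<partial>lborel) \<in> borel_measurable (?V N)"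
    by measurable
  have m2: "(\<lambda>x. Q (z(c := x))) \<in> borel_measurable lborel" if "z \<in> space (?V N)" for z
    using measurable_compose[OF measurable_component_update[OF that insert.hyps(2)] insert.prems] .
  have mp: "(\<lambda>z. \<Prod>k\<in>M. ennreal (f (z k))) \<in> borel_measurable (?V M)" for M
    by (intro borel_measurable_prod_ennreal measurable_compose[OF measurable_PiM_lborel_component]) measurable
  have "(\<integral>\<^sup>+z. Q z \<partial>PiM (insert c N) (\<lambda>_. ?D)) = (\<integral>\<^sup>+z. \<integral>\<^sup>+x. Q (z(c := x)) \<partial>?D \<partial>PiM N (\<lambda>_. ?D))"
    by (rule D.product_nn_integral_insert[OF insert.hyps QD])
  also have "\<dots> = (\<integral>\<^sup>+z. \<integral>\<^sup>+x. ennreal (f x) * Q (z(c := x)) \<partial>lborel \<partial>PiM N (\<lambda>_. ?D))"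
    using m2 by (intro nn_integral_cong nn_integral_density) (auto simp: spD)
  also have "\<dots> = (\<integral>\<^sup>+z. (\<integral>\<^sup>+x. ennreal (f x) * Q (z(c := x)) \<partial>lborel) * (\<Prod>k\<in>N. ennreal (f (z k))) \<partial>?V N)"
    by (rule insert.IH[OF m1])
  also have "\<dots> = (\<integral>\<^sup>+z. \<integral>\<^sup>+x. Q (z(c := x)) * (\<Prod>k\<in>insert c N. ennreal (f ((z(c := x)) k))) \<partial>lborel \<partial>?V N)"
  proof (rule nn_integral_cong)
    fix z assume z: "z \<in> space (?V N)"
    have [measurable]: "(\<lambda>x. Q (z(c := x))) \<in> borel_measurable borel" using m2[OF z] by simp
    have p: "(\<Prod>k\<in>N. ennreal (f ((z(c := x)) k))) = (\<Prod>k\<in>N. ennreal (f (z k)))" for x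
      using insert.hyps(2) by (intro prod.cong) auto
    have "(\<integral>\<^sup>+x. ennreal (f x) * Q (z(c := x)) \<partial>lborel) * (\<Prod>k\<in>N. ennreal (f (z k))) =
        (\<integral>\<^sup>+x. ennreal (f x) * Q (z(c := x)) * (\<Prod>k\<in>N. ennreal (f (z k))) \<partial>lborel)"
      by (rule nn_integral_multc[symmetric]) measurable
    also have "\<dots> = (\<integral>\<^sup>+x. Q (z(c := x)) * (\<Prod>k\<in>insert c N. ennreal (f ((z(c := x)) k))) \<partial>lborel)"
      unfolding prod.insert[OF insert.hyps] p by (intro nn_integral_cong) (simp add: mult_ac)
    finally show "(\<integral>\<^sup>+x. ennreal (f x) * Q (z(c := x)) \<partial>lborel) * (\<Prod>k\<in>N. ennreal (f (z k))) =
      (\<integral>\<^sup>+x. Q (z(c := x)) * (\<Prod>k\<in>insert c N. ennreal (f ((z(c := x)) k))) \<partial>lborel)" .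
  qed
  also have "\<dots> = (\<integral>\<^sup>+z. Q z * (\<Prod>k\<in>insert c N. ennreal (f (z k))) \<partial>?V (insert c N))"
    by (rule lborel_prod.product_nn_integral_insert[OF insert.hyps borel_measurable_times_ennreal[OF insert.prems mp], symmetric])
  finally show ?case .
qed

lemma nn_integral_PiM_matrix_vector_mult:
  fixes A :: "real ^ 'm ^ 'm"
  assumes "finite N" and A: "det A \<noteq> 0" and "Q \<in> borel_measurable (PiM N (\<lambda>_. lborel))"
  shows "(\<integral>\<^sup>+z. Q (\<lambda>k\<in>N. A *v z k) \<partial>PiM N (\<lambda>_. lborel)) =
    ennreal ((1 / \<bar>det A\<bar>) ^ card N) * (\<integral>\<^sup>+z. Q z \<partial>PiM N (\<lambda>_. lborel))"
  using assms(1,3)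
proof (induction N arbitrary: Q rule: finite_induct)
  case empty
  then show ?case by (simp add: PiM_empty nn_integral_count_space_finite)
next
  case (insert c N)
  let ?V = "\<lambda>N. PiM N (\<lambda>_. lborel :: (real ^ 'm) measure)"
  note [measurable] = insert.prems
  have mA: "(\<lambda>x. A *v x) \<in> borel_measurable borel"
    by (intro borel_measurable_continuous_onI linear_continuous_on)
       (simp add: linear_conv_bounded_linear[symmetric])
  have m1: "(\<lambda>z. \<integral>\<^sup>+x. Q (z(c := x)) \<partial>lborel) \<in> borel_measurable (?V N)"
    by measurable
  have m2: "(\<lambda>x. Q (z(c := x))) \<in> borel_measurable lborel" if "z \<in> space (?V N)" for z
    using measurable_compose[OF measurable_component_update[OF that insert.hyps(2)] insert.prems] .
  have mz: "(\<lambda>z. \<lambda>k\<in>M. A *v z k) \<in> ?V M \<rightarrow>\<^sub>M ?V M" for M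
    by (intro measurable_restrict) (auto intro!: measurable_compose[OF measurable_PiM_lborel_component mA])
  have mzN: "(\<lambda>k\<in>N. A *v z k) \<in> space (?V N)" for z :: "'a \<Rightarrow> real ^ 'm" by (auto simp: space_PiM)
  have upd: "(\<lambda>k\<in>insert c N. A *v (z(c := x)) k) = (\<lambda>k\<in>N. A *v z k)(c := A *v x)" for z x
    using insert.hyps(2) by (auto simp: fun_eq_iff)
  have "(\<integral>\<^sup>+z. Q (\<lambda>k\<in>insert c N. A *v z k) \<partial>?V (insert c N)) =
      (\<integral>\<^sup>+z. \<integral>\<^sup>+x. Q ((\<lambda>k\<in>N. A *v z k)(c := A *v x)) \<partial>lborel \<partial>?V N)"
    using lborel_prod.product_nn_integral_insert[OF insert.hyps measurable_compose[OF mz insert.prems]]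
    by (simp only: upd)
  also have "\<dots> = (\<integral>\<^sup>+z. ennreal (1 / \<bar>det A\<bar>) * (\<integral>\<^sup>+x. Q ((\<lambda>k\<in>N. A *v z k)(c := x)) \<partial>lborel) \<partial>?V N)"
    using m2[OF mzN] by (intro nn_integral_cong nn_integral_lborel_matrix_vector_mult[OF A, of "\<lambda>x. Q (_(c := x))"]) simp
  also have "\<dots> = ennreal (1 / \<bar>det A\<bar>) * (\<integral>\<^sup>+z. \<integral>\<^sup>+x. Q ((\<lambda>k\<in>N. A *v z k)(c := x)) \<partial>lborel \<partial>?V N)"
    by (rule nn_integral_cmult) (rule measurable_compose[OF mz m1])
  also have "(\<integral>\<^sup>+z. \<integral>\<^sup>+x. Q ((\<lambda>k\<in>N. A *v z k)(c := x)) \<partial>lborel \<partial>?V N) =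
      ennreal ((1 / \<bar>det A\<bar>) ^ card N) * (\<integral>\<^sup>+z. \<integral>\<^sup>+x. Q (z(c := x)) \<partial>lborel \<partial>?V N)"
    by (rule insert.IH[OF m1])
  also have "(\<integral>\<^sup>+z. \<integral>\<^sup>+x. Q (z(c := x)) \<partial>lborel \<partial>?V N) = (\<integral>\<^sup>+z. Q z \<partial>?V (insert c N))"
    by (rule lborel_prod.product_nn_integral_insert[OF insert.hyps insert.prems, symmetric])
  finally show ?case
    using insert.hyps by (simp add: mult.assoc[symmetric] ennreal_mult[symmetric])
qed

text \<open>The exponents (n - i)/2 of pi add up to n m / 2 - m (m - 1) / 4; the difference m (m -
  1) / 4 is the power of pi inside \<open>multivariate_gamma\<close>.\<close>

lemma gram_const_eq:
  assumes "m \<le> n"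
  shows "gram_const m n = pi powr (real n * real m / 2) / multivariate_gamma m (real n / 2)"
proof -
  have e: "(\<Sum>i<m. real (n - i) / 2) = real n * real m / 2 - real (m * (m - 1)) / 4"
    using assms
  proof (induction m)
    case (Suc m)
    have "real (Suc m * (Suc m - 1)) = real (m * (m - 1)) + 2 * real m" by (cases m) auto
    then show ?case using Suc by (simp add: field_simps of_nat_diff)
  qed simp
  have p: "(\<Prod>i<m. pi powr (real (n - i) / 2)) = pi powr (\<Sum>i<m. real (n - i) / 2)"
    by (simp add: powr_sum)
  have g: "(\<Prod>i=1..m. Gamma (real n / 2 - (real i - 1) / 2)) = (\<Prod>i<m. Gamma (real (n - i) / 2))"
  proof -
    have "(\<Prod>i=1..m. Gamma (real n / 2 - (real i - 1) / 2)) = (\<Prod>i<m. Gamma (real n / 2 - (real (Suc i) - 1) / 2))"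
      by (rule prod.reindex_bij_witness[of _ Suc "\<lambda>i. i - 1"]) auto
    also have "\<dots> = (\<Prod>i<m. Gamma (real (n - i) / 2))"
      using assms by (intro prod.cong refl arg_cong[where f=Gamma]) (simp add: of_nat_diff diff_divide_distrib)
    finally show ?thesis .
  qed
  show ?thesis
    unfolding gram_const_def multivariate_gamma_def prod_dividef p e g
    by (simp add: powr_diff)
qed

text \<open>With \<open>C\<close> the root of \<open>B\<close>, the form at \<open>x\<close> is the
  squared norm of \<open>C *v x\<close>; the substitution leaves the standard Gaussian integral and
  the factor 1 / det C.\<close>

lemma nn_integral_gaussian_form:
  fixes B :: "real ^ 'm ^ 'm"
  assumes B: "pd_matrix B"
  shows "(\<integral>\<^sup>+x. ennreal (exp (- (x \<bullet> (B *v x)) / 2)) \<partial>lborel) =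
    ennreal ((2 * pi) powr (real CARD('m) / 2) / sqrt (det B))"
proof -
  define C where "C = matrix_sqrt B"
  have C: "pd_matrix C" "C ** C = B" "transpose C = C"
    using pd_matrix_sqrt[OF B] matrix_sqrt_square[OF B] by (auto simp: C_def pd_matrix_def)
  have dC: "det C > 0" by (rule pd_matrix_det_pos[OF C(1)])
  have "det B = (det C)\<^sup>2" using C(2) by (metis det_mul power2_eq_square)
  then have sq: "sqrt (det B) = det C" using dC by simp
  have "x \<bullet> (B *v x) = (norm (C *v x))\<^sup>2" for x
    using inner_square_symmetric[OF C(3), of x] C(2) by simp
  then have "(\<integral>\<^sup>+x. ennreal (exp (- (x \<bullet> (B *v x)) / 2)) \<partial>lborel) =
      (\<integral>\<^sup>+x. ennreal (exp (- (norm (C *v x))\<^sup>2 / 2)) \<partial>lborel)" by simp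
  also have "\<dots> = ennreal (1 / \<bar>det C\<bar>) * (\<integral>\<^sup>+x. ennreal (exp (- (norm (x :: real ^ 'm))\<^sup>2 / 2)) \<partial>lborel)"
    using dC by (intro nn_integral_lborel_matrix_vector_mult[of C "\<lambda>x. ennreal (exp (- (norm x)\<^sup>2 / 2))"]) auto
  also have "\<dots> = ennreal ((2 * pi) powr (real CARD('m) / 2) / sqrt (det B))"
    unfolding nn_integral_gaussian_vec using dC by (simp add: ennreal_mult[symmetric] sq)
  finally show ?thesis .
qed

lemma nn_integral_exp_inner_scatter:
  fixes B :: "real ^ 'm ^ 'm"
  assumes "pd_matrix B" "finite N"
  shows "(\<integral>\<^sup>+z. ennreal (exp (- (B \<bullet> scatter N z) / 2)) \<partial>PiM N (\<lambda>_. lborel)) =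
    ennreal (((2 * pi) powr (real CARD('m) / 2) / sqrt (det B)) ^ card N)"
proof -
  have "exp (- (B \<bullet> scatter N z) / 2) = (\<Prod>k\<in>N. exp (- (z k \<bullet> (B *v z k)) / 2))" for z
    by (simp add: inner_scatter exp_sum[OF assms(2), symmetric] sum_divide_distrib sum_negf)
  then have "(\<integral>\<^sup>+z. ennreal (exp (- (B \<bullet> scatter N z) / 2)) \<partial>PiM N (\<lambda>_. lborel)) =
      (\<integral>\<^sup>+z. (\<Prod>k\<in>N. ennreal (exp (- (z k \<bullet> (B *v z k)) / 2))) \<partial>PiM N (\<lambda>_. lborel))"
    by (simp add: prod_ennreal)
  also have "\<dots> = (\<Prod>k\<in>N. \<integral>\<^sup>+x. ennreal (exp (- (x \<bullet> (B *v x)) / 2)) \<partial>lborel)"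
  proof (rule lborel_prod.product_nn_integral_prod[OF assms(2)])
    have "(\<lambda>x. x \<bullet> (B *v x)) \<in> borel_measurable borel"
      by (intro borel_measurable_continuous_onI continuous_on_quadratic_form continuous_intros)
    then show "(\<lambda>x. ennreal (exp (- (x \<bullet> (B *v x)) / 2))) \<in> borel_measurable lborel" by simp
  qed
  also have "\<dots> = ennreal (((2 * pi) powr (real CARD('m) / 2) / sqrt (det B)) ^ card N)"
    by (simp only: nn_integral_gaussian_form[OF assms(1)])
       (simp add: ennreal_power pd_matrix_det_pos[OF assms(1)] less_imp_le)
  finally show ?thesis .
qed

section \<open>Wishart integrals on the symmetric matrices\<close>

definition mvnormal_const :: "real ^ 'm ^ 'm \<Rightarrow> real" where
  "mvnormal_const S = (2 * pi) powr (- real CARD('m) / 2) * det S powr (- 1 / 2)"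

lemma mvnormal_const_nonneg: "mvnormal_const S \<ge> 0"
  by (simp add: mvnormal_const_def)

text \<open>A form of the law that keeps the columns as integration variables, for the substitution
  that acts on columns.\<close>

lemma nn_integral_wishart_scatter:
  fixes F :: "real ^ 'm ^ 'm \<Rightarrow> ennreal"
  assumes F: "F \<in> borel_measurable borel"
  shows "(\<integral>\<^sup>+X. F X \<partial>wishart n S) = (\<integral>\<^sup>+z. F (scatter {..<n} z) *
    ennreal (mvnormal_const S ^ n * exp (- (matrix_inv S \<bullet> scatter {..<n} z) / 2)) \<partial>PiM {..<n} (\<lambda>_. lborel))"
proof -
  define f where "f x = mvnormal_const S * exp (- (x \<bullet> (matrix_inv S *v x)) / 2)" for x :: "real ^ 'm"
  have "(\<lambda>x. x \<bullet> (matrix_inv S *v x)) \<in> borel_measurable borel"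
    by (intro borel_measurable_continuous_onI continuous_on_quadratic_form continuous_intros)
  then have f: "f \<in> borel_measurable borel" unfolding f_def by simp
  have mv: "mvnormal S = density lborel (\<lambda>x. ennreal (f x))"
    by (simp add: mvnormal_def f_def[abs_def] mvnormal_const_def)
  have FQ: "(\<lambda>z. F (scatter {..<n} z)) \<in> borel_measurable (PiM {..<n} (\<lambda>_. lborel))"
    by (rule measurable_compose[OF measurable_scatter F])
  have "(\<integral>\<^sup>+X. F X \<partial>wishart n S) = (\<integral>\<^sup>+z. F (scatter {..<n} z) \<partial>PiM {..<n} (\<lambda>_. mvnormal S))"
    unfolding wishart_def scatter_def using F
    by (intro nn_integral_distr[OF measurable_outer_product_sum]) simp
  also have "\<dots> = (\<integral>\<^sup>+z. F (scatter {..<n} z) * (\<Prod>k<n. ennreal (f (z k))) \<partial>PiM {..<n} (\<lambda>_. lborel))"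
    unfolding mv by (rule nn_integral_PiM_density[OF _ f FQ]) simp
  also have "(\<lambda>z. (\<Prod>k<n. ennreal (f (z k)))) =
      (\<lambda>z. ennreal (mvnormal_const S ^ n * exp (- (matrix_inv S \<bullet> scatter {..<n} z) / 2)))"
  proof
    fix z :: "nat \<Rightarrow> real ^ 'm"
    have "(\<Prod>k<n. ennreal (f (z k))) = ennreal (\<Prod>k<n. f (z k))"
      by (rule prod_ennreal) (simp add: f_def mvnormal_const_nonneg)
    also have "(\<Prod>k<n. f (z k)) = mvnormal_const S ^ n * exp (- (matrix_inv S \<bullet> scatter {..<n} z) / 2)"
      unfolding f_def prod.distrib
      by (simp add: inner_scatter exp_sum[symmetric] sum_divide_distrib sum_negf)
    finally show "(\<Prod>k<n. ennreal (f (z k))) =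
      ennreal (mvnormal_const S ^ n * exp (- (matrix_inv S \<bullet> scatter {..<n} z) / 2))" .
  qed
  finally show ?thesis .
qed

abbreviation exp_inner :: "real ^ 'm ^ 'm \<Rightarrow> real ^ 'm ^ 'm \<Rightarrow> ennreal" where
  "exp_inner B X \<equiv> ennreal (exp (- (B \<bullet> X) / 2))"

lemma measurable_exp_inner [measurable (raw)]:
  fixes f g :: "'a \<Rightarrow> real ^ 'm ^ 'm"
  assumes [measurable]: "f \<in> borel_measurable M" "g \<in> borel_measurable M"
  shows "(\<lambda>x. exp_inner (f x) (g x)) \<in> borel_measurable M"
  by measurable

lemma nn_integral_wishart:
  fixes F :: "real ^ ('m::{finite,linorder}) ^ ('m::{finite,linorder}) \<Rightarrow> ennreal"
  assumes n: "CARD('m) \<le> n" and F[measurable]: "F \<in> borel_measurable borel"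
  shows "(\<integral>\<^sup>+X. F X \<partial>wishart n S) = ennreal (mvnormal_const S ^ n * gram_const CARD('m) n) *
    (\<integral>\<^sup>+X. F X * exp_inner (matrix_inv S) X * pd_det_powr ((real n - real CARD('m) - 1) / 2) X \<partial>sym_lborel)"
proof -
  let ?k = "mvnormal_const S ^ n"
  have [measurable_cong]: "sets sym_lborel = sets (borel :: (real ^ ('m::{finite,linorder}) ^ ('m::{finite,linorder})) measure)"
    by (simp add: sym_lborel_def)
  have k: "?k \<ge> 0" by (simp add: mvnormal_const_nonneg)
  have G: "gram_const CARD('m) n \<ge> 0" using gram_const_pos[OF n] by simp
  have "(\<integral>\<^sup>+X. F X \<partial>wishart n S) =
      (\<integral>\<^sup>+z. F (scatter {..<n} z) * ennreal (?k * exp (- (matrix_inv S \<bullet> scatter {..<n} z) / 2)) \<partial>PiM {..<n} (\<lambda>_. lborel))"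
    by (rule nn_integral_wishart_scatter[OF F])
  also have "\<dots> = ennreal (gram_const CARD('m) n) * (\<integral>\<^sup>+X. F X * ennreal (?k * exp (- (matrix_inv S \<bullet> X) / 2)) *
      pd_det_powr ((real n - real CARD('m) - 1) / 2) X \<partial>sym_lborel)"
    using nn_integral_scatter[of "{..<n}" "\<lambda>X. F X * ennreal (?k * exp (- (matrix_inv S \<bullet> X) / 2))"] n by simp
  also have "(\<integral>\<^sup>+X. F X * ennreal (?k * exp (- (matrix_inv S \<bullet> X) / 2)) *
      pd_det_powr ((real n - real CARD('m) - 1) / 2) X \<partial>sym_lborel) =
      (\<integral>\<^sup>+X. ennreal ?k * (F X * exp_inner (matrix_inv S) X * pd_det_powr ((real n - real CARD('m) - 1) / 2) X) \<partial>sym_lborel)"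
    using k by (intro nn_integral_cong) (simp add: ennreal_mult mult_ac)
  also have "\<dots> = ennreal ?k * (\<integral>\<^sup>+X. F X * exp_inner (matrix_inv S) X * pd_det_powr ((real n - real CARD('m) - 1) / 2) X \<partial>sym_lborel)"
    by (rule nn_integral_cmult) measurable
  finally show ?thesis using k G by (simp add: ennreal_mult mult_ac)
qed

text \<open>The facts about A = Y^(-1/2) behind the substitution of A z for a column z: A Y A = I
  says that z and A z have the same exponent under the precisions I and Y, and 1 / |det A| is the
  Jacobian of one column.\<close>

lemma
  assumes Y: "pd_matrix Y"
  defines "A \<equiv> matrix_inv (matrix_sqrt Y)"
  shows transpose_inv_sqrt: "transpose A = A"
    and inv_sqrt_mult: "A ** Y ** A = mat 1"
    and det_inv_sqrt: "1 / \<bar>det A\<bar> = sqrt (det Y)" "det A \<noteq> 0"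
proof -
  define C where "C = matrix_sqrt Y"
  have C: "pd_matrix C" "C ** C = Y" "transpose C = C"
    using pd_matrix_sqrt[OF Y] matrix_sqrt_square[OF Y] by (auto simp: C_def pd_matrix_def)
  have dC: "det C > 0" by (rule pd_matrix_det_pos[OF C(1)])
  have CA: "C ** A = mat 1" and AC: "A ** C = mat 1"
    unfolding A_def C_def[symmetric] using dC by (auto intro!: matrix_inv_left matrix_inv_right)
  \<comment> \<open>The transpose is again an inverse of the symmetric matrix \<open>C\<close>, and
    inverses are unique.\<close>
  have "transpose A ** C = mat 1"
    using arg_cong[OF CA, of transpose] C(3) by (simp add: matrix_transpose_mul)
  then show "transpose A = A"
    by (metis CA matrix_mul_assoc matrix_mul_lid matrix_mul_rid)
  have "A ** Y ** A = (A ** C) ** (C ** A)" by (simp add: C(2)[symmetric] matrix_mul_assoc)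
  then show "A ** Y ** A = mat 1" by (simp add: AC CA)
  have dd: "det A * det C = 1" using AC by (metis det_I det_mul)
  then show "det A \<noteq> 0" by auto
  have "det Y = (det C)\<^sup>2" using C(2) by (metis det_mul power2_eq_square)
  then have "sqrt (det Y) = det C" using dC by simp
  moreover have "det A = 1 / det C" using dd dC by (simp add: field_simps)
  ultimately show "1 / \<bar>det A\<bar> = sqrt (det Y)" using dC by simp
qed

lemma matrix_inv_mat_1: "matrix_inv (mat 1) = (mat 1 :: real ^ 'm ^ 'm)"
  using matrix_inv_right[of "mat 1 :: real ^ 'm ^ 'm"] by simp

text \<open>Given \<open>Y\<close>, the columns of the first sample are transformed by \<open>Y^(-1/2)\<close>; so the Jacobian of a
  congruence on the space of symmetric matrices is not needed.\<close>

lemma nn_integral_wishart_congruence: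
  fixes G :: "real ^ ('m::{finite,linorder}) ^ ('m::{finite,linorder}) \<Rightarrow> ennreal"
  assumes n: "CARD('m) \<le> n" and G[measurable]: "G \<in> borel_measurable borel" and Y: "pd_matrix Y"
  shows "(\<integral>\<^sup>+X. G (matrix_inv (matrix_sqrt Y) ** X ** matrix_inv (matrix_sqrt Y)) \<partial>wishart n (mat 1)) =
    ennreal (mvnormal_const (mat 1 :: ((real, 'm) vec, 'm) vec) ^ n * gram_const CARD('m) n) * (ennreal (det Y powr (real n / 2)) *
    (\<integral>\<^sup>+X. G X * exp_inner Y X * pd_det_powr ((real n - real CARD('m) - 1) / 2) X \<partial>sym_lborel))"
proof -
  let ?k = "mvnormal_const (mat 1 :: ((real, 'm) vec, 'm) vec) ^ n" and ?N = "{..<n}"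
  let ?\<alpha> = "(real n - real CARD('m) - 1) / 2"
  have [measurable_cong]: "sets sym_lborel = sets (borel :: (real ^ ('m::{finite,linorder}) ^ ('m::{finite,linorder})) measure)"
    by (simp add: sym_lborel_def)
  have k: "?k \<ge> 0" by (simp add: mvnormal_const_nonneg)
  have gc: "gram_const CARD('m) n \<ge> 0" using gram_const_pos[OF n] by simp
  define A where "A = matrix_inv (matrix_sqrt Y)"
  have A: "transpose A = A" "A ** Y ** A = mat 1" "1 / \<bar>det A\<bar> = sqrt (det Y)" "det A \<noteq> 0"
    unfolding A_def using transpose_inv_sqrt[OF Y] inv_sqrt_mult[OF Y] det_inv_sqrt[OF Y] by auto
  define Q where "Q z = G (scatter ?N z) * ennreal (?k * exp (- (Y \<bullet> scatter ?N z) / 2))" for z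
  have Q: "Q \<in> borel_measurable (PiM ?N (\<lambda>_. lborel))" unfolding Q_def by measurable
  have GA: "(\<lambda>X. G (A ** X ** A)) \<in> borel_measurable borel" by measurable
  have int: "G (A ** scatter ?N z ** A) * ennreal (?k * exp (- (matrix_inv (mat 1) \<bullet> scatter ?N z) / 2)) =
      Q (\<lambda>k\<in>?N. A *v z k)" for z
  proof -
    have "(A *v x) \<bullet> (Y *v (A *v x)) = x \<bullet> x" for x
    proof -
      have "(A *v x) \<bullet> (Y *v (A *v x)) = x \<bullet> (A *v (Y *v (A *v x)))"
        by (rule inner_matrix_vector_mult_symmetric[OF A(1), symmetric])
      also have "\<dots> = x \<bullet> ((A ** Y ** A) *v x)" by (simp only: matrix_vector_mul_assoc matrix_mul_assoc)
      finally show ?thesis by (simp add: A(2))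
    qed
    then have "Y \<bullet> scatter ?N (\<lambda>k\<in>?N. A *v z k) = matrix_inv (mat 1) \<bullet> scatter ?N z"
      by (simp add: inner_scatter matrix_inv_mat_1)
    then show ?thesis
      unfolding Q_def by (simp add: scatter_matrix_vector_mult A(1))
  qed
  have "(\<integral>\<^sup>+X. G (A ** X ** A) \<partial>wishart n (mat 1)) = (\<integral>\<^sup>+z. Q (\<lambda>k\<in>?N. A *v z k) \<partial>PiM ?N (\<lambda>_. lborel))"
    unfolding nn_integral_wishart_scatter[OF GA] int ..
  also have "\<dots> = ennreal ((1 / \<bar>det A\<bar>) ^ card ?N) * (\<integral>\<^sup>+z. Q z \<partial>PiM ?N (\<lambda>_. lborel))"
    by (rule nn_integral_PiM_matrix_vector_mult[OF _ A(4) Q]) simp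
  also have "(1 / \<bar>det A\<bar>) ^ card ?N = det Y powr (real n / 2)"
    using pd_matrix_det_pos[OF Y] by (simp add: A(3) powr_half_sqrt[symmetric] powr_power)
  also have "(\<integral>\<^sup>+z. Q z \<partial>PiM ?N (\<lambda>_. lborel)) = ennreal (gram_const CARD('m) n) *
      (\<integral>\<^sup>+X. G X * ennreal (?k * exp (- (Y \<bullet> X) / 2)) * pd_det_powr ?\<alpha> X \<partial>sym_lborel)"
    using nn_integral_scatter[of ?N "\<lambda>X. G X * ennreal (?k * exp (- (Y \<bullet> X) / 2))"] n unfolding Q_def by simp
  also have "(\<integral>\<^sup>+X. G X * ennreal (?k * exp (- (Y \<bullet> X) / 2)) * pd_det_powr ?\<alpha> X \<partial>sym_lborel) =
      (\<integral>\<^sup>+X. ennreal ?k * (G X * exp_inner Y X * pd_det_powr ?\<alpha> X) \<partial>sym_lborel)"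
    using k by (intro nn_integral_cong) (simp add: ennreal_mult mult_ac)
  also have "\<dots> = ennreal ?k * (\<integral>\<^sup>+X. G X * exp_inner Y X * pd_det_powr ?\<alpha> X \<partial>sym_lborel)"
    by (rule nn_integral_cmult) measurable
  finally show ?thesis using k gc by (simp add: ennreal_mult mult_ac A_def)
qed

text \<open>One Gaussian integral over \<open>n\<close> columns is evaluated twice, column by column
  and through the law of the Gram matrix. The comparison is the multivariate gamma integral on the
  cone.\<close>

lemma nn_integral_exp_inner_sym_lborel:
  fixes B :: "real ^ ('m::{finite,linorder}) ^ ('m::{finite,linorder})"
  assumes n: "CARD('m) \<le> n" and B: "pd_matrix B"
  shows "(\<integral>\<^sup>+Y. exp_inner B Y * pd_det_powr ((real n - real CARD('m) - 1) / 2) Y \<partial>sym_lborel) =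
    ennreal (((2 * pi) powr (real CARD('m) / 2) / sqrt (det B)) ^ n / gram_const CARD('m) n)"
proof -
  let ?c = "gram_const CARD('m) n" and ?g = "((2 * pi) powr (real CARD('m) / 2) / sqrt (det B)) ^ n"
  let ?J = "\<integral>\<^sup>+Y. exp_inner B Y * pd_det_powr ((real n - real CARD('m) - 1) / 2) Y \<partial>sym_lborel"
  have c: "?c > 0" by (rule gram_const_pos[OF n])
  have "ennreal ?g = ennreal ?c * ?J"
    using nn_integral_exp_inner_scatter[OF B, of "{..<n}"] nn_integral_scatter[of "{..<n}" "\<lambda>X. exp_inner B X"] n
    by simp
  then have "ennreal (1 / ?c) * ennreal ?g = ennreal (1 / ?c) * ennreal ?c * ?J" by (simp add: mult.assoc)
  moreover have "ennreal (1 / ?c) * ennreal ?c = 1" using c by (simp add: ennreal_mult[symmetric])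
  moreover have "ennreal (1 / ?c) * ennreal ?g = ennreal (?g / ?c)"
    using c by (simp add: ennreal_mult'[symmetric])
  ultimately show ?thesis by simp
qed

text \<open>\<open>sym_lborel\<close> is a push-forward, so the exchange takes place on the product
  over the upper coordinates, where sigma-finiteness is known.\<close>

lemma nn_integral_sym_lborel_swap:
  fixes f :: "real ^ ('m::{finite,linorder}) ^ ('m::{finite,linorder}) \<Rightarrow> real ^ ('m::{finite,linorder}) ^ ('m::{finite,linorder}) \<Rightarrow> ennreal"
  assumes f[measurable]: "(\<lambda>(Y, X). f Y X) \<in> borel_measurable (borel \<Otimes>\<^sub>M borel)"
  shows "(\<integral>\<^sup>+Y. \<integral>\<^sup>+X. f Y X \<partial>sym_lborel \<partial>sym_lborel) = (\<integral>\<^sup>+X. \<integral>\<^sup>+Y. f Y X \<partial>sym_lborel \<partial>sym_lborel)"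
proof -
  let ?P = "lborel_PiM {(i :: 'm, j). i \<le> j}"
  note s[measurable] = measurable_sym_of_upper[where 'm='m]
  have sf: "sigma_finite_measure ?P" by (rule sigma_finite_lborel_PiM) simp
  interpret sigma_finite_measure ?P by (rule sf)
  interpret P: pair_sigma_finite ?P ?P by (intro pair_sigma_finite.intro sf)
  have d: "(\<integral>\<^sup>+X. h X \<partial>sym_lborel) = (\<integral>\<^sup>+u. h (sym_of_upper u) \<partial>?P)" if "h \<in> borel_measurable borel" for h
    unfolding sym_lborel_def using that by (intro nn_integral_distr[OF s]) simp
  have f1: "(\<lambda>X. f Y X) \<in> borel_measurable borel" and f2: "(\<lambda>Y. f Y X) \<in> borel_measurable borel" for X Y
    by measurable
  have "(\<integral>\<^sup>+Y. \<integral>\<^sup>+X. f Y X \<partial>sym_lborel \<partial>sym_lborel) = (\<integral>\<^sup>+v. \<integral>\<^sup>+u. f (sym_of_upper v) (sym_of_upper u) \<partial>?P \<partial>?P)"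
    unfolding d[OF f1] by (rule d) measurable
  also have "\<dots> = (\<integral>\<^sup>+u. \<integral>\<^sup>+v. f (sym_of_upper v) (sym_of_upper u) \<partial>?P \<partial>?P)"
    by (rule P.Fubini') measurable
  also have "\<dots> = (\<integral>\<^sup>+X. \<integral>\<^sup>+Y. f Y X \<partial>sym_lborel \<partial>sym_lborel)"
    unfolding d[OF f2] by (rule d[symmetric]) measurable
  finally show ?thesis .
qed

section \<open>The ratio of two Wishart matrices\<close>

text \<open>Here \<open>s\<close> stands for det S and \<open>b\<close> for det (I + S U), so that
  \<open>b / s\<close> is det (S^(-1) + U). The powers of \<open>2 * pi\<close> cancel because n1 +
  n2 normalising constants meet n1 + n2 Gaussian integrals; the powers of pi cancel because their
  exponent in \<open>gram_const\<close> is additive in n; and \<open>s\<close> keeps the exponent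
  (n1 + n2)/2 - n2/2 = n1/2.\<close>

lemma beta_const_eq:
  fixes m n1 n2 :: nat and s b :: real
  assumes n: "m \<le> n1" "m \<le> n2" and pos: "s > 0" "b > 0"
  defines "k \<equiv> (2 * pi) powr (- real m / 2)"
  shows "(k * s powr (- 1 / 2)) ^ n2 * gram_const m n2 * (k ^ n1 * gram_const m n1) *
      (((2 * pi) powr (real m / 2) / sqrt (b / s)) ^ (n1 + n2) / gram_const m (n1 + n2)) =
    multivariate_gamma m (real (n1 + n2) / 2) * s powr (real n1 / 2)
      / (multivariate_gamma m (real n1 / 2) * multivariate_gamma m (real n2 / 2))
      * b powr (- real (n1 + n2) / 2)"
proof -
  define w where "w = (2 * pi) powr (real m / 2)"
  define g where "g n = multivariate_gamma m (real n / 2)" for n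
  have w: "w > 0" by (simp add: w_def)
  have kw: "k = 1 / w" by (simp add: k_def w_def powr_minus_divide)
  have g: "g n > 0" if "m \<le> n" for n
  proof -
    have "gram_const m n > 0" by (rule gram_const_pos[OF that])
    then show ?thesis by (simp add: gram_const_eq[OF that] g_def zero_less_divide_iff)
  qed
  have gc: "gram_const m n = pi powr (real n * real m / 2) / g n" if "m \<le> n" for n
    using gram_const_eq[OF that] by (simp add: g_def)
  have pp: "pi powr (real (n1 + n2) * real m / 2) = pi powr (real n1 * real m / 2) * pi powr (real n2 * real m / 2)"
    by (simp add: powr_add[symmetric] field_simps)
  have sq: "sqrt (b / s) ^ (n1 + n2) = b powr (real (n1 + n2) / 2) / s powr (real (n1 + n2) / 2)"
    using pos by (simp add: real_sqrt_divide power_divide powr_half_sqrt[symmetric] powr_power)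
  have s2: "(s powr (- 1 / 2)) ^ n2 = s powr (- real n2 / 2)"
    using pos by (simp add: powr_power)
  have s3: "s powr (- real n2 / 2) * s powr (real (n1 + n2) / 2) = s powr (real n1 / 2)"
    by (simp add: powr_add[symmetric] add_divide_distrib)
  have b1: "b powr (- real (n1 + n2) / 2) = 1 / b powr (real (n1 + n2) / 2)"
    by (simp only: minus_divide_left[symmetric] powr_minus_divide)
  have gs: "g n1 > 0" "g n2 > 0" "g (n1 + n2) > 0" using g n by auto
  define p1 p2 where "p1 = pi powr (real n1 * real m / 2)" and "p2 = pi powr (real n2 * real m / 2)"
  have ps: "p1 > 0" "p2 > 0" by (simp_all add: p1_def p2_def)
  have gc': "gram_const m n1 = p1 / g n1" "gram_const m n2 = p2 / g n2" "gram_const m (n1 + n2) = p1 * p2 / g (n1 + n2)"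
    using gc n pp by (simp_all add: p1_def p2_def)
  define B where "B = b powr (real (n1 + n2) / 2)"
  define T where "T = s powr (real (n1 + n2) / 2)"
  have BT: "B > 0" "T > 0" using pos by (simp_all add: B_def T_def)
  have "(k * s powr (- 1 / 2)) ^ n2 * gram_const m n2 * (k ^ n1 * gram_const m n1) *
      (((2 * pi) powr (real m / 2) / sqrt (b / s)) ^ (n1 + n2) / gram_const m (n1 + n2)) =
      ((1 / w) ^ n2 * s powr (- real n2 / 2)) * (p2 / g n2) * ((1 / w) ^ n1 * (p1 / g n1)) *
      (w ^ (n1 + n2) / (B / T) / (p1 * p2 / g (n1 + n2)))"
    by (simp only: kw gc' power_mult_distrib s2 power_divide sq w_def[symmetric] B_def[symmetric] T_def[symmetric])
  also have "\<dots> = g (n1 + n2) * (s powr (- real n2 / 2) * T) / (g n1 * g n2) * (1 / B)"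
    using w gs ps BT by (simp add: field_simps power_add)
  also have "\<dots> = g (n1 + n2) * s powr (real n1 / 2) / (g n1 * g n2) * b powr (- real (n1 + n2) / 2)"
    by (simp only: T_def s3 b1 B_def)
  finally show ?thesis by (simp only: g_def)
qed

text \<open>The inner integral is the conditional expectation of g(U) given the second matrix.
  Sigma-finiteness of the inner measure yields its measurability in \<open>Y\<close>; for the law of
  a random matrix it is automatic.\<close>

lemma nn_integral_wishart_ratio:
  fixes g :: "real ^ ('m::{finite,linorder}) ^ ('m::{finite,linorder}) \<Rightarrow> ennreal"
    and S :: "real ^ ('m::{finite,linorder}) ^ ('m::{finite,linorder})"
  assumes n1: "CARD('m) \<le> n1" and n2: "CARD('m) \<le> n2" and S: "pd_matrix S"
    and g[measurable]: "g \<in> borel_measurable borel"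
    and sf: "sigma_finite_measure (wishart n1 (mat 1 :: ((real, 'm) vec, 'm) vec))"
  shows "(\<integral>\<^sup>+Y. \<integral>\<^sup>+X. g (matrix_inv (matrix_sqrt Y) ** X ** matrix_inv (matrix_sqrt Y)) \<partial>wishart n1 (mat 1) \<partial>wishart n2 S) =
    (\<integral>\<^sup>+U. ennreal (if psd_matrix U then
              multivariate_gamma CARD('m) (real (n1 + n2) / 2) * det S powr (real n1 / 2)
                / (multivariate_gamma CARD('m) (real n1 / 2)
                    * multivariate_gamma CARD('m) (real n2 / 2))
              * det (mat 1 + S ** U) powr (- real (n1 + n2) / 2)
              * det U powr ((real n1 - real CARD('m) - 1) / 2)
            else 0) * g U \<partial>sym_lborel)" (is "_ = (\<integral>\<^sup>+U. ennreal (?D U) * g U \<partial>sym_lborel)")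
proof -
  let ?m = "real CARD('m)"
  let ?I = "mat 1 :: ((real, 'm) vec, 'm) vec"
  let ?a1 = "(real n1 - ?m - 1) / 2" and ?a2 = "(real n2 - ?m - 1) / 2" and ?a = "(real (n1 + n2) - ?m - 1) / 2"
  have [measurable_cong]: "sets sym_lborel = sets (borel :: ((real, 'm) vec, 'm) vec measure)"
    by (simp add: sym_lborel_def)
  have [measurable_cong]: "sets (wishart n1 ?I) = sets borel" by (simp add: wishart_def)
  interpret W1: sigma_finite_measure "wishart n1 ?I" by (rule sf)
  define c1 where "c1 = mvnormal_const ?I ^ n1 * gram_const CARD('m) n1"
  define c2 where "c2 = mvnormal_const S ^ n2 * gram_const CARD('m) n2"
  have c: "c1 \<ge> 0" "c2 \<ge> 0"
    using gram_const_pos[OF n1] gram_const_pos[OF n2] by (simp_all add: c1_def c2_def mvnormal_const_nonneg)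
  define R where "R Y = (\<integral>\<^sup>+X. g (matrix_inv (matrix_sqrt Y) ** X ** matrix_inv (matrix_sqrt Y)) \<partial>wishart n1 ?I)" for Y
  have R[measurable]: "R \<in> borel_measurable borel" unfolding R_def by measurable
  define L where "L = matrix_inv S"
  have dS: "det S > 0" by (rule pd_matrix_det_pos[OF S])
  have LS: "L ** S = mat 1" and SL: "S ** L = mat 1" unfolding L_def using dS by (auto intro: matrix_inv_left matrix_inv_right)
  have pdL: "pd_matrix L"
  proof -
    have symS: "transpose S = S" using S by (simp add: pd_matrix_def)
    have "transpose L ** S = mat 1" using arg_cong[OF SL, of transpose] symS by (simp add: matrix_transpose_mul)
    then have tL: "transpose L = L" by (metis SL matrix_mul_assoc matrix_mul_lid matrix_mul_rid)
    have "det L * det S = 1" using LS by (metis det_I det_mul)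
    then have "det L \<noteq> 0" by auto
    from pd_matrix_congruence[OF this, of S] S show ?thesis by (simp add: tL LS)
  qed
  \<comment> \<open>Up to constants and the factor \<open>g X\<close>, the joint density of the
    second matrix and of U: both exponentials are merged, and \<open>Y\<close> carries the exponent
    that belongs to n1 + n2 columns.\<close>
  define f where "f Y X = g X * pd_det_powr ?a1 X * (exp_inner (L + X) Y * pd_det_powr ?a Y)" for Y X :: "((real, 'm) vec, 'm) vec"
  have f: "(\<lambda>(Y, X). f Y X) \<in> borel_measurable (borel \<Otimes>\<^sub>M borel)"
    unfolding f_def case_prod_beta by measurable
  have point: "R Y * exp_inner L Y * pd_det_powr ?a2 Y = ennreal c1 * (\<integral>\<^sup>+X. f Y X \<partial>sym_lborel)" for Y
  proof (cases "pd_matrix Y")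
    case False
    then show ?thesis by (simp add: pd_det_powr_def f_def)
  next
    case True
    have dY: "det Y > 0" by (rule pd_matrix_det_pos[OF True])
    \<comment> \<open>The Jacobian of the n1 columns raises the exponent of \<open>det Y\<close>
      from that of n2 columns to that of n1 + n2 columns.\<close>
    have "?a = real n1 / 2 + ?a2" by (simp add: field_simps)
    then have "det Y powr ?a = det Y powr (real n1 / 2) * det Y powr ?a2" by (simp only: powr_add)
    then have pw: "ennreal (det Y powr (real n1 / 2)) * pd_det_powr ?a2 Y = pd_det_powr ?a Y"
      using True unfolding pd_det_powr_def by (simp only: if_True ennreal_mult powr_ge_zero)
    have ex: "exp_inner L Y * exp_inner Y X = exp_inner (L + X) Y" for X
      by (simp add: ennreal_mult[symmetric] exp_add[symmetric] inner_add_left inner_commute[of Y X] add_divide_distrib)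
    have "R Y * exp_inner L Y * pd_det_powr ?a2 Y = ennreal c1 * ((exp_inner L Y * (ennreal (det Y powr (real n1 / 2)) * pd_det_powr ?a2 Y)) *
        (\<integral>\<^sup>+X. g X * exp_inner Y X * pd_det_powr ?a1 X \<partial>sym_lborel))"
      unfolding R_def nn_integral_wishart_congruence[OF n1 g True] c1_def by (simp only: mult_ac)
    also have "\<dots> = ennreal c1 * (\<integral>\<^sup>+X. (exp_inner L Y * pd_det_powr ?a Y) * (g X * exp_inner Y X * pd_det_powr ?a1 X) \<partial>sym_lborel)"
      unfolding pw by (subst nn_integral_cmult) measurable
    also have "(\<lambda>X. (exp_inner L Y * pd_det_powr ?a Y) * (g X * exp_inner Y X * pd_det_powr ?a1 X)) = f Y"
      unfolding f_def ex[symmetric] by (intro ext) (simp only: mult_ac)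
    finally show ?thesis .
  qed
  have inner: "ennreal c2 * (ennreal c1 * (\<integral>\<^sup>+Y. f Y U \<partial>sym_lborel)) = ennreal (?D U) * g U" for U
  proof (cases "pd_matrix U")
    case False
    \<comment> \<open>A semidefinite matrix that is not definite is singular, and
      \<open>0 powr x = 0\<close> gives the value 0 there, even for n1 = m, where the exponent of
      \<open>det U\<close> is negative.\<close>
    have "?D U = 0"
      using False psd_matrix_det_nonzero_imp_pd_matrix[of U] by auto
    then show ?thesis using False by (simp add: f_def pd_det_powr_def)
  next
    case True
    have pdB: "pd_matrix (L + U)"
      by (rule pd_matrix_add_psd_matrix[OF pdL pd_matrix_imp_psd_matrix[OF True]])
    define b where "b = det (mat 1 + S ** U)"
    \<comment> \<open>The product \<open>S ** U\<close> is in general not symmetric; factoring out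
      \<open>S\<close> leaves the positive definite precision \<open>L + U\<close> of the Gaussian
      integral over \<open>Y\<close>.\<close>
    have "mat 1 + S ** U = S ** (L + U)" by (simp add: matrix_add_ldistrib SL)
    then have "b = det S * det (L + U)" by (simp add: b_def det_mul)
    then have b: "b > 0" "det (L + U) = b / det S"
      using dS pd_matrix_det_pos[OF pdB] by auto
    define J where "J = ((2 * pi) powr (?m / 2) / sqrt (det (L + U))) ^ (n1 + n2) / gram_const CARD('m) (n1 + n2)"
    have J0: "J \<ge> 0"
      unfolding J_def using gram_const_pos[of "CARD('m)" "n1 + n2"] n1 pd_matrix_det_pos[OF pdB] by simp
    have "(\<integral>\<^sup>+Y. f Y U \<partial>sym_lborel) = (g U * pd_det_powr ?a1 U) * (\<integral>\<^sup>+Y. exp_inner (L + U) Y * pd_det_powr ?a Y \<partial>sym_lborel)"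
      unfolding f_def by (rule nn_integral_cmult) measurable
    also have "(\<integral>\<^sup>+Y. exp_inner (L + U) Y * pd_det_powr ?a Y \<partial>sym_lborel) = ennreal J"
      unfolding J_def by (rule nn_integral_exp_inner_sym_lborel[OF _ pdB]) (use n1 in simp)
    finally have "ennreal c2 * (ennreal c1 * (\<integral>\<^sup>+Y. f Y U \<partial>sym_lborel)) =
        ennreal (c2 * c1 * J * det U powr ?a1) * g U"
      using c J0 True by (simp add: pd_det_powr_def ennreal_mult mult_ac)
    also have "c2 * c1 * J * det U powr ?a1 = ?D U"
    proof -
      have k1: "mvnormal_const ?I = (2 * pi) powr (- ?m / 2)" by (simp add: mvnormal_const_def)
      have "c2 * c1 * J = multivariate_gamma CARD('m) (real (n1 + n2) / 2) * det S powr (real n1 / 2)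
          / (multivariate_gamma CARD('m) (real n1 / 2) * multivariate_gamma CARD('m) (real n2 / 2)) * b powr (- real (n1 + n2) / 2)"
        unfolding c1_def c2_def J_def k1 unfolding mvnormal_const_def b(2)
        by (rule beta_const_eq[OF n1 n2 dS b(1)])
      then show ?thesis using pd_matrix_imp_psd_matrix[OF True] by (simp add: b_def)
    qed
    finally show ?thesis .
  qed
  define h where "h Y X = ennreal c2 * (ennreal c1 * f Y X)" for Y X
  have h: "(\<lambda>(Y, X). h Y X) \<in> borel_measurable (borel \<Otimes>\<^sub>M borel)"
    using f unfolding h_def case_prod_beta by (intro borel_measurable_times_ennreal borel_measurable_const)
  have fX: "f Y \<in> borel_measurable borel" and fY: "(\<lambda>Y. f Y X) \<in> borel_measurable borel" for X Y
    unfolding f_def by measurable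
  have hX: "(\<integral>\<^sup>+X. h Y X \<partial>sym_lborel) = ennreal c2 * (ennreal c1 * (\<integral>\<^sup>+X. f Y X \<partial>sym_lborel))" for Y
    unfolding h_def using fX[of Y] by (subst nn_integral_cmult; simp add: nn_integral_cmult)
  have hY: "(\<integral>\<^sup>+Y. h Y X \<partial>sym_lborel) = ennreal c2 * (ennreal c1 * (\<integral>\<^sup>+Y. f Y X \<partial>sym_lborel))" for X
    unfolding h_def using fY[of X] by (subst nn_integral_cmult; simp add: nn_integral_cmult)
  have "(\<integral>\<^sup>+Y. R Y \<partial>wishart n2 S) = ennreal c2 * (\<integral>\<^sup>+Y. R Y * exp_inner L Y * pd_det_powr ?a2 Y \<partial>sym_lborel)"
    unfolding c2_def L_def by (rule nn_integral_wishart[OF n2 R])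
  also have "\<dots> = (\<integral>\<^sup>+Y. ennreal c2 * (R Y * exp_inner L Y * pd_det_powr ?a2 Y) \<partial>sym_lborel)"
    by (rule nn_integral_cmult[symmetric]) measurable
  also have "\<dots> = (\<integral>\<^sup>+Y. \<integral>\<^sup>+X. h Y X \<partial>sym_lborel \<partial>sym_lborel)"
    unfolding point hX ..
  also have "\<dots> = (\<integral>\<^sup>+X. \<integral>\<^sup>+Y. h Y X \<partial>sym_lborel \<partial>sym_lborel)"
    by (rule nn_integral_sym_lborel_swap[OF h])
  also have "\<dots> = (\<integral>\<^sup>+U. ennreal (?D U) * g U \<partial>sym_lborel)"
    unfolding hY inner ..
  finally show ?thesis by (simp only: R_def)
qed

theorem theorem1:
  fixes M :: "'a measure"
    and W1 W2 :: "'a \<Rightarrow> real ^ ('m::{finite,linorder}) ^ ('m::{finite,linorder})"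
    and \<Sigma>2 :: "real ^ ('m::{finite,linorder}) ^ ('m::{finite,linorder})"
    and n1 n2 :: nat
  assumes "prob_space M"
    and "n1 \<ge> CARD('m)" and "n2 \<ge> CARD('m)"
    and "pd_matrix \<Sigma>2"
    and "prob_space.indep_var M borel W1 borel W2"
    and "distr M borel W1 = wishart n1 (mat 1)"
    and "distr M borel W2 = wishart n2 \<Sigma>2"
  shows "distributed M sym_lborel
           (\<lambda>\<omega>. matrix_inv (matrix_sqrt (W2 \<omega>)) ** W1 \<omega> ** matrix_inv (matrix_sqrt (W2 \<omega>)))
           (\<lambda>U. ennreal (if psd_matrix U then
              multivariate_gamma CARD('m) (real (n1 + n2) / 2) * det \<Sigma>2 powr (real n1 / 2)
                / (multivariate_gamma CARD('m) (real n1 / 2)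
                    * multivariate_gamma CARD('m) (real n2 / 2))
              * det (mat 1 + \<Sigma>2 ** U) powr (- real (n1 + n2) / 2)
              * det U powr ((real n1 - real CARD('m) - 1) / 2)
            else 0))"
proof -
  interpret prob_space M by fact
  let ?B = "borel :: (((real, 'm) vec, 'm) vec) measure"
  let ?h = "\<lambda>X Y :: ((real, 'm) vec, 'm) vec. matrix_inv (matrix_sqrt Y) ** X ** matrix_inv (matrix_sqrt Y)"
  let ?U = "\<lambda>\<omega>. ?h (W1 \<omega>) (W2 \<omega>)"
  let ?D = "\<lambda>U. ennreal (if psd_matrix U then
              multivariate_gamma CARD('m) (real (n1 + n2) / 2) * det \<Sigma>2 powr (real n1 / 2)
                / (multivariate_gamma CARD('m) (real n1 / 2)
                    * multivariate_gamma CARD('m) (real n2 / 2))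
              * det (mat 1 + \<Sigma>2 ** U) powr (- real (n1 + n2) / 2)
              * det U powr ((real n1 - real CARD('m) - 1) / 2)
            else 0)"
  have symB: "sets sym_lborel = sets ?B" by (simp add: sym_lborel_def)
  note [measurable_cong] = symB
  have W[measurable]: "W1 \<in> borel_measurable M" "W2 \<in> borel_measurable M"
    using assms(5) by (auto simp: indep_var_distribution_eq)
  \<comment> \<open>Independence in the form used below: the joint law is the product of the two
    marginal laws.\<close>
  have joint: "distr M borel W1 \<Otimes>\<^sub>M distr M borel W2 = distr M (borel \<Otimes>\<^sub>M borel) (\<lambda>x. (W1 x, W2 x))"
    using assms(5) by (auto simp: indep_var_distribution_eq)
  interpret P1: prob_space "distr M borel W1" by (rule prob_space_distr) measurable
  interpret P2: prob_space "distr M borel W2" by (rule prob_space_distr) measurable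
  interpret P: pair_sigma_finite "distr M borel W1" "distr M borel W2" ..
  have psdm[measurable]: "Measurable.pred ?B psd_matrix"
    using borel_closed[OF closed_psd_matrix] by (simp add: pred_def)
  have [measurable]: "(\<lambda>U. det (mat 1 + \<Sigma>2 ** U)) \<in> borel_measurable ?B"
    by (intro borel_measurable_continuous_onI continuous_intros)
  have D: "?D \<in> borel_measurable sym_lborel"
    by measurable
  have U: "?U \<in> M \<rightarrow>\<^sub>M sym_lborel" by measurable
  have "distr M sym_lborel ?U = density sym_lborel ?D"
  proof (rule measure_eqI)
    fix A assume "A \<in> sets (distr M sym_lborel ?U)"
    then have A: "A \<in> sets sym_lborel" "A \<in> sets ?B" by (simp_all add: symB)
    note [measurable] = A(2)
    have g: "indicator A \<in> borel_measurable ?B" by measurable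
    have "emeasure (distr M sym_lborel ?U) A = (\<integral>\<^sup>+U. indicator A U \<partial>distr M sym_lborel ?U)"
      using A by simp
    also have "\<dots> = (\<integral>\<^sup>+\<omega>. indicator A (?U \<omega>) \<partial>M)"
      by (rule nn_integral_distr[OF U]) (use A in simp)
    also have "\<dots> = (\<integral>\<^sup>+p. indicator A (?h (fst p) (snd p)) \<partial>(distr M borel W1 \<Otimes>\<^sub>M distr M borel W2))"
      unfolding joint by (subst nn_integral_distr) measurable
    \<comment> \<open>The second matrix is the outer variable, so that the first is integrated with
      the root of \<open>Y\<close> held fixed.\<close>
    also have "\<dots> = (\<integral>\<^sup>+Y. \<integral>\<^sup>+X. indicator A (?h X Y) \<partial>distr M borel W1 \<partial>distr M borel W2)"
      by (subst P.nn_integral_snd[symmetric]) measurable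
    also have "\<dots> = (\<integral>\<^sup>+U. ?D U * indicator A U \<partial>sym_lborel)"
      \<comment> \<open>The first Wishart measure inherits sigma-finiteness as the law of
        \<open>W1\<close>.\<close>
      unfolding assms(6,7) using P1.sigma_finite_measure_axioms
      by (intro nn_integral_wishart_ratio assms(2-4) g) (simp add: assms(6))
    also have "\<dots> = emeasure (density sym_lborel ?D) A"
      by (rule emeasure_density[OF D A(1), symmetric])
    finally show "emeasure (distr M sym_lborel ?U) A = emeasure (density sym_lborel ?D) A" .
  qed simp
  then show ?thesis using D U by (simp add: distributed_def)
qed

end
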